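(* Let $K\in\mathbb{R}^{d\times d}$ be symmetric and $f(q)=q\cdot Kq-\operatorname{Tr}K$. Put $K_0=K-\frac{\operatorname{Tr}K}{d}I$, $K_1=\frac{\operatorname{Tr}K}{d}I$, and decompose $f=f_0+f_1$ with $f_0(q)=q\cdot K_0q$ and $f_1(q)=q\cdot K_1q-\operatorname{Tr}K$. Then: (a) There exists an antisymmetric matrix $J\in\mathbb{R}^{d\times d}$ such that $\lim_{\mu\to\infty}\sigma_{f_0}^2(\mu,J)=0$, and such a $J$ can be computed from $K$ as follows: choose an orthogonal matrix $U$ such that $UK_0U^T$ has zero entries on the diagonal (such a $U$ exists), choose pairwise distinct $a_1,\dots,a_d\in\mathbb{R}$, set $\bar J_{ij}=\frac{(UK_0U^T)_{ij}}{a_i-a_j}$ for $i\ne j$ and $\bar J_{ii}=0$, and set $J=U^T\bar JU$. (b) The trace part is not affected by the perturbation: $\sigma_{f_1}^2(\mu,J)=\sigma_{f_1}^2(0)$ for all $\mu\in\mathbb{R}$ (and every antisymmetric $J$).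
   Context: For a skew-symmetric $J\in\mathbb{R}^{d\times d}$, $\gamma>0$ (fixed), $\mu\in\mathbb{R}$ and a standard $d$-dimensional Brownian motion $W$, consider on $\mathbb{R}^{2d}$ $$\mathrm{d}q_t=p_t\,\mathrm{d}t-\mu Jq_t\,\mathrm{d}t,\qquad \mathrm{d}p_t=-q_t\,\mathrm{d}t-\mu Jp_t\,\mathrm{d}t-\gamma p_t\,\mathrm{d}t+\sqrt{2\gamma}\,\mathrm{d}W_t .$$ It is ergodic with invariant measure $\widehat\pi=\mathcal{N}(0,I_{2d})$, whose $q$-marginal is $\pi=\mathcal{N}(0,I_d)$. Let $\mathcal{L}$ be the generator of its Markov semigroup on $L^2(\widehat\pi)$. For $f\in L^2(\pi)$ with $\pi(f)=0$, regarded as a function of $(q,p)$ depending on $q$ only, the asymptotic variance is $\sigma_f^2(\mu,J)=\langle\chi,f\rangle_{L^2(\widehat\pi)}$, where $\chi\in\mathcal{D}(\mathcal{L})$ is the unique solution of $-\mathcal{L}\chi=f$, $\widehat\pi(\chi)=0$. $\sigma_f^2(0)$ denotes the value at $\mu=0$ (independent of $J$). *)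

theory Defs
  imports "HOL-Probability.Probability"
begin

text \<open>The standard normal law on a Euclidean space; on \<^typ>\<open>real ^ 'n\<close> it is
  \<open>\<pi> = N(0, I\<^sub>d)\<close>, on the phase space \<^typ>\<open>(real ^ 'n) \<times> (real ^ 'n)\<close> it is
  the invariant law \<open>N(0, I\<^sub>2\<^sub>d)\<close>.\<close>

definition std_gaussian :: "'a::euclidean_space measure" where
  "std_gaussian = density lborel (\<lambda>x. ennreal (\<Prod>b\<in>Basis. normal_density 0 1 (x \<bullet> b)))"

definition brownian_motion :: "'w measure \<Rightarrow> (real \<Rightarrow> 'w \<Rightarrow> 'a::euclidean_space) \<Rightarrow> bool" where
  "brownian_motion M W \<longleftrightarrow>
     prob_space M \<and>
     (\<forall>t\<ge>0. W t \<in> borel_measurable M) \<and>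
     (AE \<omega> in M. W 0 \<omega> = 0) \<and>
     (\<forall>\<omega>\<in>space M. continuous_on {0..} (\<lambda>t. W t \<omega>)) \<and>
     (\<forall>s t. 0 \<le> s \<and> s < t \<longrightarrow>
        distributed M lborel (\<lambda>\<omega>. W t \<omega> - W s \<omega>)
          (\<lambda>x. ennreal (\<Prod>b\<in>Basis. normal_density 0 (sqrt (t - s)) (x \<bullet> b)))) \<and>
     (\<forall>(n::nat) r. 0 \<le> r 0 \<and> (\<forall>k<n. r k < r (Suc k)) \<longrightarrow>
        prob_space.indep_vars M (\<lambda>_. borel) (\<lambda>k \<omega>. W (r (Suc k)) \<omega> - W (r k) \<omega>) {..<n})"

definition langevin_drift ::
  "real \<Rightarrow> real \<Rightarrow> real ^ 'n ^ 'n \<Rightarrow> (real ^ 'n) \<times> (real ^ 'n) \<Rightarrow> (real ^ 'n) \<times> (real ^ 'n)" where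
  "langevin_drift \<gamma> \<mu> J = (\<lambda>(q, p).
     (p - \<mu> *\<^sub>R (J *v q), - q - \<mu> *\<^sub>R (J *v p) - \<gamma> *\<^sub>R p))"

text \<open>The noise is additive, so the stochastic differential equation is the following
  pathwise integral equation, driven by a path \<open>w\<close> of the Brownian motion.\<close>

definition langevin_solution ::
  "real \<Rightarrow> real \<Rightarrow> real ^ 'n ^ 'n \<Rightarrow> (real \<Rightarrow> real ^ 'n) \<Rightarrow> (real ^ 'n) \<times> (real ^ 'n)
     \<Rightarrow> (real \<Rightarrow> (real ^ 'n) \<times> (real ^ 'n)) \<Rightarrow> bool" where
  "langevin_solution \<gamma> \<mu> J w x z \<longleftrightarrow>
     continuous_on {0..} z \<and>
     (\<forall>t\<ge>0. z t = x + integral {0..t} (\<lambda>s. langevin_drift \<gamma> \<mu> J (z s))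
                     + (0, sqrt (2 * \<gamma>) *\<^sub>R w t))"

text \<open>For a continuous path \<open>w\<close> the solution is unique on \<open>[0, \<infinity>)\<close>
  (the choice operator only leaves negative times unspecified).\<close>

definition langevin_flow ::
  "real \<Rightarrow> real \<Rightarrow> real ^ 'n ^ 'n \<Rightarrow> (real \<Rightarrow> real ^ 'n) \<Rightarrow> (real ^ 'n) \<times> (real ^ 'n)
     \<Rightarrow> real \<Rightarrow> (real ^ 'n) \<times> (real ^ 'n)" where
  "langevin_flow \<gamma> \<mu> J w x = (SOME z. langevin_solution \<gamma> \<mu> J w x z)"

definition langevin_semigroup ::
  "'w measure \<Rightarrow> (real \<Rightarrow> 'w \<Rightarrow> real ^ 'n) \<Rightarrow> real \<Rightarrow> real \<Rightarrow> real ^ 'n ^ 'n \<Rightarrow> real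
     \<Rightarrow> ((real ^ 'n) \<times> (real ^ 'n) \<Rightarrow> real) \<Rightarrow> (real ^ 'n) \<times> (real ^ 'n) \<Rightarrow> real" where
  "langevin_semigroup M W \<gamma> \<mu> J t f x =
     (\<integral>\<omega>. f (langevin_flow \<gamma> \<mu> J (\<lambda>s. W s \<omega>) x t) \<partial>M)"

definition square_integrable :: "'a measure \<Rightarrow> ('a \<Rightarrow> real) \<Rightarrow> bool" where
  "square_integrable N f \<longleftrightarrow> f \<in> borel_measurable N \<and> integrable N (\<lambda>x. (f x)\<^sup>2)"

text \<open>\<open>L2_generator N P f g\<close>: \<open>f\<close> lies in the domain of the generator of the semigroup \<open>P\<close>
  on \<open>L\<^sup>2(N)\<close> and the generator maps \<open>f\<close> to \<open>g\<close>. It is a relation because elements of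
  \<open>L\<^sup>2(N)\<close> are represented by functions, which are determined only almost everywhere. The
  squared distance is a nonnegative integral, so that it is infinite (and not \<open>0\<close>)
  if the difference is not square integrable.\<close>

definition L2_generator ::
  "'a measure \<Rightarrow> (real \<Rightarrow> ('a \<Rightarrow> real) \<Rightarrow> 'a \<Rightarrow> real) \<Rightarrow> ('a \<Rightarrow> real) \<Rightarrow> ('a \<Rightarrow> real) \<Rightarrow> bool" where
  "L2_generator N P f g \<longleftrightarrow>
     square_integrable N f \<and> square_integrable N g \<and>
     ((\<lambda>t. \<integral>\<^sup>+x. ennreal (((P t f x - f x) / t - g x)\<^sup>2) \<partial>N) \<longlongrightarrow> 0) (at_right 0)"

definition poisson_solution ::
  "'w measure \<Rightarrow> (real \<Rightarrow> 'w \<Rightarrow> real ^ 'n) \<Rightarrow> real \<Rightarrow> real \<Rightarrow> real ^ 'n ^ 'n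
     \<Rightarrow> (real ^ 'n \<Rightarrow> real) \<Rightarrow> ((real ^ 'n) \<times> (real ^ 'n) \<Rightarrow> real) \<Rightarrow> bool" where
  "poisson_solution M W \<gamma> \<mu> J f u \<longleftrightarrow>
     L2_generator std_gaussian (langevin_semigroup M W \<gamma> \<mu> J) u (\<lambda>(q, p). - f q) \<and>
     (\<integral>x. u x \<partial>std_gaussian) = 0"

text \<open>The solution of the Poisson equation is unique up to null sets,
  which the inner product does not see.\<close>

definition asymptotic_variance ::
  "'w measure \<Rightarrow> (real \<Rightarrow> 'w \<Rightarrow> real ^ 'n) \<Rightarrow> real \<Rightarrow> (real ^ 'n \<Rightarrow> real) \<Rightarrow> real
     \<Rightarrow> real ^ 'n ^ 'n \<Rightarrow> real" where
  "asymptotic_variance M W \<gamma> f \<mu> J =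
     (\<integral>x. (SOME u. poisson_solution M W \<gamma> \<mu> J f u) x * f (fst x) \<partial>std_gaussian)"

definition antisymmetric :: "real ^ 'n ^ 'n \<Rightarrow> bool" where
  "antisymmetric J \<longleftrightarrow> transpose J = - J"

end

theory Submission
  imports Defs
begin

text \<open>Write the drift as \<open>A = S - \<gamma> \<Pi>\<close> with \<open>S\<close> skew and \<open>\<Pi>\<close> the projection to the momentum,
  and let \<open>\<Phi>\<^sub>t\<close> be the flow of \<open>A\<close>. A quadratic \<open>\<chi>\<close> solves the Poisson equation for a quadratic
  \<open>f\<close> when its matrix solves a Lyapunov equation. The choice of the solution does not matter: if
  \<open>-L\<^sup>* \<chi>' = f\<close>, then \<open>\<langle>u, f\<rangle> = \<langle>f, \<chi>'\<rangle>\<close> for every solution \<open>u\<close>. Both facts need only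
  the action of the semigroup and of its adjoint on quadratic functions, and these follow from a
  splitting scheme, each step of which is an orthogonal map after an Ornstein--Uhlenbeck step with
  explicit adjoint; the scheme converges pathwise.

  In the blocks \<open>a, b, c\<close> of the dual Lyapunov equation the variance is \<open>2 \<langle>a, K\<rangle>\<close>. If
  \<open>K = [J, G]\<close>, the energy identity \<open>\<langle>a, K\<rangle> = 2 \<gamma> (|b|\<^sup>2 + |c|\<^sup>2)\<close> and
  \<open>\<mu> \<langle>a, K\<rangle> = 2 \<langle>b, G\<rangle>\<close> bound it by \<open>4 |G|\<^sup>2 / (\<gamma> \<mu>\<^sup>2)\<close>. The construction of \<open>J\<close> makes \<open>K\<^sub>0\<close> such a
  commutator. If \<open>K\<close> is scalar, \<open>a\<close> depends on neither \<open>\<mu>\<close> nor \<open>J\<close>.\<close>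

section \<open>The Lyapunov equation\<close>

text \<open>\<open>SOME\<close> may return any \<open>L\<^sup>2\<close> solution \<open>u\<close>,
  so neither \<open>u\<close> nor its image under the semigroup is explicit. Hence \<open>u\<close>
  is only tested against a quadratic function, and the duality behind this must hold for every
  square integrable \<open>u\<close>. The scheme gives it for bounded continuous test functions; it
  reaches \<open>u\<close> once rephrased as an identity between finite measures. The weights
  \<open>(v \<bullet> x)\<^sup>2 + k\<close> are nonnegative, which keeps the limits inside measure
  theory; polarization then yields general quadratic functions. The dual Lyapunov equation carries
  \<open>- \<mu>\<close> because reversing the momentum turns the adjoint drift into the drift with
  \<open>\<mu>\<close> negated. The decay has order 1/\<mu>^2 because |b| can be cancelled once:
  energy makes the pairing of \<open>a\<close> and \<open>K\<close> at least 2 \<gamma> |b|^2, while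
  testing with \<open>G\<close> makes it at most 2 |b| |G| / |\<mu>|. So |b| is at most |G| /
  (\<gamma> |\<mu>|), and inserting this again gives the bound. A nonzero matrix commuting with
  \<open>J\<close> is orthogonal to every commutator with \<open>J\<close>, so no such
  \<open>G\<close> exists for the trace part.\<close>

lemma inner_eq_trace: "A \<bullet> B = trace (transpose A ** B)" for A B :: "real ^ 'n ^ 'm"
  unfolding inner_vec_def trace_def matrix_matrix_mult_def transpose_def by (simp, rule sum.swap)

lemma matrix_mult_inner_left:
  fixes A :: "real ^ 'n ^ 'm" and B :: "real ^ 'k ^ 'n"
  shows "(A ** B) \<bullet> C = B \<bullet> (transpose A ** C)"
  by (simp add: inner_eq_trace matrix_transpose_mul matrix_mul_assoc)

lemma transpose_inner: "transpose A \<bullet> transpose B = A \<bullet> (B :: real ^ 'n ^ 'm)"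
  unfolding inner_vec_def transpose_def by (simp, rule sum.swap)

lemma matrix_mult_inner_right:
  fixes A :: "real ^ 'n ^ 'm" and B :: "real ^ 'k ^ 'n"
  shows "(A ** B) \<bullet> C = A \<bullet> (C ** transpose B)"
  using matrix_mult_inner_left[of "transpose B" "transpose A" "transpose C"]
  by (metis matrix_transpose_mul transpose_inner transpose_transpose)

lemma transpose_diff: "transpose (A - B) = transpose A - transpose (B :: real ^ 'n ^ 'm)"
  by (simp add: transpose_def vec_eq_iff)

lemma matrix_diff_ldistrib: "A ** (B - C) = A ** B - A ** (C :: real ^ 'k ^ 'n)"
  for A :: "real ^ 'n ^ 'm"
  by (simp add: matrix_matrix_mult_def vec_eq_iff right_diff_distrib sum_subtractf)

lemma matrix_diff_rdistrib: "(B - C) ** A = B ** A - C ** A"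
  for A :: "real ^ 'k ^ 'n" and B C :: "real ^ 'n ^ 'm"
  by (simp add: matrix_matrix_mult_def vec_eq_iff left_diff_distrib sum_subtractf)

lemma matrix_add_rdistrib: "(B + C) ** A = B ** A + C ** A"
  for A :: "real ^ 'k ^ 'n" and B C :: "real ^ 'n ^ 'm"
  by (simp add: matrix_matrix_mult_def vec_eq_iff distrib_right sum.distrib)

lemma matrix_mult_minus: "(- A) ** B = - (A ** B)" "A ** (- B) = - (A ** B)"
  for A :: "real ^ 'n ^ 'm" and B :: "real ^ 'k ^ 'n"
  by (simp_all add: matrix_matrix_mult_def vec_eq_iff sum_negf)

lemma matrix_mult_scaleR: "(r *\<^sub>R A) ** B = r *\<^sub>R (A ** B)" "A ** (r *\<^sub>R B) = r *\<^sub>R (A ** B)"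
  for A :: "real ^ 'n ^ 'm" and B :: "real ^ 'k ^ 'n"
  by (simp_all add: matrix_matrix_mult_def vec_eq_iff sum_distrib_left mult_ac)

definition commutator :: "real ^ 'n ^ 'n \<Rightarrow> real ^ 'n ^ 'n \<Rightarrow> real ^ 'n ^ 'n" where
  "commutator J X = J ** X - X ** J"

lemma linear_commutator: "linear (commutator J)"
  unfolding commutator_def
  by (rule linearI) (simp_all add: matrix_add_ldistrib matrix_add_rdistrib matrix_mult_scaleR scaleR_right_diff_distrib)

text \<open>Left and right multiplication by a skew matrix are both skew for the Frobenius inner
  product, hence so is their difference. This removes every \<open>\<mu>\<close> term from the
  energy identity.\<close>

lemma commutator_skew:
  assumes "antisymmetric J"
  shows "commutator J X \<bullet> Y = - (X \<bullet> commutator J Y)"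
  using assms unfolding antisymmetric_def commutator_def
  by (simp add: inner_diff_left inner_diff_right matrix_mult_inner_left[of J X]
      matrix_mult_inner_right[of X J] matrix_mult_minus)

lemma commutator_self:
  assumes "antisymmetric J"
  shows "commutator J X \<bullet> X = 0"
  using commutator_skew[OF assms, of X X] by (simp add: inner_commute)

text \<open>The block form of the Lyapunov equation for a quadratic solution
  \<open>q \<bullet> a q + 2 q \<bullet> b p + p \<bullet> c p\<close> of the Poisson equation.\<close>

definition lyapunov_blocks ::
  "real \<Rightarrow> real \<Rightarrow> real ^ 'n ^ 'n \<Rightarrow> real ^ 'n ^ 'n
    \<Rightarrow> real ^ 'n ^ 'n \<Rightarrow> real ^ 'n ^ 'n \<Rightarrow> real ^ 'n ^ 'n \<Rightarrow> bool" where
  "lyapunov_blocks \<gamma> \<mu> J K a b c \<longleftrightarrow>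
     \<mu> *\<^sub>R commutator J a - 2 *\<^sub>R b = - K \<and>
     \<mu> *\<^sub>R commutator J b + a - c - \<gamma> *\<^sub>R b = 0 \<and>
     2 *\<^sub>R b + \<mu> *\<^sub>R commutator J c - (2 * \<gamma>) *\<^sub>R c = 0"

text \<open>Pairing the three equations with \<open>a\<close>, \<open>b\<close>, \<open>c\<close>
  kills the commutators and leaves \<open>a \<bullet> K = 2 * (a \<bullet> b)\<close>,
  \<open>a \<bullet> b = c \<bullet> b + \<gamma> * (b \<bullet> b)\<close> and
  \<open>b \<bullet> c = \<gamma> * (c \<bullet> c)\<close>.\<close>

lemma lyapunov_blocks_energy:
  assumes J: "antisymmetric J" and L: "lyapunov_blocks \<gamma> \<mu> J K a b c"
  shows "a \<bullet> K = 2 * \<gamma> * (b \<bullet> b + c \<bullet> c)"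
proof -
  have "(\<mu> *\<^sub>R commutator J a - 2 *\<^sub>R b) \<bullet> a = - (K \<bullet> a)"
    and "(\<mu> *\<^sub>R commutator J b + a - c - \<gamma> *\<^sub>R b) \<bullet> b = 0"
    and "(2 *\<^sub>R b + \<mu> *\<^sub>R commutator J c - (2 * \<gamma>) *\<^sub>R c) \<bullet> c = 0"
    using L unfolding lyapunov_blocks_def by auto
  then show ?thesis
    by (simp add: inner_diff_left inner_add_left commutator_self[OF J] inner_commute[of c b]
        inner_commute[of b a] inner_commute[of K a] algebra_simps)
qed

text \<open>The system is linear with as many equations as unknowns, so injectivity suffices. For
  \<open>K = 0\<close> the energy identity forces \<open>b = c = 0\<close>, and the second equation
  then gives \<open>a = 0\<close>.\<close>

lemma lyapunov_blocks_exists: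
  assumes J: "antisymmetric J" and g: "\<gamma> > 0"
  obtains a b c where "lyapunov_blocks \<gamma> \<mu> J K a b c"
proof -
  define T where "T = (\<lambda>(a, b, c). (\<mu> *\<^sub>R commutator J a - 2 *\<^sub>R b,
     \<mu> *\<^sub>R commutator J b + a - c - \<gamma> *\<^sub>R b,
     2 *\<^sub>R b + \<mu> *\<^sub>R commutator J c - (2 * \<gamma>) *\<^sub>R c))"
  interpret C: linear "commutator J" by (rule linear_commutator)
  have lin: "linear T"
    unfolding T_def by (rule linearI) (auto simp: C.add C.scaleR algebra_simps)
  have "inj T"
  proof (rule linear_injective_0[OF lin, THEN iffD2], clarify)
    fix a b c assume "T (a, b, c) = 0"
    then have L: "lyapunov_blocks \<gamma> \<mu> J 0 a b c"
      by (simp add: T_def lyapunov_blocks_def zero_prod_def)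
    have "b \<bullet> b + c \<bullet> c = 0"
      using lyapunov_blocks_energy[OF J L] g by simp
    then have "b = 0" "c = 0"
      by (simp_all add: add_nonneg_eq_0_iff)
    with L show "(a, b, c) = 0"
      by (simp add: lyapunov_blocks_def C.zero zero_prod_def)
  qed
  then have "surj T"
    using eucl.linear_inj_imp_surj[OF lin] by blast
  then obtain x where "T x = (- K, 0, 0)"
    by (metis surjD)
  then show ?thesis
    using that by (cases x) (auto simp: T_def lyapunov_blocks_def)
qed

lemma lyapunov_blocks_range_bound:
  assumes J: "antisymmetric J" and g: "\<gamma> > 0" and m: "\<mu> \<noteq> 0"
    and L: "lyapunov_blocks \<gamma> \<mu> J (commutator J G) a b c"
  shows "\<bar>a \<bullet> commutator J G\<bar> \<le> 2 * (norm G)\<^sup>2 / (\<gamma> * \<mu>\<^sup>2)"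
proof -
  \<comment> \<open>The first equation is tested on \<open>G\<close>. Its right-hand side
    contributes nothing, since \<open>commutator J G\<close> is orthogonal to
    \<open>G\<close>.\<close>
  have "\<mu> * (a \<bullet> commutator J G) = - ((\<mu> *\<^sub>R commutator J a) \<bullet> G)"
    by (simp add: commutator_skew[OF J, of a])
  also have "\<mu> *\<^sub>R commutator J a = 2 *\<^sub>R b - commutator J G"
    using L by (simp add: lyapunov_blocks_def algebra_simps)
  finally have eq: "\<mu> * (a \<bullet> commutator J G) = - 2 * (b \<bullet> G)"
    by (simp add: inner_diff_left commutator_self[OF J])
  have en: "a \<bullet> commutator J G = 2 * \<gamma> * (b \<bullet> b + c \<bullet> c)"
    by (rule lyapunov_blocks_energy[OF J L])
  have "\<bar>\<mu>\<bar> * \<bar>a \<bullet> commutator J G\<bar> = 2 * \<bar>b \<bullet> G\<bar>"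
    using arg_cong[OF eq, of abs] by (simp add: abs_mult)
  also have "\<bar>b \<bullet> G\<bar> \<le> norm b * norm G"
    by (rule Cauchy_Schwarz_ineq2)
  finally have bd: "\<bar>\<mu>\<bar> * \<bar>a \<bullet> commutator J G\<bar> \<le> 2 * (norm b * norm G)" by simp
  have "\<bar>\<mu>\<bar> * (2 * \<gamma> * (norm b)\<^sup>2) \<le> \<bar>\<mu>\<bar> * \<bar>a \<bullet> commutator J G\<bar>"
    using g by (intro mult_left_mono) (auto simp: en power2_norm_eq_inner)
  with bd have "(\<bar>\<mu>\<bar> * \<gamma> * norm b) * norm b \<le> norm G * norm b"
    by (simp add: power2_eq_square mult_ac)
  \<comment> \<open>One factor \<open>norm b\<close> cancels between the lower bound from the energy
    and the upper bound from Cauchy-Schwarz.\<close>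
  then have nb: "\<bar>\<mu>\<bar> * \<gamma> * norm b \<le> norm G"
    by (cases "norm b = 0") auto
  have "(\<gamma> * \<mu>\<^sup>2) * \<bar>a \<bullet> commutator J G\<bar> = (\<gamma> * \<bar>\<mu>\<bar>) * (\<bar>\<mu>\<bar> * \<bar>a \<bullet> commutator J G\<bar>)"
    by (simp add: power2_eq_square)
  also have "\<dots> \<le> (\<gamma> * \<bar>\<mu>\<bar>) * (2 * (norm b * norm G))"
    using g bd by (intro mult_left_mono) auto
  also have "\<dots> = 2 * (\<bar>\<mu>\<bar> * \<gamma> * norm b) * norm G" by simp
  also have "\<dots> \<le> 2 * norm G * norm G"
    using nb by (intro mult_right_mono) auto
  finally have "\<bar>a \<bullet> commutator J G\<bar> * (\<gamma> * \<mu>\<^sup>2) \<le> 2 * (norm G)\<^sup>2"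
    by (simp only: mult_ac power2_eq_square)
  then show ?thesis
    using g m by (subst pos_le_divide_eq) auto
qed

text \<open>Multiples of the identity commute with \<open>J\<close>, so the system reduces to the
  scalar equations 2 b = k, a = c + \<gamma> b and b = \<gamma> c, whose solution supplies the
  coefficients.\<close>

lemma lyapunov_blocks_scalar:
  assumes g: "\<gamma> > 0"
  shows "lyapunov_blocks \<gamma> \<mu> J (k *\<^sub>R mat 1) ((k * (1 / (2 * \<gamma>) + \<gamma> / 2)) *\<^sub>R mat 1)
    ((k / 2) *\<^sub>R mat 1) ((k / (2 * \<gamma>)) *\<^sub>R mat 1)"
proof -
  have [simp]: "commutator J (r *\<^sub>R mat 1) = 0" for r
    by (simp add: commutator_def matrix_mult_scaleR)
  show ?thesis
    using g unfolding lyapunov_blocks_def by (simp add: algebra_simps flip: scaleR_add_left)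
qed

section \<open>Zero-diagonal form of a trace-free matrix, and its representation as a
  commutator\<close>

lemma orthonormal_zero_diagonal:
  fixes K :: "'a::real_inner \<Rightarrow> 'a" and v :: "'n::finite \<Rightarrow> 'a"
  assumes lin: "linear K"
    and "\<forall>i j. v i \<bullet> v j = (if i = j then 1 else 0)" and "(\<Sum>i\<in>UNIV. v i \<bullet> K (v i)) = 0"
  shows "\<exists>w :: 'n \<Rightarrow> 'a. (\<forall>i j. w i \<bullet> w j = (if i = j then 1 else 0)) \<and> (\<forall>i. w i \<bullet> K (w i) = 0)"
  using assms(2,3)
\<comment> \<open>Induction on the number of nonzero diagonal entries. As they sum to zero, both
  signs occur; a rotation in the plane of two such basis vectors annihilates one entry and leaves
  all entries outside the plane alone.\<close>
proof (induction "card {i. v i \<bullet> K (v i) \<noteq> 0}" arbitrary: v rule: less_induct)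
  case less
  interpret K: linear K by (rule lin)
  show ?case
  proof (cases "\<forall>i. v i \<bullet> K (v i) = 0")
    case True with less.prems show ?thesis by blast
  next
    case False
    have pos: "\<exists>i. v i \<bullet> K (v i) > 0"
    proof (rule ccontr)
      assume *: "\<not> ?thesis"
      have "\<forall>i\<in>UNIV. - (v i \<bullet> K (v i)) = 0"
        using less.prems(2) * by (subst sum_nonneg_eq_0_iff[symmetric]) (auto simp: sum_negf not_less)
      with False show False by simp
    qed
    have neg: "\<exists>i. v i \<bullet> K (v i) < 0"
    proof (rule ccontr)
      assume *: "\<not> ?thesis"
      have "\<forall>i\<in>UNIV. v i \<bullet> K (v i) = 0"
        using less.prems(2) * by (subst sum_nonneg_eq_0_iff[symmetric]) (auto simp: not_less)
      with False show False by simp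
    qed
    from pos neg obtain i j where ij: "v i \<bullet> K (v i) > 0" "v j \<bullet> K (v j) < 0" by blast
    then have ne: "i \<noteq> j" by auto
    \<comment> \<open>A quarter turn from \<open>v i\<close> to \<open>v j\<close>: the quadratic
      form goes from positive to negative and vanishes in between.\<close>
    define u where "u = (\<lambda>t. cos t *\<^sub>R v i + sin t *\<^sub>R v j)"
    have expand: "u t \<bullet> K (u t) = (cos t)\<^sup>2 * (v i \<bullet> K (v i)) + (sin t)\<^sup>2 * (v j \<bullet> K (v j))
        + cos t * sin t * (v i \<bullet> K (v j) + v j \<bullet> K (v i))" for t
      by (simp add: u_def K.add K.scaleR inner_add_left inner_add_right algebra_simps power2_eq_square)
    have "\<exists>t\<ge>0. t \<le> pi / 2 \<and> u t \<bullet> K (u t) = 0"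
      using ij by (intro IVT2') (auto simp: expand intro!: continuous_intros)
    then obtain t where t: "u t \<bullet> K (u t) = 0" by blast
    \<comment> \<open>The second vector is the rotated partner of \<open>u t\<close>. The two
      diagonal entries of the plane keep their sum, so the total stays zero.\<close>
    define w where "w = v(i := u t, j := - sin t *\<^sub>R v i + cos t *\<^sub>R v j)"
    have vv: "v k \<bullet> v l = (if k = l then 1 else 0)" for k l
      using less.prems(1) by blast
    have sc: "cos t * cos t + sin t * sin t = 1" "sin t * sin t + cos t * cos t = 1"
      using sin_cos_squared_add[of t] by (simp_all add: power2_eq_square)
    have on: "\<forall>k l. w k \<bullet> w l = (if k = l then 1 else 0)"
      using ne by (auto simp: w_def u_def inner_add_left inner_add_right inner_diff_left inner_diff_right vv sc)
    have split: "(\<Sum>k\<in>UNIV. g k) = g i + (g j + (\<Sum>k\<in>UNIV - {i, j}. g k))" for g :: "'n \<Rightarrow> real"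
    proof -
      have "UNIV - {i, j} = UNIV - {i} - {j}" by auto
      then show ?thesis
        using ne by (simp add: sum.remove[of UNIV i g] sum.remove[of "UNIV - {i}" j g])
    qed
    have wj: "w j \<bullet> K (w j) = (sin t)\<^sup>2 * (v i \<bullet> K (v i)) + (cos t)\<^sup>2 * (v j \<bullet> K (v j))
        - cos t * sin t * (v i \<bullet> K (v j) + v j \<bullet> K (v i))"
      by (simp add: w_def K.add K.scaleR K.neg K.diff inner_add_left inner_add_right algebra_simps power2_eq_square)
    have wi: "w i = u t" using ne by (simp add: w_def)
    have "w i \<bullet> K (w i) + w j \<bullet> K (w j)
        = ((cos t)\<^sup>2 + (sin t)\<^sup>2) * (v i \<bullet> K (v i)) + ((cos t)\<^sup>2 + (sin t)\<^sup>2) * (v j \<bullet> K (v j))"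
      unfolding wi expand wj by (simp only: distrib_right)
    then have "w i \<bullet> K (w i) + w j \<bullet> K (w j) = v i \<bullet> K (v i) + v j \<bullet> K (v j)"
      by (simp only: sin_cos_squared_add2 mult_1)
    moreover have "(\<Sum>k\<in>UNIV - {i, j}. w k \<bullet> K (w k)) = (\<Sum>k\<in>UNIV - {i, j}. v k \<bullet> K (v k))"
      by (rule sum.cong) (auto simp: w_def)
    ultimately have sum0: "(\<Sum>k\<in>UNIV. w k \<bullet> K (w k)) = 0"
      using less.prems(2) split[of "\<lambda>k. w k \<bullet> K (w k)"] split[of "\<lambda>k. v k \<bullet> K (v k)"] by linarith
    \<comment> \<open>Index \<open>i\<close> leaves the set; index \<open>j\<close> may stay but was
      in it before, so no new index can enter.\<close>
    have "{k. w k \<bullet> K (w k) \<noteq> 0} \<subset> {k. v k \<bullet> K (v k) \<noteq> 0}"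
    proof (rule psubsetI)
      show "{k. w k \<bullet> K (w k) \<noteq> 0} \<subseteq> {k. v k \<bullet> K (v k) \<noteq> 0}"
      proof
        fix k assume "k \<in> {k. w k \<bullet> K (w k) \<noteq> 0}"
        then show "k \<in> {k. v k \<bullet> K (v k) \<noteq> 0}"
          using ij by (cases "k = i"; cases "k = j") (auto simp: w_def)
      qed
      have "i \<notin> {k. w k \<bullet> K (w k) \<noteq> 0}" "i \<in> {k. v k \<bullet> K (v k) \<noteq> 0}"
        using ij t wi by auto
      then show "{k. w k \<bullet> K (w k) \<noteq> 0} \<noteq> {k. v k \<bullet> K (v k) \<noteq> 0}" by blast
    qed
    then have "card {k. w k \<bullet> K (w k) \<noteq> 0} < card {k. v k \<bullet> K (v k) \<noteq> 0}"
      by (rule psubset_card_mono[rotated]) simp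
    then show ?thesis by (rule less.hyps[OF _ on sum0])
  qed
qed

lemma matrix_conj_diag: "(U ** K ** transpose U) $ i $ j = row i U \<bullet> (K *v row j U)"
  for K :: "real ^ 'n ^ 'n"
proof -
  have "(U ** K ** transpose U) $ i $ j = (\<Sum>k\<in>UNIV. \<Sum>l\<in>UNIV. U $ i $ l * K $ l $ k * U $ j $ k)"
    by (simp add: matrix_matrix_mult_def transpose_def sum_distrib_right)
  also have "\<dots> = (\<Sum>l\<in>UNIV. \<Sum>k\<in>UNIV. U $ i $ l * K $ l $ k * U $ j $ k)"
    by (rule sum.swap)
  also have "\<dots> = row i U \<bullet> (K *v row j U)"
    by (simp add: inner_vec_def matrix_vector_mult_def row_def sum_distrib_left mult.assoc)
  finally show ?thesis .
qed

lemma orthogonal_zero_diagonal: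
  fixes K :: "real ^ 'n ^ 'n"
  assumes "trace K = 0"
  obtains U where "orthogonal_matrix U" "\<forall>i. (U ** K ** transpose U) $ i $ i = 0"
proof -
  have "\<exists>w :: 'n \<Rightarrow> real ^ 'n. (\<forall>i j. w i \<bullet> w j = (if i = j then 1 else 0)) \<and> (\<forall>i. w i \<bullet> (K *v w i) = 0)"
  proof (rule orthonormal_zero_diagonal[where v = "\<lambda>i. axis i 1"])
    show "linear ((*v) K)" by simp
    show "\<forall>i j. axis i 1 \<bullet> (axis j 1 :: real ^ 'n) = (if i = j then 1 else 0)"
      by (simp add: inner_axis_axis)
    show "(\<Sum>i\<in>UNIV. axis i 1 \<bullet> (K *v axis i 1)) = 0"
      using assms by (simp add: inner_axis' matrix_vector_mult_basis column_def trace_def)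
  qed
  then obtain w :: "'n \<Rightarrow> real ^ 'n" where w: "\<forall>i j. w i \<bullet> w j = (if i = j then 1 else 0)"
    "\<forall>i. w i \<bullet> (K *v w i) = 0" by blast
  define U :: "real ^ 'n ^ 'n" where "U = (\<chi> i. w i)"
  have r: "row i U = w i" for i by (simp add: U_def row_def vec_eq_iff)
  show ?thesis
  proof
    show "orthogonal_matrix U"
      using w by (simp add: orthogonal_matrix_orthonormal_rows r orthogonal_def norm_eq_sqrt_inner)
    show "\<forall>i. (U ** K ** transpose U) $ i $ i = 0"
      using w by (simp add: matrix_conj_diag r)
  qed
qed

text \<open>With \<open>D\<close> the diagonal matrix of \<open>a\<close>, the commutator of
  \<open>D\<close> and \<open>Jb\<close> has entries (a_i - a_j) Jb_ij, which is
  \<open>U ** K ** transpose U\<close> by the choice of \<open>Jb\<close>; on the diagonal both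
  sides vanish. Conjugating back by \<open>U\<close> makes \<open>K\<close> a commutator.\<close>

lemma antisymmetric_potential:
  fixes K U :: "real ^ 'n ^ 'n" and a :: "'n \<Rightarrow> real"
  assumes sym: "transpose K = K" and U: "orthogonal_matrix U"
    and dz: "\<forall>i. (U ** K ** transpose U) $ i $ i = 0" and a: "inj a"
    and Jb: "Jb = (\<chi> i j. if i = j then 0 else (U ** K ** transpose U) $ i $ j / (a i - a j))"
  shows "antisymmetric (transpose U ** Jb ** U)"
    and "\<exists>G. K = commutator (transpose U ** Jb ** U) G"
proof -
  let ?L = "U ** K ** transpose U"
  have Lt: "transpose ?L = ?L"
    by (simp add: matrix_transpose_mul sym matrix_mul_assoc)
  then have Lsym: "?L $ i $ j = ?L $ j $ i" for i j
    by (metis (no_types) transpose_def vec_lambda_beta)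
  have "transpose Jb = - Jb"
  proof -
    have "Jb $ j $ i = - (Jb $ i $ j)" for i j
    proof (cases "i = j")
      case False
      have "x / (a j - a i) = - (x / (a i - a j))" for x
        by (metis minus_diff_eq minus_divide_right)
      then have "?L $ j $ i / (a j - a i) = - (?L $ i $ j / (a i - a j))"
        by (metis Lsym)
      moreover have "Jb $ j $ i = ?L $ j $ i / (a j - a i)" "Jb $ i $ j = ?L $ i $ j / (a i - a j)"
        using False by (simp_all add: Jb)
      ultimately show ?thesis by simp
    qed (simp add: Jb)
    then show ?thesis unfolding vec_eq_iff transpose_def vec_lambda_beta vector_uminus_component by blast
  qed
  then show "antisymmetric (transpose U ** Jb ** U)"
    by (simp add: antisymmetric_def matrix_transpose_mul matrix_mul_assoc matrix_mult_minus)
  define D :: "real ^ 'n ^ 'n" where "D = (\<chi> i j. if i = j then a i else 0)"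
  have DJ: "(D ** Jb) $ i $ j = a i * Jb $ i $ j" for i j
    by (simp add: D_def matrix_matrix_mult_def if_distrib[where f="\<lambda>x. x * _"] cong: if_cong)
  have JD: "(Jb ** D) $ i $ j = a j * Jb $ i $ j" for i j
    by (simp add: D_def matrix_matrix_mult_def if_distrib[where f="\<lambda>x. _ * x"] cong: if_cong)
  have L: "?L = D ** Jb - Jb ** D"
  proof -
    have "?L $ i $ j = a i * Jb $ i $ j - a j * Jb $ i $ j" for i j
    proof (cases "i = j")
      case False
      with a have "a i - a j \<noteq> 0" by (auto dest: injD)
      with False show ?thesis by (simp add: Jb flip: left_diff_distrib diff_divide_distrib)
    qed (use dz in simp)
    then show ?thesis by (simp add: vec_eq_iff DJ JD)
  qed
  have UU: "transpose U ** U = mat 1" "U ** transpose U = mat 1"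
    using U by (auto simp: orthogonal_matrix_def)
  have c1: "X ** U ** transpose U = X" for X :: "real ^ 'n ^ 'n"
    by (metis UU(2) matrix_mul_assoc matrix_mul_rid)
  have "K = transpose U ** ?L ** U"
    by (metis UU(1) matrix_mul_assoc matrix_mul_lid matrix_mul_rid)
  \<comment> \<open>Exchanging the arguments of the commutator of \<open>D\<close> and
    \<open>Jb\<close> produces the minus sign in \<open>G\<close>.\<close>
  also have "\<dots> = commutator (transpose U ** Jb ** U) (- (transpose U ** D ** U))"
    unfolding L commutator_def
    by (simp add: matrix_diff_ldistrib matrix_diff_rdistrib matrix_mult_minus matrix_mul_assoc c1)
  finally show "\<exists>G. K = commutator (transpose U ** Jb ** U) G" by blast
qed

section \<open>Linear stochastic dynamics and a splitting scheme\<close>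

lemma continuous_on_atLeast_local:
  fixes f :: "real \<Rightarrow> 'a::topological_space"
  assumes "\<And>T. 0 \<le> T \<Longrightarrow> continuous_on {0..T} f"
  shows "continuous_on {0..} f"
  unfolding continuous_on_eq_continuous_within
proof
  fix t :: real assume "t \<in> {0..}"
  then have "continuous (at t within {0..t + 1}) f"
    using assms[of "t + 1"] by (auto simp: continuous_on_eq_continuous_within)
  moreover have "at t within {0..t + 1} = at t within {0..}"
    by (rule at_within_nhd[where S = "{..<t + 1}"]) auto
  ultimately show "continuous (at t within {0..}) f" by (simp add: continuous_within)
qed

text \<open>The n-th term of the Neumann series of z = g + V z, where V z is the indefinite integral
  of \<open>A\<close> applied to z. The Picard iterates are its partial sums.\<close>

primrec volterra_iter :: "('a \<Rightarrow> 'a) \<Rightarrow> (real \<Rightarrow> 'a) \<Rightarrow> nat \<Rightarrow> real \<Rightarrow> 'a::euclidean_space" where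
  "volterra_iter A g 0 = g"
| "volterra_iter A g (Suc n) = (\<lambda>t. integral {0..t} (\<lambda>s. A (volterra_iter A g n s)))"

lemma continuous_on_volterra_iter:
  assumes A: "bounded_linear A" and g: "continuous_on {0..T} g"
  shows "continuous_on {0..T} (volterra_iter A g n)"
proof (induction n)
  case (Suc n)
  then show ?case
    by (auto intro!: indefinite_integral_continuous_1 integrable_continuous_real
        bounded_linear.continuous_on[OF A])
qed (use g in simp)

text \<open>Each integration contributes a factor K and raises the power of t, which produces the
  factorial. The majorant is the exponential series.\<close>

lemma norm_volterra_iter_le:
  assumes A: "bounded_linear A" and K: "\<And>x. norm (A x) \<le> K * norm x" "K \<ge> 0"
    and g: "continuous_on {0..T} g" "\<And>t. t \<in> {0..T} \<Longrightarrow> norm (g t) \<le> B"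
  shows "t \<in> {0..T} \<Longrightarrow> norm (volterra_iter A g n t) \<le> B * (K * t) ^ n / fact n"
proof (induction n arbitrary: t)
  case (Suc n)
  have hi: "((\<lambda>s. K * (B * (K * s) ^ n / fact n)) has_integral
      B * (K * t) ^ Suc n / fact (Suc n) - B * (K * 0) ^ Suc n / fact (Suc n)) {0..t}"
  proof (rule fundamental_theorem_of_calculus)
    fix s
    have "((\<lambda>s. B * (K * s) ^ Suc n / fact (Suc n)) has_real_derivative
        B * (real (Suc n) * (K * s) ^ n * K) / fact (Suc n)) (at s within {0..t})"
      by (auto intro!: derivative_eq_intros simp del: fact_Suc power_Suc)
    also have "B * (real (Suc n) * (K * s) ^ n * K) / fact (Suc n) = K * (B * (K * s) ^ n / fact n)"
    proof -
      have "(fact (Suc n) :: real) = real (Suc n) * fact n" by (rule fact_Suc)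
      then show ?thesis by (simp del: fact_Suc of_nat_Suc add: field_simps)
    qed
    finally show "((\<lambda>s. B * (K * s) ^ Suc n / fact (Suc n)) has_vector_derivative
        K * (B * (K * s) ^ n / fact n)) (at s within {0..t})"
      by (simp add: has_real_derivative_iff_has_vector_derivative)
  qed (use Suc in simp)
  have "norm (volterra_iter A g (Suc n) t) \<le> integral {0..t} (\<lambda>s. K * (B * (K * s) ^ n / fact n))"
    unfolding volterra_iter.simps
  proof (rule integral_norm_bound_integral)
    show "(\<lambda>s. A (volterra_iter A g n s)) integrable_on {0..t}"
      using Suc.prems
      by (intro integrable_continuous_real bounded_linear.continuous_on[OF A] continuous_on_volterra_iter[OF A]
          continuous_on_subset[OF g(1)]) auto
    show "(\<lambda>s. K * (B * (K * s) ^ n / fact n)) integrable_on {0..t}"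
      using hi by blast
    fix s assume "s \<in> {0..t}"
    then have "norm (volterra_iter A g n s) \<le> B * (K * s) ^ n / fact n"
      using Suc by auto
    then show "norm (A (volterra_iter A g n s)) \<le> K * (B * (K * s) ^ n / fact n)"
      using K by (meson mult_left_mono order_trans)
  qed
  also have "\<dots> = B * (K * t) ^ Suc n / fact (Suc n)"
    using integral_unique[OF hi] by (simp only: mult_zero_right power_0_Suc)
  finally show ?case .
qed (use g in simp)

text \<open>The Neumann series converges uniformly on every \<open>{0..T}\<close>, so the relation
  between consecutive partial sums passes to the limit under the integral. The sum is defined
  without a time horizon, so no gluing of solutions arises.\<close>

lemma volterra_exists:
  fixes A :: "'a::euclidean_space \<Rightarrow> 'a"
  assumes A: "bounded_linear A" and g: "continuous_on {0..} (g :: real \<Rightarrow> 'a)"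
  obtains z where "continuous_on {0..} z" "\<And>t. t \<ge> 0 \<Longrightarrow> z t = g t + integral {0..t} (\<lambda>s. A (z s))"
proof -
  interpret A: bounded_linear A by (rule A)
  obtain K where K: "K \<ge> 0" "\<And>x. norm (A x) \<le> K * norm x"
    using A.nonneg_bounded by (auto simp: mult.commute)
  define G where "G = volterra_iter A g"
  define P where "P = (\<lambda>n t. \<Sum>i<n. G i t)"
  define z where "z = (\<lambda>t. \<Sum>i. G i t)"
  have gT: "continuous_on {0..T} g" for T
    by (rule continuous_on_subset[OF g]) auto
  have cG: "continuous_on {0..T} (G n)" for n T
    unfolding G_def by (rule continuous_on_volterra_iter[OF A gT])
  have cP: "continuous_on {0..T} (P n)" for n T
    unfolding P_def by (intro continuous_on_sum cG)
  have ul: "uniform_limit {0..T} P z sequentially" if T: "T \<ge> 0" for T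
  proof -
    have "compact (g ` {0..T})" by (intro compact_continuous_image gT compact_Icc)
    then obtain B where B: "\<And>t. t \<in> {0..T} \<Longrightarrow> norm (g t) \<le> B"
      by (meson compact_imp_bounded bounded_iff imageI)
    have B0: "B \<ge> 0" using order_trans[OF norm_ge_zero B[of 0]] T by simp
    show ?thesis
      unfolding P_def z_def
    proof (rule Weierstrass_m_test)
      show "summable (\<lambda>n. B * ((K * T) ^ n / fact n))"
        by (intro summable_mult) (use summable_exp[of "K * T"] in \<open>simp add: field_simps\<close>)
      fix n t assume t: "t \<in> {0..T}"
      have "norm (G n t) \<le> B * (K * t) ^ n / fact n"
        unfolding G_def by (rule norm_volterra_iter_le[OF A K(2) K(1) gT B t])
      also have "\<dots> \<le> B * (K * T) ^ n / fact n"
        using t B0 K by (intro divide_right_mono mult_left_mono power_mono) auto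
      finally show "norm (G n t) \<le> B * ((K * T) ^ n / fact n)" by simp
    qed
  qed
  have cz: "continuous_on {0..T} z" if "T \<ge> 0" for T
    by (rule uniform_limit_theorem[OF _ ul[OF that]]) (auto simp: cP)
  show ?thesis
  proof
    show "continuous_on {0..} z" by (rule continuous_on_atLeast_local[OF cz])
    fix t :: real assume t: "t \<ge> 0"
    obtain I J where IJ: "\<And>n. ((\<lambda>s. A (P n s)) has_integral I n) {0..t}"
      "((\<lambda>s. A (z s)) has_integral J) {0..t}" "I \<longlonglongrightarrow> J"
    proof (rule uniform_limit_integral)
      show "uniform_limit {0..t} (\<lambda>n s. A (P n s)) (\<lambda>s. A (z s)) sequentially"
        by (rule A.uniform_limit[OF ul[OF t]])
      show "continuous_on {0..t} (\<lambda>s. A (P n s))" for n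
        by (intro A.continuous_on cP)
    qed auto
    have "P (Suc n) t = g t + I n" for n
    proof -
      have "I n = integral {0..t} (\<lambda>s. \<Sum>i<n. A (G i s))"
        using integral_unique[OF IJ(1)[of n]] by (simp add: P_def A.sum)
      also have "\<dots> = (\<Sum>i<n. integral {0..t} (\<lambda>s. A (G i s)))"
        by (intro integral_sum integrable_continuous_real A.continuous_on cG) auto
      also have "\<dots> = (\<Sum>i<n. G (Suc i) t)" by (simp add: G_def)
      finally show ?thesis
        by (simp add: P_def sum.lessThan_Suc_shift del: sum.lessThan_Suc) (simp add: G_def)
    qed
    then have "(\<lambda>n. P (Suc n) t) \<longlonglongrightarrow> g t + J"
      using IJ(3) by (auto intro!: tendsto_intros)
    moreover have "(\<lambda>n. P (Suc n) t) \<longlonglongrightarrow> z t"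
      using tendsto_uniform_limitI[OF ul[OF t], of t] t by (intro LIMSEQ_Suc) auto
    ultimately have "z t = g t + J" using LIMSEQ_unique by blast
    then show "z t = g t + integral {0..t} (\<lambda>s. A (z s))"
      using IJ(2) by (simp add: integral_unique)
  qed
qed

text \<open>The Cayley transform: \<open>R = (I - e S)\<^sup>-\<^sup>1 (I + e S)\<close> is orthogonal when \<open>S\<close> is skew.\<close>

lemma cayley_exists:
  fixes S :: "'a::euclidean_space \<Rightarrow> 'a"
  assumes S: "linear S" and skew: "\<And>x. x \<bullet> S x = 0"
  shows "\<exists>R. linear R \<and> (\<forall>x. norm (R x) = norm x) \<and> (\<forall>x. R x = x + e *\<^sub>R S (R x + x))"
proof -
  interpret S: linear S by (rule S)
  define T where "T = (\<lambda>y. y - e *\<^sub>R S y)"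
  have T: "linear T"
    unfolding T_def by (rule linearI) (auto simp: S.add S.scaleR algebra_simps)
  interpret T: linear T by (rule T)
  \<comment> \<open>The cross term is \<open>y \<bullet> S y = 0\<close>; hence \<open>T\<close> is
    injective for every \<open>e\<close>, however large.\<close>
  have nT: "(norm (T y))\<^sup>2 = (norm y)\<^sup>2 + e\<^sup>2 * (norm (S y))\<^sup>2" for y
    using skew[of y] unfolding T_def power2_norm_eq_inner
    by (simp add: inner_diff_left inner_diff_right inner_commute[of "S y" y] power2_eq_square)
  have nT': "(norm (y + e *\<^sub>R S y))\<^sup>2 = (norm y)\<^sup>2 + e\<^sup>2 * (norm (S y))\<^sup>2" for y
    using skew[of y] unfolding power2_norm_eq_inner
    by (simp add: inner_add_left inner_add_right inner_commute[of "S y" y] power2_eq_square)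
  have inj: "inj T"
  proof (rule linear_injective_0[OF T, THEN iffD2], clarify)
    fix x assume "T x = 0"
    then have "(norm x)\<^sup>2 + e\<^sup>2 * (norm (S x))\<^sup>2 = 0" using nT[of x] by simp
    then show "x = 0" by (smt (verit) norm_eq_zero mult_nonneg_nonneg zero_le_power2 power2_less_eq_zero_iff)
  qed
  then have surj: "surj T" using eucl.linear_inj_imp_surj[OF T] by blast
  define R where "R = (\<lambda>x. inv T (x + e *\<^sub>R S x))"
  have TR: "T (R x) = x + e *\<^sub>R S x" for x
    unfolding R_def using surj by (simp add: surj_f_inv_f)
  have "linear R"
  proof (rule linearI)
    show "R (x + y) = R x + R y" for x y
      by (rule injD[OF inj]) (simp add: TR T.add S.add algebra_simps)
    show "R (c *\<^sub>R x) = c *\<^sub>R R x" for c x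
      by (rule injD[OF inj]) (simp add: TR T.scaleR S.scaleR algebra_simps)
  qed
  moreover have eq: "R x = x + e *\<^sub>R S (R x + x)" for x
    using TR[of x] by (simp add: T_def S.add algebra_simps)
  moreover have "norm (R x) = norm x" for x
  proof -
    have m: "R x + x = T (R x + x) + e *\<^sub>R S (R x + x)" by (simp add: T_def)
    \<comment> \<open>The difference of the squared norms factors as
      \<open>(R x + x) \<bullet> (R x - x)\<close>. The implicit equation writes
      \<open>R x - x\<close> as \<open>e *\<^sub>R S (R x + x)\<close>, and skewness
      finishes.\<close>
    have "(R x + x) \<bullet> (R x - x) = e * ((R x + x) \<bullet> S (R x + x))"
      by (subst (2) eq) simp
    moreover have "R x \<bullet> R x - x \<bullet> x = (R x + x) \<bullet> (R x - x)"
      by (simp add: inner_add_left inner_diff_right inner_commute[of x "R x"])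
    ultimately have "(norm (R x))\<^sup>2 = (norm x)\<^sup>2"
      by (simp add: skew power2_norm_eq_inner)
    then show ?thesis by simp
  qed
  ultimately show ?thesis by blast
qed

section \<open>The splitting scheme and its pathwise convergence\<close>

locale skew_langevin =
  fixes S :: "'a::euclidean_space \<times> 'a \<Rightarrow> 'a \<times> 'a" and \<gamma> :: real
  assumes linear_S: "linear S" and skew: "x \<bullet> S x = 0" and gamma_pos: "\<gamma> > 0"
begin

definition drift :: "'a \<times> 'a \<Rightarrow> 'a \<times> 'a" where
  "drift z = S z - (0, \<gamma> *\<^sub>R snd z)"

definition solution :: "(real \<Rightarrow> 'a) \<Rightarrow> 'a \<times> 'a \<Rightarrow> (real \<Rightarrow> 'a \<times> 'a) \<Rightarrow> bool" where
  "solution w x z \<longleftrightarrow> continuous_on {0..} z \<and>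
     (\<forall>t\<ge>0. z t = x + integral {0..t} (\<lambda>s. drift (z s)) + (0, sqrt (2 * \<gamma>) *\<^sub>R w t))"

text \<open>The implicit midpoint step, standing in for exp(\<delta> S): it preserves norms exactly,
  and its error can be read off one algebraic equation.\<close>

definition rot :: "real \<Rightarrow> 'a \<times> 'a \<Rightarrow> 'a \<times> 'a" where
  "rot \<delta> = (SOME R. linear R \<and> (\<forall>x. norm (R x) = norm x) \<and> (\<forall>x. R x = x + (\<delta> / 2) *\<^sub>R S (R x + x)))"

text \<open>The factor is not exp(-\<gamma> \<delta>): the noise of a step is the raw Brownian
  increment scaled by \<open>sqrt (2 * \<gamma>)\<close>, of variance 2 \<gamma> \<delta>, and the
  damping is adjusted so that the standard Gaussian is exactly invariant. This is the origin of the
  recurring condition \<open>2 * \<gamma> * \<delta> \<le> 1\<close>.\<close>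

definition damp :: "real \<Rightarrow> real" where
  "damp \<delta> = sqrt (1 - 2 * \<gamma> * \<delta>)"

text \<open>One step of a splitting scheme: an autoregressive step in the momentum, which preserves the
  Gaussian measure since \<open>(damp \<delta>)\<^sup>2 + 2 \<gamma> \<delta> = 1\<close>, followed by a rotation.\<close>

definition step :: "real \<Rightarrow> 'a \<times> 'a \<Rightarrow> 'a \<Rightarrow> 'a \<times> 'a" where
  "step \<delta> z \<eta> = rot \<delta> (fst z, damp \<delta> *\<^sub>R snd z + sqrt (2 * \<gamma>) *\<^sub>R \<eta>)"

primrec chain :: "real \<Rightarrow> (nat \<Rightarrow> 'a) \<Rightarrow> 'a \<times> 'a \<Rightarrow> nat \<Rightarrow> 'a \<times> 'a" where
  "chain \<delta> \<eta> x 0 = x"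
| "chain \<delta> \<eta> x (Suc k) = step \<delta> (chain \<delta> \<eta> x k) (\<eta> k)"

lemma bounded_linear_drift: "bounded_linear drift"
proof -
  interpret S: linear S by (rule linear_S)
  have "linear drift"
    unfolding drift_def by (rule linearI) (auto simp: S.add S.scaleR algebra_simps prod_eq_iff)
  then show ?thesis by (simp add: linear_conv_bounded_linear)
qed

lemma solution_exists:
  assumes w: "continuous_on {0..} w"
  shows "\<exists>z. solution w x z"
proof -
  obtain z where "continuous_on {0..} z"
    "\<And>t. t \<ge> 0 \<Longrightarrow> z t = (x + (0, sqrt (2 * \<gamma>) *\<^sub>R w t)) + integral {0..t} (\<lambda>s. drift (z s))"
    by (rule volterra_exists[OF bounded_linear_drift, where g = "\<lambda>t. x + (0, sqrt (2 * \<gamma>) *\<^sub>R w t)"])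
      (auto intro!: continuous_intros w)
  then show ?thesis unfolding solution_def by (intro exI[of _ z]) (auto simp: algebra_simps)
qed

lemma rot:
  shows linear_rot: "linear (rot \<delta>)" and norm_rot: "norm (rot \<delta> x) = norm x"
    and rot_eq: "rot \<delta> x = x + (\<delta> / 2) *\<^sub>R S (rot \<delta> x + x)"
  using someI_ex[OF cayley_exists[OF linear_S skew, of "\<delta> / 2"]] unfolding rot_def by blast+

text \<open>As \<open>rot\<close> preserves norms, the implicit equation yields explicit bounds. The
  second-order remainder is \<open>\<delta> / 2\<close> times \<open>S\<close> applied to the
  first-order one.\<close>

lemma rot_error:
  assumes L: "\<And>x. norm (S x) \<le> L * norm x" "L \<ge> 0" and d: "\<delta> \<ge> 0"
  shows "norm (rot \<delta> x - x) \<le> \<delta> * L * norm x"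
    and "norm (rot \<delta> x - x - \<delta> *\<^sub>R S x) \<le> \<delta>\<^sup>2 * L\<^sup>2 * norm x"
proof -
  interpret S: linear S by (rule linear_S)
  have "norm (rot \<delta> x - x) = (\<delta> / 2) * norm (S (rot \<delta> x + x))"
    using d by (subst rot_eq) simp
  also have "\<dots> \<le> (\<delta> / 2) * (L * (norm (rot \<delta> x) + norm x))"
    using L d by (intro mult_left_mono order_trans[OF L(1)] norm_triangle_ineq) auto
  finally show *: "norm (rot \<delta> x - x) \<le> \<delta> * L * norm x" by (simp add: norm_rot)
  have "rot \<delta> x - x - \<delta> *\<^sub>R S x = (\<delta> / 2) *\<^sub>R S (rot \<delta> x + x) - \<delta> *\<^sub>R S x"
    using rot_eq[of \<delta> x] by (simp add: algebra_simps)
  also have "\<dots> = (\<delta> / 2) *\<^sub>R S (rot \<delta> x - x)"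
    by (simp add: S.add S.diff algebra_simps flip: scaleR_add_left)
  finally have "norm (rot \<delta> x - x - \<delta> *\<^sub>R S x) = (\<delta> / 2) * norm (S (rot \<delta> x - x))"
    using d by simp
  also have "\<dots> \<le> \<delta> * (L * (\<delta> * L * norm x))"
    using d L by (intro mult_mono order_trans[OF L(1)] mult_left_mono *) auto
  finally show "norm (rot \<delta> x - x - \<delta> *\<^sub>R S x) \<le> \<delta>\<^sup>2 * L\<^sup>2 * norm x"
    by (simp add: power2_eq_square mult_ac)
qed

lemma damp_bounds:
  assumes d: "\<delta> \<ge> 0" "2 * \<gamma> * \<delta> \<le> 1"
  shows "0 \<le> damp \<delta>" "damp \<delta> \<le> 1" "\<bar>damp \<delta> - 1\<bar> \<le> 2 * \<gamma> * \<delta>"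
    "\<bar>damp \<delta> - 1 + \<gamma> * \<delta>\<bar> \<le> 2 * \<gamma>\<^sup>2 * \<delta>\<^sup>2" "(damp \<delta>)\<^sup>2 + 2 * \<gamma> * \<delta> = 1"
proof -
  define h where "h = \<gamma> * \<delta>"
  have h: "0 \<le> h" "2 * h \<le> 1" using d gamma_pos by (auto simp: h_def)
  define c where "c = sqrt (1 - 2 * h)"
  have c: "0 \<le> c" "c\<^sup>2 = 1 - 2 * h" "c \<le> 1" using h by (auto simp: c_def)
  have dc: "damp \<delta> = c" by (simp add: damp_def c_def h_def)
  have "(1 - c) * 1 \<le> (1 - c) * (1 + c)" using c by (intro mult_left_mono) auto
  also have "\<dots> = 2 * h" using c by (simp add: algebra_simps power2_eq_square)
  finally have 1: "1 - c \<le> 2 * h" by simp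
  have eq: "(1 - h - c) * (1 - h + c) = h\<^sup>2"
    using c(2) by (simp add: power2_eq_square algebra_simps)
  have 3: "c \<le> 1 - h"
    by (rule power2_le_imp_le) (use c h in \<open>auto simp: power2_eq_square algebra_simps\<close>)
  \<comment> \<open>Since h is at most 1/2, the conjugate factor \<open>1 - h + c\<close> is at
    least 1/2, so dividing \<open>h\<^sup>2\<close> by it costs at most a factor 2.\<close>
  then have "(1 - h - c) * (1 / 2) \<le> (1 - h - c) * (1 - h + c)"
    using h c by (intro mult_left_mono) auto
  then have 2: "1 - h - c \<le> 2 * h\<^sup>2" using eq by simp
  show "0 \<le> damp \<delta>" "damp \<delta> \<le> 1" "\<bar>damp \<delta> - 1\<bar> \<le> 2 * \<gamma> * \<delta>" "(damp \<delta>)\<^sup>2 + 2 * \<gamma> * \<delta> = 1"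
    using c 1 by (auto simp: dc h_def)
  show "\<bar>damp \<delta> - 1 + \<gamma> * \<delta>\<bar> \<le> 2 * \<gamma>\<^sup>2 * \<delta>\<^sup>2"
    using 2 3 by (simp add: dc power_mult_distrib abs_if flip: h_def) (simp add: h_def power_mult_distrib)
qed

lemma norm_damp_le:
  assumes "\<delta> \<ge> 0" "2 * \<gamma> * \<delta> \<le> 1"
  shows "norm (fst z, damp \<delta> *\<^sub>R snd z) \<le> norm z"
proof -
  have "(norm (damp \<delta> *\<^sub>R snd z))\<^sup>2 \<le> (norm (snd z))\<^sup>2"
    using damp_bounds[OF assms] by (intro power_mono) (auto intro: mult_left_le_one_le)
  then show ?thesis by (simp add: norm_prod_def)
qed

lemma linear_step0: "linear (\<lambda>z. step \<delta> z 0)"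
proof -
  interpret R: linear "rot \<delta>" by (rule linear_rot)
  have "linear (\<lambda>z :: 'a \<times> 'a. (fst z, damp \<delta> *\<^sub>R snd z))"
    by (rule linearI) (auto simp: algebra_simps)
  from linear_compose[OF this linear_rot[of \<delta>]] show ?thesis
    by (simp add: step_def o_def)
qed

lemma step_split: "step \<delta> z \<eta> = step \<delta> z 0 + rot \<delta> (0, sqrt (2 * \<gamma>) *\<^sub>R \<eta>)"
  unfolding step_def by (simp flip: linear_add[OF linear_rot])

text \<open>With equal noise the noise cancels in the difference, which is then moved by the
  noise-free step: a damping by at most 1 and a rotation.\<close>

lemma step_contraction:
  assumes "\<delta> \<ge> 0" "2 * \<gamma> * \<delta> \<le> 1"
  shows "norm (step \<delta> z \<eta> - step \<delta> z' \<eta>) \<le> norm (z - z')"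
proof -
  have "step \<delta> z \<eta> - step \<delta> z' \<eta> = step \<delta> (z - z') 0"
    using linear_diff[OF linear_step0, of \<delta> z z'] step_split[of \<delta> z \<eta>] step_split[of \<delta> z' \<eta>] by simp
  also have "norm \<dots> \<le> norm (z - z')"
    using norm_damp_le[OF assms, of "z - z'"] by (simp add: step_def norm_rot)
  finally show ?thesis .
qed

lemma step0_error:
  assumes L: "\<And>x. norm (S x) \<le> L * norm x" "L \<ge> 0" and d: "\<delta> \<ge> 0" "2 * \<gamma> * \<delta> \<le> 1"
  shows "norm (step \<delta> z 0 - z - \<delta> *\<^sub>R drift z) \<le> (L\<^sup>2 + 2 * \<gamma>\<^sup>2 + 2 * \<gamma> * L) * \<delta>\<^sup>2 * norm z"
proof -
  interpret S: linear S by (rule linear_S)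
  define y where "y = (fst z, damp \<delta> *\<^sub>R snd z)"
  have zz: "z = (fst z, snd z)" by simp
  have dy: "y - z = (0, (damp \<delta> - 1) *\<^sub>R snd z)"
    by (simp add: y_def prod_eq_iff algebra_simps)
  \<comment> \<open>Three second-order errors: of the rotation at the damped point, of the damping
    factor, and of evaluating \<open>S\<close> at \<open>y\<close> instead of
    \<open>z\<close>.\<close>
  have eq: "step \<delta> z 0 - z - \<delta> *\<^sub>R drift z = (rot \<delta> y - y - \<delta> *\<^sub>R S y)
      + (0, (damp \<delta> - 1 + \<gamma> * \<delta>) *\<^sub>R snd z) + \<delta> *\<^sub>R S (y - z)"
  proof -
    have "(0, (damp \<delta> - 1 + \<gamma> * \<delta>) *\<^sub>R snd z) = y - z + \<delta> *\<^sub>R (0, \<gamma> *\<^sub>R snd z)"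
      unfolding dy by (simp add: algebra_simps)
    then show ?thesis
      by (simp add: step_def drift_def S.diff algebra_simps flip: y_def)
  qed
  have sz: "norm (snd z) \<le> norm z" by (metis norm_snd_le prod.collapse)
  have ny: "norm y \<le> norm z" unfolding y_def by (rule norm_damp_le[OF d])
  have 1: "norm (rot \<delta> y - y - \<delta> *\<^sub>R S y) \<le> L\<^sup>2 * \<delta>\<^sup>2 * norm z"
    using rot_error(2)[OF L d(1), of y] mult_left_mono[OF ny, of "\<delta>\<^sup>2 * L\<^sup>2"] by (simp add: mult_ac)
  have 2: "norm ((0 :: 'a, (damp \<delta> - 1 + \<gamma> * \<delta>) *\<^sub>R snd z)) \<le> 2 * \<gamma>\<^sup>2 * \<delta>\<^sup>2 * norm z"
    using damp_bounds(4)[OF d] sz by (simp add: norm_Pair) (intro mult_mono, auto)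
  have "norm (y - z) \<le> 2 * \<gamma> * \<delta> * norm z"
    using damp_bounds(3)[OF d] sz gamma_pos d by (simp add: dy norm_Pair) (intro mult_mono, auto)
  then have "\<delta> * norm (S (y - z)) \<le> \<delta> * (L * (2 * \<gamma> * \<delta> * norm z))"
    using L d by (intro mult_left_mono order_trans[OF L(1)]) auto
  then have 3: "norm (\<delta> *\<^sub>R S (y - z)) \<le> 2 * \<gamma> * L * \<delta>\<^sup>2 * norm z"
    using d by (simp add: power2_eq_square mult_ac)
  show ?thesis
    unfolding eq by (rule order_trans[OF norm_triangle_le[OF add_right_mono[OF norm_triangle_ineq]]])
      (use 1 2 3 in \<open>auto simp: algebra_simps\<close>)
qed

text \<open>Brownian paths are only known to be continuous, so the convergence of the scheme rests
  on a uniform modulus of continuity over the grid and not on a rate.\<close>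

lemma uniformly_small:
  fixes f :: "real \<Rightarrow> 'b::real_normed_vector"
  assumes f: "continuous_on {0..} f" and t: "t > 0" and e: "e > 0"
  shows "eventually (\<lambda>n. \<forall>k<n. \<forall>s\<in>{real k * (t / n)..real (Suc k) * (t / n)}.
           norm (f s - f (real k * (t / n))) \<le> e) sequentially"
proof -
  have "uniformly_continuous_on {0..t} f"
    by (intro compact_uniformly_continuous continuous_on_subset[OF f]) auto
  then obtain d where d: "d > 0" "\<And>s s'. s \<in> {0..t} \<Longrightarrow> s' \<in> {0..t} \<Longrightarrow> dist s' s < d \<Longrightarrow> dist (f s') (f s) < e"
    unfolding uniformly_continuous_on_def using e by metis
  have "eventually (\<lambda>n. t / real n < d) sequentially"
    using d(1) by (intro order_tendstoD) (real_asymp)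
  then show ?thesis
    using eventually_gt_at_top[of "0::nat"]
  proof eventually_elim
    case (elim n)
    show ?case
    proof (intro allI impI ballI)
      fix k s assume k: "k < n" and s: "s \<in> {real k * (t / n)..real (Suc k) * (t / n)}"
      have "real (Suc k) * (t / n) \<le> real n * (t / n)"
        using k t by (intro mult_right_mono) auto
      also have "\<dots> = t" using elim by simp
      finally have b: "real (Suc k) * (t / n) \<le> t" .
      have b0: "0 \<le> real k * (t / n)" using t by simp
      have "real (Suc k) * (t / n) = real k * (t / n) + t / n" by (simp add: algebra_simps add_divide_distrib)
      then have "dist s (real k * (t / n)) < d"
        using s elim unfolding dist_real_def atLeastAtMost_iff by linarith
      then have "dist (f s) (f (real k * (t / n))) < e"
        using s b b0 by (intro d(2)) auto
      then show "norm (f s - f (real k * (t / n))) \<le> e" by (simp add: dist_norm)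
    qed
  qed
qed

text \<open>The scheme is a contraction, so the local errors merely add up. As the limit does not
  depend on the solution, this also shows uniqueness.\<close>

lemma chain_tendsto_solution:
  assumes z: "solution w x z" and w: "continuous_on {0..} w" and t: "t > 0"
  shows "(\<lambda>n. chain (t / n) (\<lambda>k. w (real (Suc k) * (t / n)) - w (real k * (t / n)))
           (x + (0, sqrt (2 * \<gamma>) *\<^sub>R w 0)) n) \<longlonglongrightarrow> z t"
proof -
  interpret D: bounded_linear drift by (rule bounded_linear_drift)
  obtain L where L: "L \<ge> 0" "\<And>x. norm (S x) \<le> L * norm x"
    using bounded_linear.nonneg_bounded[of S] linear_S by (auto simp: mult.commute linear_conv_bounded_linear)
  obtain La where La: "La \<ge> 0" "\<And>x. norm (drift x) \<le> La * norm x"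
    using D.nonneg_bounded by (auto simp: mult.commute)
  define b where "b = sqrt (2 * \<gamma>)"
  have b: "b \<ge> 0" using gamma_pos by (simp add: b_def)
  define C where "C = L\<^sup>2 + 2 * \<gamma>\<^sup>2 + 2 * \<gamma> * L"
  have C: "C \<ge> 0" using L gamma_pos by (simp add: C_def)
  have cz: "continuous_on {0..} z"
    and ze: "\<And>t. t \<ge> 0 \<Longrightarrow> z t = x + integral {0..t} (\<lambda>s. drift (z s)) + (0, b *\<^sub>R w t)"
    using z by (auto simp: solution_def b_def)
  have "compact (z ` {0..t})" by (intro compact_continuous_image continuous_on_subset[OF cz]) auto
  then obtain B where B: "\<And>s. s \<in> {0..t} \<Longrightarrow> norm (z s) \<le> B"
    by (meson compact_imp_bounded bounded_iff imageI)
  have B0: "B \<ge> 0" using order_trans[OF norm_ge_zero B[of 0]] t by simp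
  define Z where "Z = (\<lambda>n. chain (t / real n) (\<lambda>k. w (real (Suc k) * (t / n)) - w (real k * (t / n)))
           (x + (0, b *\<^sub>R w 0)))"
  \<comment> \<open>The local error is at most \<open>\<delta> * (E * e)\<close>: \<open>La\<close>
    from freezing the drift over a step, \<open>L * b\<close> from rotating the noise increment,
    \<open>C * B\<close> from the second-order error of the noise-free step.\<close>
  define E where "E = La + L * b + C * B"
  have E: "E \<ge> 0" unfolding E_def using La L b C B0 by (intro add_nonneg_nonneg mult_nonneg_nonneg)
  have main: "eventually (\<lambda>n. norm (z t - Z n n) \<le> t * (E * e)) sequentially"
    if e: "e > 0" for e
  proof -
    \<comment> \<open>The bound by \<open>e\<close> turns the terms in
      \<open>\<delta>\<^sup>2\<close> into \<open>e * \<delta>\<close>; the bound by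
      \<open>1 / (2 * \<gamma>)\<close> makes the damping admissible.\<close>
    have "eventually (\<lambda>n. t / real n < min e (1 / (2 * \<gamma>))) sequentially"
      using e gamma_pos by (intro order_tendstoD) (real_asymp, auto)
    then show ?thesis
      using uniformly_small[OF cz t e] uniformly_small[OF w t e] eventually_gt_at_top[of "0::nat"]
    proof eventually_elim
      case (elim n)
      define \<delta> where "\<delta> = t / real n"
      have d: "\<delta> \<ge> 0" "2 * \<gamma> * \<delta> \<le> 1" "\<delta> \<le> e" "real n * \<delta> = t"
        using elim t gamma_pos by (auto simp: \<delta>_def field_simps)
      define \<tau> where "\<tau> = (\<lambda>k. real k * \<delta>)"
      have step: "norm (z (\<tau> (Suc k)) - Z n (Suc k)) \<le> norm (z (\<tau> k) - Z n k) + \<delta> * (E * e)"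
        if k: "k < n" for k
      proof -
        define \<eta> where "\<eta> = w (\<tau> (Suc k)) - w (\<tau> k)"
        let ?r1 = "step \<delta> (z (\<tau> k)) 0 - z (\<tau> k) - \<delta> *\<^sub>R drift (z (\<tau> k))"
        let ?r2 = "rot \<delta> (0, b *\<^sub>R \<eta>) - (0, b *\<^sub>R \<eta>)"
        have "\<tau> (Suc k) \<le> real n * \<delta>"
          unfolding \<tau>_def using k d by (intro mult_right_mono) auto
        then have tk: "0 \<le> \<tau> k" "\<tau> k \<le> \<tau> (Suc k)" "\<tau> (Suc k) \<le> t" "\<tau> (Suc k) - \<tau> k = \<delta>"
          using d by (auto simp: \<tau>_def algebra_simps)
        have zk: "\<And>s. s \<in> {\<tau> k..\<tau> (Suc k)} \<Longrightarrow> norm (z s - z (\<tau> k)) \<le> e"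
          using elim(2) k by (auto simp: \<tau>_def \<delta>_def)
        have "\<tau> (Suc k) \<in> {\<tau> k..\<tau> (Suc k)}" using tk by auto
        then have wk: "norm \<eta> \<le> e"
          using elim(3) k by (auto simp: \<tau>_def \<delta>_def \<eta>_def)
        have int: "(\<lambda>s. drift (z s)) integrable_on {u..v}" if "0 \<le> u" for u v
          using that by (intro integrable_continuous_real D.continuous_on continuous_on_subset[OF cz]) auto
        define I where "I = integral {\<tau> k..\<tau> (Suc k)} (\<lambda>s. drift (z s) - drift (z (\<tau> k)))"
        have "integral {\<tau> k..\<tau> (Suc k)} (\<lambda>s. drift (z s)) = I + \<delta> *\<^sub>R drift (z (\<tau> k))"
          unfolding I_def using tk int[of "\<tau> k"] by (subst integral_diff) auto
        moreover have "integral {0..\<tau> k} (\<lambda>s. drift (z s)) + integral {\<tau> k..\<tau> (Suc k)} (\<lambda>s. drift (z s))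
            = integral {0..\<tau> (Suc k)} (\<lambda>s. drift (z s))"
          by (rule Henstock_Kurzweil_Integration.integral_combine) (use tk int[of 0] in auto)
        moreover have "z (\<tau> (Suc k)) = x + integral {0..\<tau> (Suc k)} (\<lambda>s. drift (z s)) + (0, b *\<^sub>R w (\<tau> (Suc k)))"
          "z (\<tau> k) = x + integral {0..\<tau> k} (\<lambda>s. drift (z s)) + (0, b *\<^sub>R w (\<tau> k))"
          using tk by (intro ze; simp)+
        moreover have "y' = y + I + d + (0, b *\<^sub>R \<eta>)"
          if "q = I + d" "p + q = p'" "y' = x + p' + (0, b *\<^sub>R w (\<tau> (Suc k)))" "y = x + p + (0, b *\<^sub>R w (\<tau> k))"
          for y y' p p' q d
          using that by (auto simp: \<eta>_def prod_eq_iff algebra_simps)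
        ultimately have z1: "z (\<tau> (Suc k)) = z (\<tau> k) + I + \<delta> *\<^sub>R drift (z (\<tau> k)) + (0, b *\<^sub>R \<eta>)"
          by blast
        have nI: "norm I \<le> (La * e) * \<delta>"
          unfolding I_def tk(4)[symmetric]
        proof (rule integral_bound)
          show "continuous_on {\<tau> k..\<tau> (Suc k)} (\<lambda>s. drift (z s) - drift (z (\<tau> k)))"
            using tk by (intro continuous_intros D.continuous_on continuous_on_subset[OF cz]) auto
          fix s assume "s \<in> {\<tau> k..\<tau> (Suc k)}"
          then show "norm (drift (z s) - drift (z (\<tau> k))) \<le> La * e"
            using zk La by (auto simp flip: D.diff intro!: order_trans[OF La(2)] mult_left_mono)
        qed (use tk in auto)
        have "z (\<tau> (Suc k)) - step \<delta> (z (\<tau> k)) \<eta> = I - ?r1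
            - ?r2"
          unfolding z1 by (subst step_split) (simp add: b_def algebra_simps)
        also have "norm \<dots> \<le> norm I + norm ?r1
            + norm ?r2"
          by (rule order_trans[OF norm_triangle_ineq4 add_right_mono[OF norm_triangle_ineq4]])
        also have "\<dots> \<le> (La * e) * \<delta> + (C * B * e) * \<delta> + (L * b * e) * \<delta>"
        proof (intro add_mono nI)
          have "norm ?r1 \<le> C * \<delta>\<^sup>2 * norm (z (\<tau> k))"
            unfolding C_def by (rule step0_error[OF L(2) L(1) d(1,2)])
          also have "\<dots> \<le> C * (e * \<delta>) * B"
            using d C B0 tk B[of "\<tau> k"] unfolding power2_eq_square
            by (intro mult_mono mult_left_mono mult_right_mono) auto
          finally show "norm ?r1 \<le> (C * B * e) * \<delta>"
            by (simp add: mult_ac)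
          have "norm ?r2 \<le> \<delta> * L * (b * norm \<eta>)"
            using rot_error(1)[OF L(2) L(1) d(1), of "(0, b *\<^sub>R \<eta>)"] b by (simp add: norm_Pair)
          also have "\<dots> \<le> \<delta> * L * (b * e)"
            using d L b wk by (intro mult_left_mono) auto
          finally show "norm ?r2 \<le> (L * b * e) * \<delta>"
            by (simp add: mult_ac)
        qed
        finally have r: "norm (z (\<tau> (Suc k)) - step \<delta> (z (\<tau> k)) \<eta>) \<le> \<delta> * (E * e)"
          by (simp add: E_def algebra_simps)
        have "Z n (Suc k) = step \<delta> (Z n k) \<eta>"
          by (simp add: Z_def \<delta>_def \<eta>_def \<tau>_def)
        then have "z (\<tau> (Suc k)) - Z n (Suc k) = (step \<delta> (z (\<tau> k)) \<eta> - step \<delta> (Z n k) \<eta>)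
            + (z (\<tau> (Suc k)) - step \<delta> (z (\<tau> k)) \<eta>)" by simp
        also have "norm \<dots> \<le> norm (z (\<tau> k) - Z n k) + \<delta> * (E * e)"
          by (intro norm_triangle_le add_mono step_contraction d r)
        finally show ?thesis .
      qed
      have "k \<le> n \<Longrightarrow> norm (z (\<tau> k) - Z n k) \<le> real k * (\<delta> * (E * e))" for k
      proof (induction k)
        case 0
        \<comment> \<open>At time 0 the integral equation gives x plus the noise term in
          \<open>w 0\<close>, which vanishes only almost surely for Brownian paths. This is why the
          chain starts at the shifted point.\<close>
        show ?case using ze[of 0] by (simp add: \<tau>_def Z_def)
      next
        case (Suc k)
        then show ?case using step[of k] by (simp add: algebra_simps)
      qed
      from this[of n] show ?case
        using d(4) by (simp add: \<tau>_def mult.assoc[symmetric])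
    qed
  qed
  have "(\<lambda>n. z t - Z n n) \<longlonglongrightarrow> 0"
  proof (rule tendstoI, simp only: dist_0_norm norm_minus_cancel dist_norm diff_0_right)
    fix r :: real assume r: "r > 0"
    define M where "M = t * E + 1"
    have M: "M > 0" unfolding M_def using t E by (intro add_nonneg_pos mult_nonneg_nonneg) auto
    have "r / M > 0" using r M by simp
    from main[OF this] show "eventually (\<lambda>n. norm (z t - Z n n) < r) sequentially"
    proof eventually_elim
      case (elim n)
      have "t * (E * (r / M)) = (M - 1) * (r / M)" by (simp add: M_def)
      also have "\<dots> < M * (r / M)" using r M by (intro mult_strict_right_mono) auto
      finally show ?case using elim M by simp
    qed
  qed
  then have "(\<lambda>n. z t - (z t - Z n n)) \<longlonglongrightarrow> z t - 0" by (intro tendsto_intros)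
  then show ?thesis by (simp add: Z_def b_def)
qed

text \<open>This is exp(t A) for the drift A, obtained as the solution driven by the zero
  path.\<close>

definition mean_flow :: "real \<Rightarrow> 'a \<times> 'a \<Rightarrow> 'a \<times> 'a" where
  "mean_flow t x = (SOME z. solution (\<lambda>_. 0) x z) t"

lemma mean_flow_solution: "solution (\<lambda>_. 0) x (\<lambda>t. mean_flow t x)"
  unfolding mean_flow_def using someI_ex[OF solution_exists[of "\<lambda>_. 0" x]] by simp

lemma chain_mean_tendsto: "t > 0 \<Longrightarrow> (\<lambda>n. chain (t / n) (\<lambda>_. 0) x n) \<longlonglongrightarrow> mean_flow t x"
  using chain_tendsto_solution[OF mean_flow_solution[of x]] by (simp flip: zero_prod_def)

lemma linear_chain_mean: "linear (\<lambda>x. chain \<delta> (\<lambda>_. 0) x n)"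
proof (induction n)
  case 0 then show ?case by (simp add: linear_id[unfolded id_def])
next
  case (Suc n)
  from linear_compose[OF this linear_step0[of \<delta>]] show ?case by (simp add: o_def)
qed

text \<open>A choice operator says nothing about linearity in the starting point; it comes from the
  noise-free chains, which are linear and converge to the flow.\<close>

lemma linear_mean_flow:
  assumes t: "t > 0"
  shows "linear (mean_flow t)"
proof (rule linearI)
  fix x y c
  have "(\<lambda>n. chain (t / n) (\<lambda>_. 0) (x + y) n) \<longlonglongrightarrow> mean_flow t x + mean_flow t y"
    unfolding linear_add[OF linear_chain_mean] by (intro tendsto_intros chain_mean_tendsto t)
  then show "mean_flow t (x + y) = mean_flow t x + mean_flow t y"
    using chain_mean_tendsto[OF t, of "x + y"] LIMSEQ_unique by blast
  have "(\<lambda>n. chain (t / n) (\<lambda>_. 0) (c *\<^sub>R x) n) \<longlonglongrightarrow> c *\<^sub>R mean_flow t x"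
    unfolding linear_scale[OF linear_chain_mean] by (intro tendsto_intros chain_mean_tendsto t)
  then show "mean_flow t (c *\<^sub>R x) = c *\<^sub>R mean_flow t x"
    using chain_mean_tendsto[OF t, of "c *\<^sub>R x"] LIMSEQ_unique by blast
qed

lemma mean_flow_derivative:
  "((\<lambda>t. (mean_flow t x - x) /\<^sub>R t) \<longlongrightarrow> drift x) (at_right 0)"
proof -
  interpret D: bounded_linear drift by (rule bounded_linear_drift)
  have c: "continuous_on {0..} (\<lambda>t. mean_flow t x)"
    and e: "\<And>t. t \<ge> 0 \<Longrightarrow> mean_flow t x = x + integral {0..t} (\<lambda>s. drift (mean_flow s x))"
    using mean_flow_solution[of x] by (auto simp: solution_def zero_prod_def[symmetric])
  have x0: "mean_flow 0 x = x" using e[of 0] by simp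
  have "((\<lambda>u. integral {0..u} (\<lambda>s. drift (mean_flow s x))) has_vector_derivative drift (mean_flow 0 x)) (at 0 within {0..1})"
    by (intro integral_has_vector_derivative D.continuous_on continuous_on_subset[OF c]) auto
  then have "((\<lambda>u. (1 / norm u) *\<^sub>R (integral {0..u} (\<lambda>s. drift (mean_flow s x)) - u *\<^sub>R drift x)) \<longlongrightarrow> 0) (at_right 0)"
    by (simp add: has_vector_derivative_def has_derivative_within x0 at_within_Icc_at_right)
  moreover have "eventually (\<lambda>u. (1 / norm u) *\<^sub>R (integral {0..u} (\<lambda>s. drift (mean_flow s x)) - u *\<^sub>R drift x)
      = (mean_flow u x - x) /\<^sub>R u - drift x) (at_right 0)"
    unfolding eventually_at_right_field
    by (intro exI[of _ 1]) (auto simp: e[of u for u] algebra_simps divide_inverse)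
  ultimately have "((\<lambda>u. (mean_flow u x - x) /\<^sub>R u - drift x) \<longlongrightarrow> 0) (at_right 0)"
    by (rule Lim_transform_eventually)
  then show ?thesis by (simp add: LIM_zero_iff)
qed

end

section \<open>The standard Gaussian measure\<close>

lemma linear_borel_measurable:
  fixes R :: "'a::euclidean_space \<Rightarrow> 'b::euclidean_space"
  shows "linear R \<Longrightarrow> R \<in> borel_measurable borel"
  by (intro borel_measurable_continuous_onI linear_continuous_on) (simp add: linear_conv_bounded_linear)

lemma inner_square_le: "(m \<bullet> x)\<^sup>2 \<le> (norm m)\<^sup>2 * (norm x)\<^sup>2" for m :: "'a::real_inner"
  using Cauchy_Schwarz_ineq[of m x] by (simp add: power2_norm_eq_inner)

text \<open>The product density rewritten through the norm, which makes its invariance under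
  isometries visible.\<close>

definition gauss_density :: "'a::euclidean_space \<Rightarrow> real" where
  "gauss_density x = (1 / sqrt (2 * pi)) ^ DIM('a) * exp (- (norm x)\<^sup>2 / 2)"

lemma gauss_density_prod: "(\<Prod>b\<in>Basis. normal_density 0 1 (x \<bullet> b)) = gauss_density x"
proof -
  have "(\<Prod>b\<in>Basis. normal_density 0 1 (x \<bullet> b)) = (\<Prod>b\<in>Basis. (1 / sqrt (2 * pi)) * exp (- (x \<bullet> b)\<^sup>2 / 2))"
    by (simp add: std_normal_density_def)
  also have "\<dots> = (1 / sqrt (2 * pi)) ^ DIM('a) * exp (\<Sum>b\<in>Basis. - (x \<bullet> b)\<^sup>2 / 2)"
    by (simp add: prod_dividef exp_sum power_divide)
  also have "(\<Sum>b\<in>Basis. - (x \<bullet> b)\<^sup>2 / 2) = - (norm x)\<^sup>2 / 2"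
    by (simp add: sum_negf norm_eq_sqrt_inner euclidean_inner[of x x] power2_eq_square
        sum_nonneg flip: sum_divide_distrib)
  finally show ?thesis by (simp only: gauss_density_def)
qed

lemma std_gaussian_eq: "std_gaussian = density lborel (\<lambda>x. ennreal (gauss_density x))"
  by (simp add: std_gaussian_def gauss_density_prod)

lemma gauss_density_nonneg [simp]: "0 \<le> gauss_density x"
  by (simp add: gauss_density_def)

lemma gauss_density_measurable [measurable]: "gauss_density \<in> borel_measurable borel"
  unfolding gauss_density_def by measurable

lemma sets_std_gaussian [simp, measurable_cong]: "sets std_gaussian = sets borel"
  and space_std_gaussian [simp]: "space std_gaussian = UNIV"
  by (simp_all add: std_gaussian_def)

lemma measurable_std_gaussian [simp]: "measurable std_gaussian M = measurable borel M"
  by (rule measurable_cong_sets) simp_all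

lemma nn_integral_std_gaussian:
  "f \<in> borel_measurable borel \<Longrightarrow>
    (\<integral>\<^sup>+x. f x \<partial>std_gaussian) = (\<integral>\<^sup>+x. ennreal (gauss_density x) * f x \<partial>lborel)"
  unfolding std_gaussian_eq by (rule nn_integral_density) auto

lemma nn_integral_gauss_density: "(\<integral>\<^sup>+x. ennreal (gauss_density (x :: 'a::euclidean_space)) \<partial>lborel) = 1"
proof -
  have "(\<integral>\<^sup>+x. ennreal (gauss_density (x :: 'a)) \<partial>lborel)
      = (\<integral>\<^sup>+x. (\<Prod>b\<in>Basis. ennreal (normal_density 0 1 ((x :: 'a) \<bullet> b))) \<partial>lborel)"
    by (simp add: gauss_density_prod[symmetric] prod_ennreal)
  also have "\<dots> = (\<Prod>b\<in>(Basis :: 'a set). \<integral>\<^sup>+x. ennreal (normal_density 0 1 x) \<partial>lborel)"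
    by (rule nn_integral_lborel_prod) auto
  also have "(\<integral>\<^sup>+x. ennreal (normal_density 0 1 x) \<partial>lborel) = 1"
    by (subst nn_integral_eq_integral) auto
  finally show ?thesis by simp
qed

lemma prob_space_std_gaussian: "prob_space (std_gaussian :: 'a::euclidean_space measure)"
  by (rule prob_spaceI) (simp add: std_gaussian_eq emeasure_density nn_integral_gauss_density)

interpretation std_gaussian: prob_space "std_gaussian :: 'a::euclidean_space measure"
  by (rule prob_space_std_gaussian)

lemma measure_std_gaussian_UNIV [simp]: "measure std_gaussian (UNIV :: 'a::euclidean_space set) = 1"
  using std_gaussian.prob_space[where 'a = 'a] by simp

lemma nn_integral_lborel_translate:
  fixes c :: "'a::euclidean_space"
  assumes [measurable]: "f \<in> borel_measurable borel"
  shows "(\<integral>\<^sup>+x. f (c + x) \<partial>lborel) = (\<integral>\<^sup>+x. f x \<partial>lborel)"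
  by (subst (2) lborel_distr_plus[of c, symmetric]) (simp add: nn_integral_distr)

text \<open>Uniqueness of Haar measure, specialised: as the Gaussian weight is invariant under \<open>R\<close>,
  comparing the integrals of \<open>f\<close> and \<open>f \<circ> R\<close> with the weight by Fubini gives the
  normalisation \<open>1\<close>.\<close>

lemma nn_integral_lborel_isometry:
  fixes R :: "'a::euclidean_space \<Rightarrow> 'a"
  assumes R: "linear R" "\<And>x. norm (R x) = norm x" and f [measurable]: "f \<in> borel_measurable borel"
  shows "(\<integral>\<^sup>+x. f (R x) \<partial>lborel) = (\<integral>\<^sup>+x. f x \<partial>lborel)"
proof -
  interpret R: linear R by (rule R)
  have [measurable]: "R \<in> borel_measurable borel"
    by (rule linear_borel_measurable[OF R(1)])
  have "inj R"
    by (rule linear_injective_0[OF R(1), THEN iffD2]) (metis R(2) norm_eq_zero)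
  then have "surj R" using eucl.linear_inj_imp_surj[OF R(1)] by blast
  then have RR: "R (inv R y) = y" for y by (rule surj_f_inv_f)
  let ?g = "\<lambda>x. ennreal (gauss_density (x :: 'a))"
  have g: "?g (y - R x) = ?g (- inv R y + x)" for x y
  proof -
    have "norm (y - R x) = norm (R (- inv R y + x))"
      by (subst norm_minus_cancel[symmetric]) (simp add: R.add R.neg R.diff RR)
    then show ?thesis by (simp add: gauss_density_def R(2))
  qed
  have tr: "(\<integral>\<^sup>+x. ?g (c + x) \<partial>lborel) = 1" for c
    by (subst nn_integral_lborel_translate[where f = ?g]) (simp_all add: nn_integral_gauss_density)
  have "(\<integral>\<^sup>+x. f (R x) \<partial>lborel) = (\<integral>\<^sup>+x. f (R x) \<partial>lborel) * (\<integral>\<^sup>+y. ?g y \<partial>lborel)"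
    by (simp add: nn_integral_gauss_density)
  also have "\<dots> = (\<integral>\<^sup>+y. (\<integral>\<^sup>+x. f (R x) \<partial>lborel) * ?g y \<partial>lborel)"
    by (simp add: nn_integral_cmult)
  \<comment> \<open>Shifting x by the preimage of y, and after Fubini y by \<open>- R x\<close>,
    moves \<open>R\<close> from \<open>f\<close> into the Gaussian weight, where \<open>g\<close>
    absorbs it.\<close>
  also have "\<dots> = (\<integral>\<^sup>+y. (\<integral>\<^sup>+x. f (R (inv R y + x)) \<partial>lborel) * ?g y \<partial>lborel)"
    by (simp add: nn_integral_lborel_translate[where f = "\<lambda>x. f (R x)"])
  also have "\<dots> = (\<integral>\<^sup>+y. \<integral>\<^sup>+x. f (y + R x) * ?g y \<partial>lborel \<partial>lborel)"
    by (simp add: nn_integral_multc R.add RR)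
  also have "\<dots> = (\<integral>\<^sup>+x. \<integral>\<^sup>+y. f (y + R x) * ?g y \<partial>lborel \<partial>lborel)"
    by (rule lborel_pair.Fubini') simp
  also have "\<dots> = (\<integral>\<^sup>+x. \<integral>\<^sup>+y. f (- R x + y + R x) * ?g (- R x + y) \<partial>lborel \<partial>lborel)"
    by (intro nn_integral_cong nn_integral_lborel_translate[symmetric]) simp
  also have "\<dots> = (\<integral>\<^sup>+x. \<integral>\<^sup>+y. f y * ?g (y - R x) \<partial>lborel \<partial>lborel)"
    by simp
  also have "\<dots> = (\<integral>\<^sup>+y. \<integral>\<^sup>+x. f y * ?g (y - R x) \<partial>lborel \<partial>lborel)"
    by (rule lborel_pair.Fubini'[symmetric]) simp
  also have "\<dots> = (\<integral>\<^sup>+y. f y * (\<integral>\<^sup>+x. ?g (- inv R y + x) \<partial>lborel) \<partial>lborel)"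
    by (simp add: nn_integral_cmult g)
  also have "\<dots> = (\<integral>\<^sup>+y. f y \<partial>lborel)"
    by (simp only: tr mult_1_right)
  finally show ?thesis .
qed

lemma nn_integral_std_gaussian_isometry:
  fixes R :: "'a::euclidean_space \<Rightarrow> 'a"
  assumes R: "linear R" "\<And>x. norm (R x) = norm x" and f [measurable]: "f \<in> borel_measurable borel"
  shows "(\<integral>\<^sup>+x. f (R x) \<partial>std_gaussian) = (\<integral>\<^sup>+x. f x \<partial>std_gaussian)"
proof -
  have [measurable]: "R \<in> borel_measurable borel"
    by (rule linear_borel_measurable[OF R(1)])
  have [simp]: "gauss_density (R x) = gauss_density x" for x
    by (simp add: gauss_density_def R(2))
  show ?thesis
    using nn_integral_lborel_isometry[OF R, of "\<lambda>x. ennreal (gauss_density x) * f x"]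
    by (simp add: nn_integral_std_gaussian)
qed

lemma gauss_density_Pair: "gauss_density (x, y) = gauss_density x * gauss_density y"
proof -
  have "- (norm (x, y))\<^sup>2 / 2 = - (norm x)\<^sup>2 / 2 + - (norm y)\<^sup>2 / 2"
    by (simp add: norm_Pair add_divide_distrib)
  then show ?thesis
    unfolding gauss_density_def by (simp only: exp_add DIM_prod power_add mult_ac)
qed

lemma std_gaussian_prod:
  "(std_gaussian :: ('a::euclidean_space \<times> 'b::euclidean_space) measure)
    = (std_gaussian :: 'a measure) \<Otimes>\<^sub>M (std_gaussian :: 'b measure)"
proof -
  have sf: "sigma_finite_measure (density lborel (\<lambda>y :: 'b. ennreal (gauss_density y)))"
    using prob_space_imp_sigma_finite[OF prob_space_std_gaussian] by (simp only: std_gaussian_eq)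
  have "(std_gaussian :: 'a measure) \<Otimes>\<^sub>M (std_gaussian :: 'b measure)
      = density (lborel \<Otimes>\<^sub>M lborel) (\<lambda>(x, y). ennreal (gauss_density x) * ennreal (gauss_density y))"
    unfolding std_gaussian_eq
    by (rule pair_measure_density[OF _ _ sigma_finite_lborel sf]) simp_all
  also have "(\<lambda>(x :: 'a, y :: 'b). ennreal (gauss_density x) * ennreal (gauss_density y))
      = (\<lambda>z. ennreal (gauss_density z))"
    by (auto simp: fun_eq_iff gauss_density_Pair ennreal_mult)
  finally show ?thesis by (simp add: std_gaussian_eq lborel_prod)
qed

lemma nn_integral_std_gaussian_prod:
  assumes [measurable]: "f \<in> borel_measurable (borel :: ('a::euclidean_space \<times> 'b::euclidean_space) measure)"
  shows "(\<integral>\<^sup>+z. f z \<partial>std_gaussian) = (\<integral>\<^sup>+x. \<integral>\<^sup>+y. f (x, y) \<partial>std_gaussian \<partial>std_gaussian)"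
  unfolding std_gaussian_prod
  by (rule std_gaussian.nn_integral_fst[symmetric]) (simp flip: std_gaussian_prod)

text \<open>Brownian increments have variance depending on the step, while the kernels below
  integrate against the standard Gaussian. The factor \<open>\<sigma> ^ DIM('a)\<close> is the
  Jacobian of the scaling.\<close>

lemma distributed_normal_scale:
  assumes X: "distributed M lborel X (\<lambda>x. ennreal (\<Prod>b\<in>Basis. normal_density 0 \<sigma> (x \<bullet> b)))"
    and s: "\<sigma> > 0" and [measurable]: "f \<in> borel_measurable borel"
  shows "(\<integral>\<^sup>+\<omega>. f (X \<omega>) \<partial>M) = (\<integral>\<^sup>+\<xi>. f (\<sigma> *\<^sub>R \<xi>) \<partial>(std_gaussian :: 'a::euclidean_space measure))"
proof -
  let ?n = "\<lambda>x :: 'a. ennreal (\<Prod>b\<in>Basis. normal_density 0 \<sigma> (x \<bullet> b))"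
  have sc: "ennreal (\<sigma> ^ DIM('a)) * ?n (\<sigma> *\<^sub>R x) = ennreal (gauss_density x)" for x :: 'a
  proof -
    have 1: "normal_density 0 \<sigma> (\<sigma> * y) = normal_density 0 1 y / \<sigma>" for y
      using s by (simp add: normal_density_def real_sqrt_mult power_mult_distrib)
    have "\<sigma> ^ DIM('a) * (\<Prod>b\<in>Basis. normal_density 0 \<sigma> (\<sigma> * (x \<bullet> b))) = gauss_density x"
      using s by (simp add: 1 prod_dividef gauss_density_prod)
    then show ?thesis using s by (simp add: ennreal_mult'[symmetric])
  qed
  have "(\<integral>\<^sup>+\<omega>. f (X \<omega>) \<partial>M) = (\<integral>\<^sup>+x. ?n x * f x \<partial>lborel)"
    using distributed_nn_integral[OF X, of f] by simp
  also have "\<dots> = (\<integral>\<^sup>+x. ennreal (\<sigma> ^ DIM('a)) * (?n (\<sigma> *\<^sub>R x) * f (\<sigma> *\<^sub>R x)) \<partial>lborel)"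
    using s by (subst lborel_affine[of \<sigma> 0]) (simp_all add: nn_integral_density nn_integral_distr)
  also have "\<dots> = (\<integral>\<^sup>+\<xi>. f (\<sigma> *\<^sub>R \<xi>) \<partial>std_gaussian)"
    by (simp add: nn_integral_std_gaussian flip: sc mult.assoc)
  finally show ?thesis .
qed

section \<open>Gaussian moments and Wick's formula\<close>

lemma std_gaussian_monomial:
  fixes k :: "'a::euclidean_space \<Rightarrow> nat"
  shows "integrable std_gaussian (\<lambda>x. \<Prod>b\<in>Basis. (x \<bullet> b) ^ k b)"
    and "(\<integral>x. (\<Prod>b\<in>Basis. (x \<bullet> b) ^ k b) \<partial>std_gaussian)
      = (\<Prod>b\<in>Basis. \<integral>y. std_normal_density y * y ^ k b \<partial>lborel)"
proof -
  interpret product_sigma_finite "\<lambda>_ :: 'a. lborel :: real measure"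
    by standard
  let ?f = "\<lambda>b y. std_normal_density y * y ^ k b"
  let ?F = "\<lambda>x :: 'a. \<Prod>b\<in>Basis. ?f b (x \<bullet> b)"
  have F: "gauss_density x * (\<Prod>b\<in>Basis. (x \<bullet> b) ^ k b) = ?F x" for x :: 'a
    by (simp add: gauss_density_prod[symmetric] prod.distrib)
  have co: "(\<Sum>b\<in>Basis. f b *\<^sub>R b) \<bullet> c = f c" if "c \<in> Basis" for f and c :: 'a
    using that by simp
  have m: "(\<lambda>f. \<Sum>b\<in>Basis. f b *\<^sub>R b :: 'a) \<in> measurable (\<Pi>\<^sub>M b\<in>Basis. lborel) borel"
    by measurable
  have "integrable (\<Pi>\<^sub>M b\<in>(Basis :: 'a set). lborel) (\<lambda>f. \<Prod>b\<in>Basis. ?f b (f b))"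
    by (rule product_integrable_prod) (auto intro: integrable_std_normal_moment)
  then have I: "integrable lborel ?F"
    by (subst lborel_eq) (simp add: integrable_distr_eq m cong: prod.cong)
  then show "integrable std_gaussian (\<lambda>x. \<Prod>b\<in>Basis. (x \<bullet> b) ^ k b)"
    unfolding std_gaussian_eq by (subst integrable_density) (auto simp: F)
  have "(\<integral>x. (\<Prod>b\<in>Basis. (x \<bullet> b) ^ k b) \<partial>std_gaussian) = integral\<^sup>L lborel ?F"
    unfolding std_gaussian_eq by (subst integral_density) (auto simp: F)
  also have "\<dots> = (\<integral>f. (\<Prod>b\<in>(Basis :: 'a set). ?f b (f b)) \<partial>(\<Pi>\<^sub>M b\<in>(Basis :: 'a set). lborel))"
    by (subst lborel_eq) (simp add: integral_distr m cong: prod.cong)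
  also have "\<dots> = (\<Prod>b\<in>Basis. \<integral>y. std_normal_density y * y ^ k b \<partial>lborel)"
    by (rule product_integral_prod) (auto intro: integrable_std_normal_moment)
  finally show "(\<integral>x. (\<Prod>b\<in>Basis. (x \<bullet> b) ^ k b) \<partial>std_gaussian)
      = (\<Prod>b\<in>Basis. \<integral>y. std_normal_density y * y ^ k b \<partial>lborel)" .
qed

lemma std_normal_moments:
  "(\<integral>y. std_normal_density y * y ^ 0 \<partial>lborel) = 1" "(\<integral>y. std_normal_density y * y ^ 1 \<partial>lborel) = 0"
  "(\<integral>y. std_normal_density y * y ^ 2 \<partial>lborel) = 1" "(\<integral>y. std_normal_density y * y ^ 3 \<partial>lborel) = 0"
  "(\<integral>y. std_normal_density y * y ^ 4 \<partial>lborel) = 3"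
  using integral_std_normal_moment_even[of 0] integral_std_normal_moment_even[of 1]
    integral_std_normal_moment_even[of 2] integral_std_normal_moment_odd[of 0]
    integral_std_normal_moment_odd[of 1]
  by (simp_all add: fact_numeral)

lemma std_gaussian_product:
  fixes bs :: "'a::euclidean_space list"
  assumes "set bs \<subseteq> Basis"
  shows "integrable std_gaussian (\<lambda>x. \<Prod>b\<leftarrow>bs. b \<bullet> x)"
    and "(\<integral>x. (\<Prod>b\<leftarrow>bs. b \<bullet> x) \<partial>std_gaussian)
      = (\<Prod>b\<in>set bs. \<integral>y. std_normal_density y * y ^ count_list bs b \<partial>lborel)"
proof -
  have eq: "(\<Prod>b\<leftarrow>bs. b \<bullet> x) = (\<Prod>b\<in>Basis. (x \<bullet> b) ^ count_list bs b)" for x :: 'a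
    using assms
  proof (induction bs)
    case (Cons c bs)
    have one: "(\<Prod>b\<in>Basis. (x \<bullet> b) ^ of_bool (b = c)) = c \<bullet> x"
      using Cons.prems by (subst prod.remove[of _ c]) (auto intro!: prod.neutral simp: inner_commute)
    have "count_list (c # bs) b = of_bool (b = c) + count_list bs b" for b by simp
    then show ?case
      using Cons one by (simp only: power_add prod.distrib) simp
  qed simp
  show "integrable std_gaussian (\<lambda>x. \<Prod>b\<leftarrow>bs. b \<bullet> x)"
    unfolding eq by (rule std_gaussian_monomial)
  show "(\<integral>x. (\<Prod>b\<leftarrow>bs. b \<bullet> x) \<partial>std_gaussian)
      = (\<Prod>b\<in>set bs. \<integral>y. std_normal_density y * y ^ count_list bs b \<partial>lborel)"
    unfolding eq std_gaussian_monomial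
    \<comment> \<open>Basis vectors missing from the list contribute the moment of order zero, which
      is 1.\<close>
    using assms std_normal_moments(1) by (intro prod.mono_neutral_right) (auto simp: count_list_0_iff)
qed

text \<open>For basis vectors the integral factors into one-dimensional moments, so only the
  coincidences among the four vectors matter: three pairings when all agree, one for two distinct
  pairs, none otherwise.\<close>

lemma wick_basis:
  fixes i j k l :: "'a::euclidean_space"
  assumes "i \<in> Basis" "j \<in> Basis" "k \<in> Basis" "l \<in> Basis"
  shows "integrable std_gaussian (\<lambda>x. (i \<bullet> x) * ((j \<bullet> x) * ((k \<bullet> x) * (l \<bullet> x))))"
    and "(\<integral>x. (i \<bullet> x) * ((j \<bullet> x) * ((k \<bullet> x) * (l \<bullet> x))) \<partial>std_gaussian)
      = (i \<bullet> j) * (k \<bullet> l) + (i \<bullet> k) * (j \<bullet> l) + (i \<bullet> l) * (j \<bullet> k)"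
proof -
  show "integrable std_gaussian (\<lambda>x. (i \<bullet> x) * ((j \<bullet> x) * ((k \<bullet> x) * (l \<bullet> x))))"
    using std_gaussian_product(1)[of "[i, j, k, l]"] assms by simp
  show "(\<integral>x. (i \<bullet> x) * ((j \<bullet> x) * ((k \<bullet> x) * (l \<bullet> x))) \<partial>std_gaussian)
      = (i \<bullet> j) * (k \<bullet> l) + (i \<bullet> k) * (j \<bullet> l) + (i \<bullet> l) * (j \<bullet> k)"
  proof -
    define m where "m = (\<lambda>k. \<integral>y. std_normal_density y * y ^ k \<partial>lborel)"
    have ms: "m (Suc 0) = 0" "m (Suc (Suc 0)) = 1" "m (Suc (Suc (Suc 0))) = 0" "m (Suc (Suc (Suc (Suc 0)))) = 3"
      using std_normal_moments unfolding m_def by (simp_all add: numeral_eq_Suc)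
    have "(\<integral>x. (i \<bullet> x) * ((j \<bullet> x) * ((k \<bullet> x) * (l \<bullet> x))) \<partial>std_gaussian) = (\<Prod>b\<in>{i, j, k, l}. m (count_list [i, j, k, l] b))"
      using std_gaussian_product(2)[of "[i, j, k, l]"] assms by (simp add: m_def)
    also have "\<dots> = (i \<bullet> j) * (k \<bullet> l) + (i \<bullet> k) * (j \<bullet> l) + (i \<bullet> l) * (j \<bullet> k)"
      unfolding inner_Basis[OF assms(1,2)] inner_Basis[OF assms(1,3)] inner_Basis[OF assms(1,4)]
        inner_Basis[OF assms(2,3)] inner_Basis[OF assms(2,4)] inner_Basis[OF assms(3,4)]
      by (cases "i = j"; cases "i = k"; cases "i = l"; cases "j = k"; cases "j = l"; cases "k = l")
        (simp_all add: ms insert_commute)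
    finally show ?thesis .
  qed
qed

lemma wick2_basis:
  fixes i j :: "'a::euclidean_space"
  assumes "i \<in> Basis" "j \<in> Basis"
  shows "integrable std_gaussian (\<lambda>x. (i \<bullet> x) * (j \<bullet> x))"
    and "(\<integral>x. (i \<bullet> x) * (j \<bullet> x) \<partial>std_gaussian) = i \<bullet> j"
  using std_gaussian_product[of "[i, j]"] std_normal_moments(2,3) assms
  by (simp_all add: inner_Basis numeral_eq_Suc)

text \<open>Lets a moment identity that is linear in one vector be checked on the basis only,
  together with integrability.\<close>

lemma linear_extension_integral:
  fixes h L :: "'a::euclidean_space \<Rightarrow> real"
  assumes b: "\<And>b. b \<in> Basis \<Longrightarrow> integrable M (\<lambda>x. (b \<bullet> x) * h x)"
    "\<And>b. b \<in> Basis \<Longrightarrow> (\<integral>x. (b \<bullet> x) * h x \<partial>M) = L b" and L: "linear L"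
  shows "integrable M (\<lambda>x. (u \<bullet> x) * h x) \<and> (\<integral>x. (u \<bullet> x) * h x \<partial>M) = L u"
proof -
  have eq: "(u \<bullet> x) * h x = (\<Sum>b\<in>Basis. (u \<bullet> b) * ((b \<bullet> x) * h x))" for x
    by (subst euclidean_inner) (simp add: sum_distrib_right mult.assoc inner_commute)
  have "L u = (\<Sum>b\<in>Basis. (u \<bullet> b) * L b)"
    by (subst (1) euclidean_representation[of u, symmetric])
      (simp add: linear_sum[OF L] linear_scale[OF L])
  then show ?thesis
    unfolding eq using b by (auto intro!: integrable_sum)
qed

lemma wick:
  fixes u v w z :: "'a::euclidean_space"
  shows "integrable std_gaussian (\<lambda>x. (u \<bullet> x) * ((v \<bullet> x) * ((w \<bullet> x) * (z \<bullet> x)))) \<and>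
    (\<integral>x. (u \<bullet> x) * ((v \<bullet> x) * ((w \<bullet> x) * (z \<bullet> x))) \<partial>std_gaussian)
      = (u \<bullet> v) * (w \<bullet> z) + (u \<bullet> w) * (v \<bullet> z) + (u \<bullet> z) * (v \<bullet> w)"
proof -
  define P where "P = (\<lambda>u v w z :: 'a. integrable std_gaussian (\<lambda>x. (u \<bullet> x) * ((v \<bullet> x) * ((w \<bullet> x) * (z \<bullet> x)))) \<and>
    (\<integral>x. (u \<bullet> x) * ((v \<bullet> x) * ((w \<bullet> x) * (z \<bullet> x))) \<partial>std_gaussian)
      = (u \<bullet> v) * (w \<bullet> z) + (u \<bullet> w) * (v \<bullet> z) + (u \<bullet> z) * (v \<bullet> w))"
  have lin: "linear (\<lambda>u. (u \<bullet> v) * (w \<bullet> z) + (u \<bullet> w) * (v \<bullet> z) + (u \<bullet> z) * (v \<bullet> w))" for v w z :: 'a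
    by (rule linearI) (auto simp: inner_add_left algebra_simps)
  have ext: "P u v w z" if "\<And>b. b \<in> Basis \<Longrightarrow> P b v w z" for u v w z
    using linear_extension_integral[where M = std_gaussian and h = "\<lambda>x. (v \<bullet> x) * ((w \<bullet> x) * (z \<bullet> x))", OF _ _ lin] that
    unfolding P_def by blast
  \<comment> \<open>The statement is invariant under cyclic rotation of its arguments, so extending
    the first slot only, once per rotation, frees all four slots.\<close>
  have rot: "P v w z u = P u v w z" for u v w z
    unfolding P_def by (simp add: inner_commute[of _ u] mult_ac add_ac)
  have 0: "P u v w z" if "u \<in> Basis" "v \<in> Basis" "w \<in> Basis" "z \<in> Basis" for u v w z
    unfolding P_def
    using wick_basis[OF that] by blast
  have 1: "P u v w z" if "v \<in> Basis" "w \<in> Basis" "z \<in> Basis" for u v w z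
    using ext 0 that by blast
  have 2: "P u v w z" if "w \<in> Basis" "z \<in> Basis" for u v w z
  proof -
    have "P v w z u" by (rule ext) (use 1 rot that in metis)
    then show ?thesis using rot by metis
  qed
  have 3: "P u v w z" if "z \<in> Basis" for u v w z
  proof -
    have "P w z u v" by (rule ext) (use 2 rot that in metis)
    then show ?thesis using rot by metis
  qed
  have "P z u v w" by (rule ext) (use 3 rot in metis)
  then have "P u v w z" using rot by metis
  then show ?thesis unfolding P_def .
qed

lemma wick2:
  fixes u v :: "'a::euclidean_space"
  shows "integrable std_gaussian (\<lambda>x. (u \<bullet> x) * (v \<bullet> x)) \<and> (\<integral>x. (u \<bullet> x) * (v \<bullet> x) \<partial>std_gaussian) = u \<bullet> v"
proof -
  have lin: "linear (\<lambda>u. u \<bullet> v)" for v :: 'a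
    by (rule linearI) (auto simp: inner_add_left)
  have 1: "integrable std_gaussian (\<lambda>x. (u \<bullet> x) * (v \<bullet> x)) \<and> (\<integral>x. (u \<bullet> x) * (v \<bullet> x) \<partial>std_gaussian) = u \<bullet> v"
    if "v \<in> Basis" for u v :: 'a
    by (rule linear_extension_integral[OF _ _ lin]) (use wick2_basis that in auto)
  have "integrable std_gaussian (\<lambda>x. (v \<bullet> x) * (u \<bullet> x)) \<and> (\<integral>x. (v \<bullet> x) * (u \<bullet> x) \<partial>std_gaussian) = v \<bullet> u"
    by (rule linear_extension_integral[OF _ _ lin]) (use 1[of _ u] in \<open>auto simp: mult.commute inner_commute\<close>)
  then show ?thesis by (simp add: mult.commute inner_commute)
qed

section \<open>Transition kernels of the scheme\<close>

lemma std_gaussian_mean: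
  fixes u :: "'a::euclidean_space"
  shows "integrable std_gaussian (\<lambda>x. u \<bullet> x) \<and> (\<integral>x. u \<bullet> x \<partial>std_gaussian) = 0"
proof -
  have 1: "integrable std_gaussian (\<lambda>x. b \<bullet> x)" and 2: "(\<integral>x. b \<bullet> x \<partial>std_gaussian) = 0" if "b \<in> Basis" for b :: 'a
    using std_gaussian_product[of "[b]"] std_normal_moments(2) that by simp_all
  have "integrable std_gaussian (\<lambda>x. (u \<bullet> x) * 1) \<and> (\<integral>x. (u \<bullet> x) * 1 \<partial>std_gaussian) = 0"
    by (rule linear_extension_integral) (auto simp: 1 2 linear_iff)
  then show ?thesis by simp
qed

lemma integral_gaussian_affine_square:
  fixes w :: "'a::euclidean_space"
  assumes k: "k \<ge> 0"
  shows "(\<integral>\<^sup>+\<xi>. ennreal ((a + w \<bullet> \<xi>)\<^sup>2 + k) \<partial>std_gaussian) = ennreal (a\<^sup>2 + (w \<bullet> w) + k)"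
proof -
  note i1 = std_gaussian_mean[of w, THEN conjunct1] and i0 = std_gaussian_mean[of w, THEN conjunct2]
  have eq: "(a + w \<bullet> \<xi>)\<^sup>2 + k = (a\<^sup>2 + k) + (2 * a * (w \<bullet> \<xi>) + (w \<bullet> \<xi>) * (w \<bullet> \<xi>))" for \<xi>
    by (simp add: power2_eq_square algebra_simps)
  have "(\<integral>\<^sup>+\<xi>. ennreal ((a + w \<bullet> \<xi>)\<^sup>2 + k) \<partial>std_gaussian) = ennreal (\<integral>\<xi>. (a + w \<bullet> \<xi>)\<^sup>2 + k \<partial>std_gaussian)"
  proof (rule nn_integral_eq_integral)
    show "integrable std_gaussian (\<lambda>\<xi>. (a + w \<bullet> \<xi>)\<^sup>2 + k)"
      unfolding eq using wick2[of w w] i1 by simp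
  qed (use k in auto)
  also have "(\<integral>\<xi>. (a + w \<bullet> \<xi>)\<^sup>2 + k \<partial>std_gaussian) = a\<^sup>2 + (w \<bullet> w) + k"
    unfolding eq using wick2[of w w] i1 i0 by simp
  finally show ?thesis .
qed

context skew_langevin
begin

text \<open>The transition kernel of one step. Values in \<open>ennreal\<close> let Fubini and the
  duality hold for all measurable functions.\<close>

definition fwd :: "real \<Rightarrow> ('a \<times> 'a \<Rightarrow> ennreal) \<Rightarrow> 'a \<times> 'a \<Rightarrow> ennreal" where
  "fwd \<delta> u x = (\<integral>\<^sup>+\<xi>. u (step \<delta> x (sqrt \<delta> *\<^sub>R \<xi>)) \<partial>std_gaussian)"

text \<open>The adjoint of \<open>fwd\<close> with respect to the Gaussian: the factors appear in
  reverse order, the rotation is inverted, and the autoregressive momentum step is its own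
  adjoint.\<close>

definition bwd :: "real \<Rightarrow> ('a \<times> 'a \<Rightarrow> ennreal) \<Rightarrow> 'a \<times> 'a \<Rightarrow> ennreal" where
  "bwd \<delta> h x = (\<integral>\<^sup>+\<xi>. h (fst (inv (rot \<delta>) x),
     damp \<delta> *\<^sub>R snd (inv (rot \<delta>) x) + sqrt (2 * \<gamma> * \<delta>) *\<^sub>R \<xi>) \<partial>std_gaussian)"

lemma inj_rot: "inj (rot \<delta>)"
  by (rule linear_injective_0[OF linear_rot, THEN iffD2]) (metis norm_rot norm_eq_zero)

lemma surj_rot: "surj (rot \<delta>)"
  using eucl.linear_inj_imp_surj[OF linear_rot inj_rot] by blast

lemma inv_rot [simp]: "inv (rot \<delta>) (rot \<delta> x) = x" "rot \<delta> (inv (rot \<delta>) x) = x"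
  by (simp_all add: inj_rot surj_rot surj_f_inv_f)

lemma linear_inv_rot: "linear (inv (rot \<delta>))"
  by (rule linearI; rule injD[OF inj_rot[of \<delta>]])
    (simp_all add: linear_add[OF linear_rot] linear_scale[OF linear_rot])

lemma rot_measurable [measurable]: "rot \<delta> \<in> borel_measurable borel"
  by (rule linear_borel_measurable[OF linear_rot])

lemma inv_rot_measurable [measurable]: "inv (rot \<delta>) \<in> borel_measurable borel"
  by (rule linear_borel_measurable[OF linear_inv_rot])

lemma rot_inner: "rot \<delta> x \<bullet> rot \<delta> y = x \<bullet> y"
proof -
  have n: "rot \<delta> z \<bullet> rot \<delta> z = z \<bullet> z" for z
    using norm_rot[of \<delta> z] by (simp add: norm_eq_sqrt_inner)
  show ?thesis
    using n[of "x + y"] n[of x] n[of y]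
    by (simp add: linear_add[OF linear_rot] inner_add_left inner_add_right inner_commute)
qed

lemma borel_measurable_fst [measurable]: "(fst :: 'a \<times> 'a \<Rightarrow> 'a) \<in> borel_measurable borel"
  and borel_measurable_snd [measurable]: "(snd :: 'a \<times> 'a \<Rightarrow> 'a) \<in> borel_measurable borel"
  by (intro borel_measurable_continuous_onI continuous_intros)+

lemma step_measurable [measurable]:
  assumes [measurable]: "f \<in> borel_measurable N" "g \<in> borel_measurable N"
  shows "(\<lambda>x. step \<delta> (f x) (g x)) \<in> borel_measurable N"
  unfolding step_def by (intro measurable_compose[OF _ rot_measurable] borel_measurable_Pair) measurable

lemma fwd_measurable [measurable]:
  assumes [measurable]: "u \<in> borel_measurable borel"
  shows "fwd \<delta> u \<in> borel_measurable borel"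
  unfolding fwd_def by measurable

lemma bwd_measurable [measurable]:
  assumes [measurable]: "h \<in> borel_measurable borel"
  shows "bwd \<delta> h \<in> borel_measurable borel"
proof -
  have [measurable]: "(\<lambda>(x, \<xi>). (fst (inv (rot \<delta>) x),
     damp \<delta> *\<^sub>R snd (inv (rot \<delta>) x) + sqrt (2 * \<gamma> * \<delta>) *\<^sub>R \<xi>)) \<in> borel_measurable (borel \<Otimes>\<^sub>M borel)"
    unfolding split_def by (intro borel_measurable_Pair) measurable
  show ?thesis unfolding bwd_def by measurable
qed

text \<open>Reversibility of the autoregressive step is an isometry of the pair (momentum, noise)
  that exchanges old and new momentum; the rotation is handled by its own invariance.\<close>

lemma fwd_bwd_duality:
  assumes d: "\<delta> \<ge> 0" "2 * \<gamma> * \<delta> \<le> 1"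
    and [measurable]: "u \<in> borel_measurable borel" "h \<in> borel_measurable borel"
  shows "(\<integral>\<^sup>+x. fwd \<delta> u x * h x \<partial>std_gaussian) = (\<integral>\<^sup>+x. u x * bwd \<delta> h x \<partial>std_gaussian)"
proof -
  define c where "c = damp \<delta>"
  define s where "s = sqrt (2 * \<gamma> * \<delta>)"
  have "s\<^sup>2 = 2 * \<gamma> * \<delta>" using d gamma_pos by (simp add: s_def)
  then have cs: "c * c + s * s = 1" using damp_bounds(5)[OF d] by (simp add: c_def power2_eq_square)
  \<comment> \<open>A reflection, since \<open>c * c + s * s = 1\<close>: its first component is the
    new momentum, and the same formula applied to its image recovers the old one. The product
    Gaussian is invariant under it.\<close>
  define T :: "'a \<times> 'a \<Rightarrow> 'a \<times> 'a" where "T = (\<lambda>(p, \<xi>). (c *\<^sub>R p + s *\<^sub>R \<xi>, s *\<^sub>R p - c *\<^sub>R \<xi>))"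
  have T: "linear T"
    unfolding T_def by (rule linearI) (auto simp: algebra_simps)
  have nT: "norm (T z) = norm z" for z
  proof -
    have "T z \<bullet> T z = (c * c + s * s) * (fst z \<bullet> fst z) + (c * c + s * s) * (snd z \<bullet> snd z)"
      by (cases z) (simp add: T_def inner_add_left inner_add_right inner_diff_left inner_diff_right
          inner_commute algebra_simps)
    then show ?thesis unfolding cs by (cases z) (simp add: norm_eq_sqrt_inner)
  qed
  have TT: "c *\<^sub>R fst (T (p, \<xi>)) + s *\<^sub>R snd (T (p, \<xi>)) = p" for p \<xi>
  proof -
    have "c *\<^sub>R fst (T (p, \<xi>)) + s *\<^sub>R snd (T (p, \<xi>)) = (c * c + s * s) *\<^sub>R p"
      by (simp add: T_def algebra_simps)
    then show ?thesis by (simp add: cs)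
  qed
  have st: "step \<delta> (q, p) (sqrt \<delta> *\<^sub>R \<xi>) = rot \<delta> (q, fst (T (p, \<xi>)))" for q p \<xi>
    by (simp add: step_def T_def c_def s_def real_sqrt_mult)
  define G where "G = (\<lambda>q (a, b). u (rot \<delta> (q, a)) * h (q, c *\<^sub>R a + s *\<^sub>R b))"
  have Gm [measurable]: "G q \<in> borel_measurable borel" for q
    unfolding G_def split_def
    by (intro borel_measurable_times_ennreal measurable_compose[OF _ assms(3)] measurable_compose[OF _ assms(4)]
        measurable_compose[OF _ rot_measurable] borel_measurable_Pair) measurable
  have "(\<integral>\<^sup>+x. fwd \<delta> u x * h x \<partial>std_gaussian)
      = (\<integral>\<^sup>+q. \<integral>\<^sup>+p. fwd \<delta> u (q, p) * h (q, p) \<partial>std_gaussian \<partial>std_gaussian)"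
    by (rule nn_integral_std_gaussian_prod) measurable
  also have "\<dots> = (\<integral>\<^sup>+q. \<integral>\<^sup>+p. \<integral>\<^sup>+\<xi>. G q (T (p, \<xi>)) \<partial>std_gaussian \<partial>std_gaussian \<partial>std_gaussian)"
  proof (intro nn_integral_cong)
    fix q p
    have "fwd \<delta> u (q, p) * h (q, p) = (\<integral>\<^sup>+\<xi>. u (step \<delta> (q, p) (sqrt \<delta> *\<^sub>R \<xi>)) * h (q, p) \<partial>std_gaussian)"
      unfolding fwd_def by (rule nn_integral_multc[symmetric]) measurable
    also have "\<dots> = (\<integral>\<^sup>+\<xi>. G q (T (p, \<xi>)) \<partial>std_gaussian)"
      by (intro nn_integral_cong) (simp add: st G_def split_def TT)
    finally show "fwd \<delta> u (q, p) * h (q, p) = (\<integral>\<^sup>+\<xi>. G q (T (p, \<xi>)) \<partial>std_gaussian)" .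
  qed
  also have "\<dots> = (\<integral>\<^sup>+q. \<integral>\<^sup>+z. G q (T z) \<partial>std_gaussian \<partial>std_gaussian)"
  proof (intro nn_integral_cong nn_integral_std_gaussian_prod[symmetric])
    have [measurable]: "T \<in> borel_measurable borel"
      by (rule linear_borel_measurable[OF T])
    show "(\<lambda>z. G q (T z)) \<in> borel_measurable borel" for q by measurable
  qed
  also have "\<dots> = (\<integral>\<^sup>+q. \<integral>\<^sup>+z. G q z \<partial>std_gaussian \<partial>std_gaussian)"
    by (intro nn_integral_cong nn_integral_std_gaussian_isometry T nT Gm)
  also have "\<dots> = (\<integral>\<^sup>+q. \<integral>\<^sup>+a. \<integral>\<^sup>+b. G q (a, b) \<partial>std_gaussian \<partial>std_gaussian \<partial>std_gaussian)"
    by (intro nn_integral_cong nn_integral_std_gaussian_prod Gm)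
  also have "\<dots> = (\<integral>\<^sup>+q. \<integral>\<^sup>+a. u (rot \<delta> (q, a)) * bwd \<delta> h (rot \<delta> (q, a)) \<partial>std_gaussian \<partial>std_gaussian)"
  proof (intro nn_integral_cong)
    fix q a
    have [measurable]: "(\<lambda>b. h (q, c *\<^sub>R a + s *\<^sub>R b)) \<in> borel_measurable borel"
      by (intro measurable_compose[OF _ assms(4)] borel_measurable_Pair) measurable
    have "(\<integral>\<^sup>+b. G q (a, b) \<partial>std_gaussian) = u (rot \<delta> (q, a)) * (\<integral>\<^sup>+b. h (q, c *\<^sub>R a + s *\<^sub>R b) \<partial>std_gaussian)"
      unfolding G_def by (simp add: nn_integral_cmult)
    then show "(\<integral>\<^sup>+b. G q (a, b) \<partial>std_gaussian) = u (rot \<delta> (q, a)) * bwd \<delta> h (rot \<delta> (q, a))"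
      by (simp add: bwd_def c_def s_def)
  qed
  also have "\<dots> = (\<integral>\<^sup>+x. u (rot \<delta> x) * bwd \<delta> h (rot \<delta> x) \<partial>std_gaussian)"
    by (rule nn_integral_std_gaussian_prod[symmetric]) measurable
  also have "\<dots> = (\<integral>\<^sup>+x. u x * bwd \<delta> h x \<partial>std_gaussian)"
    by (rule nn_integral_std_gaussian_isometry[OF linear_rot norm_rot]) measurable
  finally show ?thesis .
qed

lemma fwd_funpow_measurable [measurable]:
  "u \<in> borel_measurable borel \<Longrightarrow> (fwd \<delta> ^^ n) u \<in> borel_measurable borel"
  by (induction n) auto

lemma bwd_funpow_measurable [measurable]:
  "u \<in> borel_measurable borel \<Longrightarrow> (bwd \<delta> ^^ n) u \<in> borel_measurable borel"
  by (induction n) auto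

lemma fwd_bwd_funpow_duality:
  assumes d: "\<delta> \<ge> 0" "2 * \<gamma> * \<delta> \<le> 1"
    and u: "u \<in> borel_measurable borel" and h: "h \<in> borel_measurable borel"
  shows "(\<integral>\<^sup>+x. (fwd \<delta> ^^ n) u x * h x \<partial>std_gaussian) = (\<integral>\<^sup>+x. u x * (bwd \<delta> ^^ n) h x \<partial>std_gaussian)"
  using u h
proof (induction n arbitrary: h)
  case (Suc n)
  have "(\<integral>\<^sup>+x. (fwd \<delta> ^^ Suc n) u x * h x \<partial>std_gaussian) = (\<integral>\<^sup>+x. (fwd \<delta> ^^ n) u x * bwd \<delta> h x \<partial>std_gaussian)"
    using Suc.prems by (simp add: fwd_bwd_duality d)
  also have "\<dots> = (\<integral>\<^sup>+x. u x * (bwd \<delta> ^^ Suc n) h x \<partial>std_gaussian)"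
    using Suc.prems by (simp add: Suc.IH funpow_swap1)
  finally show ?case .
qed simp

text \<open>A class of nonnegative quadratic functions that both kernels map into itself, and whose
  polarization gives all products of two linear forms.\<close>

definition sq :: "'a \<times> 'a \<Rightarrow> real \<Rightarrow> 'a \<times> 'a \<Rightarrow> ennreal" where
  "sq v k x = ennreal ((v \<bullet> x)\<^sup>2 + k)"

lemma sq_measurable [measurable]: "sq v k \<in> borel_measurable borel"
  unfolding sq_def by measurable

lemma damp_inner: "(fst v \<bullet> fst y) + snd v \<bullet> (damp \<delta> *\<^sub>R snd y + e)
    = (fst v, damp \<delta> *\<^sub>R snd v) \<bullet> y + snd v \<bullet> e"
  by (simp add: inner_prod_def inner_add_right)

lemma norm_damp_eq:
  fixes v :: "'a \<times> 'a"
  assumes "\<delta> \<ge> 0" "2 * \<gamma> * \<delta> \<le> 1"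
  shows "2 * \<gamma> * \<delta> * (snd v \<bullet> snd v) = (norm v)\<^sup>2 - (norm (fst v, damp \<delta> *\<^sub>R snd v))\<^sup>2"
proof -
  have N: "(norm z)\<^sup>2 = fst z \<bullet> fst z + snd z \<bullet> snd z" for z :: "'a \<times> 'a"
    by (metis inner_prod_def power2_norm_eq_inner)
  have g: "2 * \<gamma> * \<delta> = 1 - damp \<delta> * damp \<delta>" using damp_bounds(5)[OF assms] by (simp add: power2_eq_square)
  have "(norm v)\<^sup>2 - (norm (fst v, damp \<delta> *\<^sub>R snd v))\<^sup>2
      = (fst v \<bullet> fst v + snd v \<bullet> snd v) - (fst v \<bullet> fst v + damp \<delta> * damp \<delta> * (snd v \<bullet> snd v))"
    by (simp only: N fst_conv snd_conv inner_scaleR_left inner_scaleR_right mult.assoc)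
  then show ?thesis by (simp only: g) (simp only: algebra_simps)
qed

text \<open>The vector moves by the noise-free step because the inverse rotation is the transpose.
  The constant gains the variance of the injected noise, which is exactly the squared norm lost by
  \<open>v\<close>, so the Gaussian mean \<open>(norm v)\<^sup>2 + k\<close> is conserved.\<close>

lemma bwd_sq:
  assumes d: "\<delta> \<ge> 0" "2 * \<gamma> * \<delta> \<le> 1" and k: "k \<ge> 0"
  shows "bwd \<delta> (sq v k) = sq (step \<delta> v 0) (k + (norm v)\<^sup>2 - (norm (step \<delta> v 0))\<^sup>2)"
proof
  fix x
  define y where "y = inv (rot \<delta>) x"
  have xy: "x = rot \<delta> y" by (simp add: y_def)
  define v' where "v' = (fst v, damp \<delta> *\<^sub>R snd v)"
  have sv: "step \<delta> v 0 = rot \<delta> v'" by (simp add: step_def v'_def)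
  define s where "s = sqrt (2 * \<gamma> * \<delta>)"
  have s2: "s * s = 2 * \<gamma> * \<delta>" using d gamma_pos by (simp add: s_def)
  have "bwd \<delta> (sq v k) x = (\<integral>\<^sup>+\<xi>. ennreal ((v' \<bullet> y + (s *\<^sub>R snd v) \<bullet> \<xi>)\<^sup>2 + k) \<partial>std_gaussian)"
    unfolding bwd_def sq_def by (simp add: inner_prod_def[of v] damp_inner v'_def flip: y_def s_def)
  also have "\<dots> = ennreal ((v' \<bullet> y)\<^sup>2 + (s *\<^sub>R snd v) \<bullet> (s *\<^sub>R snd v) + k)"
    by (rule integral_gaussian_affine_square[OF k])
  also have "(s *\<^sub>R snd v) \<bullet> (s *\<^sub>R snd v) = (norm v)\<^sup>2 - (norm v')\<^sup>2"
    using norm_damp_eq[OF d, of v] by (simp add: v'_def flip: s2 mult.assoc)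
  also have "v' \<bullet> y = step \<delta> v 0 \<bullet> x" by (simp add: sv xy rot_inner)
  finally have "bwd \<delta> (sq v k) x = ennreal ((step \<delta> v 0 \<bullet> x)\<^sup>2 + ((norm v)\<^sup>2 - (norm v')\<^sup>2) + k)" .
  then show "bwd \<delta> (sq v k) x = sq (step \<delta> v 0) (k + (norm v)\<^sup>2 - (norm (step \<delta> v 0))\<^sup>2) x"
    by (simp only:) (simp add: sq_def sv norm_rot algebra_simps)
qed

text \<open>The same conservation of the Gaussian mean as for \<open>bwd\<close>, with the
  transposed noise-free step acting on the vector.\<close>

lemma fwd_sq:
  assumes d: "\<delta> \<ge> 0" "2 * \<gamma> * \<delta> \<le> 1" and k: "k \<ge> 0"
  defines "N \<equiv> adjoint (\<lambda>z. step \<delta> z 0)"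
  shows "fwd \<delta> (sq v k) = sq (N v) (k + (norm v)\<^sup>2 - (norm (N v))\<^sup>2)"
proof
  fix x
  define y where "y = inv (rot \<delta>) v"
  have vy: "v = rot \<delta> y" by (simp add: y_def)
  define v' where "v' = (fst y, damp \<delta> *\<^sub>R snd y)"
  have Nv: "N v = v'"
  proof (rule vector_eq_ldot[THEN iffD1], rule allI)
    fix z
    have "z \<bullet> N v = step \<delta> z 0 \<bullet> v" unfolding N_def by (rule adjoint_works[OF linear_step0])
    also have "\<dots> = z \<bullet> v'" unfolding step_def vy rot_inner by (simp add: v'_def inner_prod_def)
    finally show "z \<bullet> N v = z \<bullet> v'" .
  qed
  define s where "s = sqrt (2 * \<gamma> * \<delta>)"
  have s2: "s * s = 2 * \<gamma> * \<delta>" using d gamma_pos by (simp add: s_def)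
  have ss: "sqrt (2 * \<gamma>) * sqrt \<delta> = s" by (simp add: s_def real_sqrt_mult)
  have "fwd \<delta> (sq v k) x = (\<integral>\<^sup>+\<xi>. ennreal ((v' \<bullet> x + (s *\<^sub>R snd y) \<bullet> \<xi>)\<^sup>2 + k) \<partial>std_gaussian)"
    unfolding fwd_def sq_def step_def vy rot_inner
    by (simp add: inner_prod_def[of y] damp_inner v'_def ss)
  also have "\<dots> = ennreal ((v' \<bullet> x)\<^sup>2 + (s *\<^sub>R snd y) \<bullet> (s *\<^sub>R snd y) + k)"
    by (rule integral_gaussian_affine_square[OF k])
  also have "(s *\<^sub>R snd y) \<bullet> (s *\<^sub>R snd y) = (norm y)\<^sup>2 - (norm v')\<^sup>2"
    using norm_damp_eq[OF d, of y] by (simp add: v'_def flip: s2 mult.assoc)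
  also have "norm y = norm v" by (simp add: vy norm_rot)
  finally have "fwd \<delta> (sq v k) x = ennreal ((v' \<bullet> x)\<^sup>2 + ((norm v)\<^sup>2 - (norm v')\<^sup>2) + k)" .
  then show "fwd \<delta> (sq v k) x = sq (N v) (k + (norm v)\<^sup>2 - (norm (N v))\<^sup>2) x"
    by (simp only:) (simp add: sq_def Nv algebra_simps)
qed

lemma norm_step0_le:
  assumes "\<delta> \<ge> 0" "2 * \<gamma> * \<delta> \<le> 1"
  shows "norm (step \<delta> v 0) \<le> norm v"
  using norm_damp_le[OF assms, of v] by (simp add: step_def norm_rot)

lemma norm_chain_mean_le:
  assumes "\<delta> \<ge> 0" "2 * \<gamma> * \<delta> \<le> 1"
  shows "norm (chain \<delta> (\<lambda>_. 0) v n) \<le> norm v"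
  by (induction n) (auto intro: order_trans[OF norm_step0_le[OF assms]])

lemma bwd_funpow_sq:
  fixes v :: "'a \<times> 'a"
  assumes d: "\<delta> \<ge> 0" "2 * \<gamma> * \<delta> \<le> 1" and k: "k \<ge> 0"
  defines "N \<equiv> \<lambda>n. chain \<delta> (\<lambda>_. 0) v n"
  shows "(bwd \<delta> ^^ n) (sq v k) = sq (N n) (k + (norm v)\<^sup>2 - (norm (N n))\<^sup>2)"
proof (induction n)
  case (Suc n)
  have "k + (norm v)\<^sup>2 - (norm (N n))\<^sup>2 \<ge> 0"
    using norm_chain_mean_le[OF d, of v n] k unfolding N_def
    by (simp add: add_increasing power_mono)
  then show ?case using Suc.IH by (simp add: bwd_sq[OF d] N_def)
qed (simp add: N_def)

lemma adjoint_chain_mean: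
  "((adjoint (\<lambda>z. step \<delta> z 0)) ^^ n) v \<bullet> x = v \<bullet> chain \<delta> (\<lambda>_. 0) x n"
proof (induction n arbitrary: v)
  case (Suc n)
  let ?A = "adjoint (\<lambda>z. step \<delta> z 0)"
  have "(?A ^^ Suc n) v \<bullet> x = (?A ^^ n) (?A v) \<bullet> x" by (simp only: funpow_Suc_right o_apply)
  also have "\<dots> = ?A v \<bullet> chain \<delta> (\<lambda>_. 0) x n" by (rule Suc)
  also have "\<dots> = v \<bullet> chain \<delta> (\<lambda>_. 0) x (Suc n)"
    using adjoint_works[OF linear_step0, of "chain \<delta> (\<lambda>_. 0) x n" \<delta> v] by (simp add: inner_commute)
  finally show ?case .
qed simp

lemma norm_adjoint_chain_le:
  assumes d: "\<delta> \<ge> 0" "2 * \<gamma> * \<delta> \<le> 1"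
  shows "norm (((adjoint (\<lambda>z. step \<delta> z 0)) ^^ n) v) \<le> norm v"
proof -
  define w where "w = ((adjoint (\<lambda>z. step \<delta> z 0)) ^^ n) v"
  have "norm w * norm w = v \<bullet> chain \<delta> (\<lambda>_. 0) w n"
    unfolding w_def adjoint_chain_mean[symmetric] by (simp add: norm_eq_sqrt_inner)
  also have "\<dots> \<le> norm v * norm w"
    using norm_chain_mean_le[OF d, of w n] by (meson norm_cauchy_schwarz mult_left_mono norm_ge_zero order_trans)
  finally show ?thesis unfolding w_def[symmetric] by (cases "norm w = 0") auto
qed

lemma fwd_funpow_sq:
  fixes v :: "'a \<times> 'a"
  assumes d: "\<delta> \<ge> 0" "2 * \<gamma> * \<delta> \<le> 1" and k: "k \<ge> 0"
  defines "N \<equiv> \<lambda>n. ((adjoint (\<lambda>z. step \<delta> z 0)) ^^ n) v"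
  shows "(fwd \<delta> ^^ n) (sq v k) = sq (N n) (k + (norm v)\<^sup>2 - (norm (N n))\<^sup>2)"
proof (induction n)
  case (Suc n)
  have "k + (norm v)\<^sup>2 - (norm (N n))\<^sup>2 \<ge> 0"
    using norm_adjoint_chain_le[OF d, of n v] k unfolding N_def
    by (simp add: add_increasing power_mono)
  then show ?case using Suc.IH by (simp add: fwd_sq[OF d] N_def)
qed (simp add: N_def)

lemma adjoint_mean_flow_tendsto:
  assumes t: "t > 0"
  shows "(\<lambda>n. ((adjoint (\<lambda>z. step (t / real n) z 0)) ^^ n) v) \<longlonglongrightarrow> adjoint (mean_flow t) v"
proof (rule tendsto_componentwise_iff[THEN iffD2], rule ballI)
  fix b :: "'a \<times> 'a" assume "b \<in> Basis"
  have "(\<lambda>n. v \<bullet> chain (t / n) (\<lambda>_. 0) b n) \<longlonglongrightarrow> v \<bullet> mean_flow t b"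
    by (intro tendsto_intros chain_mean_tendsto t)
  then show "(\<lambda>n. ((adjoint (\<lambda>z. step (t / real n) z 0)) ^^ n) v \<bullet> b) \<longlonglongrightarrow> adjoint (mean_flow t) v \<bullet> b"
    using adjoint_works[OF linear_mean_flow[OF t], of b v]
    by (simp only: adjoint_chain_mean inner_commute[of b] inner_commute[of _ v])
qed

lemma chain_measurable:
  assumes x [measurable]: "x \<in> borel_measurable N" and "\<And>k. k < n \<Longrightarrow> \<eta> k \<in> borel_measurable N"
  shows "(\<lambda>\<omega>. chain \<delta> (\<lambda>k. \<eta> k \<omega>) (x \<omega>) n) \<in> borel_measurable N"
  using assms(2)
proof (induction n)
  case (Suc n)
  from Suc.prems[of n] have [measurable]: "\<eta> n \<in> borel_measurable N" by simp
  from Suc have [measurable]: "(\<lambda>\<omega>. chain \<delta> (\<lambda>k. \<eta> k \<omega>) (x \<omega>) n) \<in> borel_measurable N" by simp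
  show ?case by simp
qed simp

lemma chain_cong: "(\<And>k. k < n \<Longrightarrow> f k = g k) \<Longrightarrow> chain \<delta> f x n = chain \<delta> g x n"
  by (induction n) auto

text \<open>The Markov property of the chain: the last increment is independent of the state before
  it, so integrating it out replaces \<open>u\<close> by \<open>fwd \<delta> u\<close>.\<close>

lemma nn_integral_chain:
  assumes M: "prob_space M" and ind: "prob_space.indep_vars M (\<lambda>_. borel) \<eta> {..<n}" and d: "\<delta> > 0"
    and law: "\<And>k. k < n \<Longrightarrow> distributed M lborel (\<eta> k) (\<lambda>x. ennreal (\<Prod>b\<in>Basis. normal_density 0 (sqrt \<delta>) (x \<bullet> b)))"
    and u: "u \<in> borel_measurable borel"
  shows "(\<integral>\<^sup>+\<omega>. u (chain \<delta> (\<lambda>k. \<eta> k \<omega>) x n) \<partial>M) = (fwd \<delta> ^^ n) u x"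
  using ind law u
proof (induction n arbitrary: u)
  case 0
  interpret prob_space M by (rule M)
  show ?case by (simp add: emeasure_space_1)
next
  case (Suc n)
  interpret prob_space M by (rule M)
  note [measurable] = Suc.prems(3)
  define X where "X = (\<lambda>\<omega>. chain \<delta> (\<lambda>k. \<eta> k \<omega>) x n)"
  have rv [measurable]: "\<eta> k \<in> borel_measurable M" if "k < Suc n" for k
    using Suc.prems(1) that unfolding indep_vars_def by auto
  have Xm [measurable]: "X \<in> borel_measurable M"
    unfolding X_def by (rule chain_measurable) (use rv in auto)
  \<comment> \<open>\<open>indep_var\<close> wants both variables in one type, so the increment is
    padded with a zero.\<close>
  define Y :: "'b \<Rightarrow> 'a \<times> 'a" where "Y = (\<lambda>\<omega>. (0, \<eta> n \<omega>))"
  define F where "F = (\<lambda>f. chain \<delta> f x n)"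
  have Fm: "F \<in> borel_measurable (PiM {..<n} (\<lambda>_. borel))"
    unfolding F_def by (rule chain_measurable[where \<eta> = "\<lambda>k f. f k"]) measurable
  have "indep_var borel (F \<circ> (\<lambda>\<omega>. restrict (\<lambda>i. \<eta> i \<omega>) {..<n}))
      borel ((\<lambda>f. (0, f n)) \<circ> (\<lambda>\<omega>. restrict (\<lambda>i. \<eta> i \<omega>) {n}))"
    by (rule indep_var_compose[OF indep_var_restrict[OF Suc.prems(1)] Fm])
      (auto intro!: borel_measurable_Pair)
  moreover have "F \<circ> (\<lambda>\<omega>. restrict (\<lambda>i. \<eta> i \<omega>) {..<n}) = X"
    by (auto simp: F_def X_def fun_eq_iff intro!: chain_cong)
  moreover have "(\<lambda>f. (0, f n)) \<circ> (\<lambda>\<omega>. restrict (\<lambda>i. \<eta> i \<omega>) {n}) = Y" by (auto simp: Y_def)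
  ultimately have iv: "indep_var borel X borel Y" by simp
  have [measurable]: "\<eta> n \<in> borel_measurable M" by (rule rv) simp
  have Ym [measurable]: "Y \<in> borel_measurable M" unfolding Y_def by (intro borel_measurable_Pair) auto
  interpret D: prob_space "distr M borel Y" by (rule prob_space_distr) simp
  have "(\<integral>\<^sup>+\<omega>. u (chain \<delta> (\<lambda>k. \<eta> k \<omega>) x (Suc n)) \<partial>M) = (\<integral>\<^sup>+\<omega>. u (step \<delta> (X \<omega>) (snd (Y \<omega>))) \<partial>M)"
    by (simp add: X_def Y_def)
  also have "\<dots> = (\<integral>\<^sup>+z. u (step \<delta> (fst z) (snd (snd z))) \<partial>distr M (borel \<Otimes>\<^sub>M borel) (\<lambda>\<omega>. (X \<omega>, Y \<omega>)))"
    by (simp add: nn_integral_distr)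
  also have "\<dots> = (\<integral>\<^sup>+z. u (step \<delta> (fst z) (snd (snd z))) \<partial>(distr M borel X \<Otimes>\<^sub>M distr M borel Y))"
    using iv by (simp add: indep_var_distribution_eq)
  also have "\<dots> = (\<integral>\<^sup>+a. \<integral>\<^sup>+b. u (step \<delta> a (snd b)) \<partial>distr M borel Y \<partial>distr M borel X)"
    by (subst D.nn_integral_fst[symmetric]) simp_all
  also have "\<dots> = (\<integral>\<^sup>+\<omega>. \<integral>\<^sup>+\<omega>'. u (step \<delta> (X \<omega>) (\<eta> n \<omega>')) \<partial>M \<partial>M)"
    by (simp add: nn_integral_distr Y_def[abs_def])
  also have "\<dots> = (\<integral>\<^sup>+\<omega>. fwd \<delta> u (X \<omega>) \<partial>M)"
  proof (intro nn_integral_cong)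
    fix \<omega>
    show "(\<integral>\<^sup>+\<omega>'. u (step \<delta> (X \<omega>) (\<eta> n \<omega>')) \<partial>M) = fwd \<delta> u (X \<omega>)"
      unfolding fwd_def
      by (rule distributed_normal_scale[OF Suc.prems(2), where f = "\<lambda>b. u (step \<delta> (X \<omega>) b)"]) (use d in auto)
  qed
  also have "\<dots> = (fwd \<delta> ^^ n) (fwd \<delta> u) x"
    unfolding X_def
  proof (rule Suc.IH)
    show "indep_vars (\<lambda>_. borel) \<eta> {..<n}"
      by (rule indep_vars_subset[OF Suc.prems(1)]) auto
  qed (use Suc.prems in auto)
  finally show ?case by (simp add: funpow_swap1)
qed

end

section \<open>Quadratic Hermite functions\<close>

lemma integrable_std_gaussian_norm:
  shows "integrable std_gaussian (\<lambda>x :: 'a::euclidean_space. (norm x)\<^sup>2)"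
    and "integrable std_gaussian (\<lambda>x :: 'a. ((norm x)\<^sup>2 + 1)\<^sup>2)"
proof -
  have eq: "(norm x)\<^sup>2 = (\<Sum>b\<in>Basis. (b \<bullet> x) * (b \<bullet> x))" for x :: 'a
    by (simp add: power2_norm_eq_inner euclidean_inner[of x x] inner_commute)
  show 1: "integrable std_gaussian (\<lambda>x :: 'a. (norm x)\<^sup>2)"
    unfolding eq by (intro Bochner_Integration.integrable_sum) (use wick2 in blast)
  have eq2: "((norm x)\<^sup>2 + 1)\<^sup>2
      = (\<Sum>b\<in>Basis. \<Sum>c\<in>Basis. (b \<bullet> x) * ((b \<bullet> x) * ((c \<bullet> x) * (c \<bullet> x)))) + (2 * (norm x)\<^sup>2 + 1)" for x :: 'a
  proof -
    have "(norm x)\<^sup>2 * (norm x)\<^sup>2 = (\<Sum>b\<in>Basis. \<Sum>c\<in>Basis. (b \<bullet> x) * ((b \<bullet> x) * ((c \<bullet> x) * (c \<bullet> x))))"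
      unfolding eq sum_product by (simp only: mult.assoc)
    then show ?thesis by (simp add: power2_eq_square algebra_simps)
  qed
  show "integrable std_gaussian (\<lambda>x :: 'a. ((norm x)\<^sup>2 + 1)\<^sup>2)"
    unfolding eq2
  proof (intro Bochner_Integration.integrable_add Bochner_Integration.integrable_sum)
    show "integrable std_gaussian (\<lambda>x :: 'a. (b \<bullet> x) * ((b \<bullet> x) * ((c \<bullet> x) * (c \<bullet> x))))" for b c
      using wick by blast
  qed (use 1 in auto)
qed

text \<open>The second Wick polynomial: the product of two linear forms minus its Gaussian mean.
  With this centering the semigroup acts on the two vectors alone and leaves no constant
  behind.\<close>

definition herm :: "'a::euclidean_space \<Rightarrow> 'a \<Rightarrow> 'a \<Rightarrow> real" where
  "herm v w x = (v \<bullet> x) * (w \<bullet> x) - v \<bullet> w"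

lemma herm_bound: "\<bar>herm a b x\<bar> \<le> norm a * norm b * ((norm x)\<^sup>2 + 1)"
proof -
  have "\<bar>(a \<bullet> x) * (b \<bullet> x)\<bar> \<le> (norm a * norm x) * (norm b * norm x)"
    unfolding abs_mult by (intro mult_mono Cauchy_Schwarz_ineq2) auto
  then have "\<bar>herm a b x\<bar> \<le> (norm a * norm x) * (norm b * norm x) + norm a * norm b"
    using Cauchy_Schwarz_ineq2[of a b] unfolding herm_def by linarith
  then show ?thesis
    by (simp add: power2_eq_square algebra_simps)
qed

lemma herm_polarization: "herm v w x = (1 / 4) * ((v + w) \<bullet> x)\<^sup>2 - (1 / 4) * ((v - w) \<bullet> x)\<^sup>2 - v \<bullet> w"
  by (simp add: herm_def inner_add_left inner_diff_left power2_eq_square field_simps)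

lemma norm_polarization: "(norm (v + w))\<^sup>2 - (norm (v - w))\<^sup>2 = 4 * (v \<bullet> w)" for v w :: "'a::real_inner"
  by (simp add: power2_norm_eq_inner inner_add_left inner_diff_left inner_add_right inner_diff_right inner_commute)

lemma bilinear_herm: "bounded_bilinear (\<lambda>v w. herm v w x)"
proof (rule bounded_bilinear.intro)
  show "\<exists>K. \<forall>a b. norm (herm a b x) \<le> norm a * norm b * K"
    using herm_bound[of _ _ x] by auto
qed (simp_all add: herm_def inner_add_left algebra_simps)

lemma herm_measurable [measurable]: "herm v w \<in> borel_measurable borel"
  unfolding herm_def by measurable

lemma square_integrable_bound:
  fixes g :: "'a::euclidean_space \<Rightarrow> real"
  assumes g: "g \<in> borel_measurable borel" and b: "\<And>x. \<bar>g x\<bar> \<le> c * ((norm x)\<^sup>2 + 1)"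
  shows "square_integrable std_gaussian g"
  unfolding square_integrable_def
proof
  show "integrable std_gaussian (\<lambda>x. (g x)\<^sup>2)"
  proof (rule Bochner_Integration.integrable_bound)
    show "integrable std_gaussian (\<lambda>x :: 'a. c\<^sup>2 * ((norm x)\<^sup>2 + 1)\<^sup>2)"
      using integrable_std_gaussian_norm(2) by auto
    show "(\<lambda>x. (g x)\<^sup>2) \<in> borel_measurable std_gaussian"
      using g by auto
    have "(g x)\<^sup>2 \<le> (c * ((norm x)\<^sup>2 + 1))\<^sup>2" for x
      by (rule power2_le_iff_abs_le[THEN iffD2, OF order_trans[OF abs_ge_zero b] b])
    then show "AE x in std_gaussian. norm ((g x)\<^sup>2) \<le> norm (c\<^sup>2 * ((norm x)\<^sup>2 + 1)\<^sup>2)"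
      by (simp add: power_mult_distrib)
  qed
qed (use g in simp)

lemma integrable_std_gaussian_quadratic:
  fixes u g :: "'a::euclidean_space \<Rightarrow> real"
  assumes u: "square_integrable std_gaussian u" and g: "g \<in> borel_measurable borel"
    and b: "\<And>x. \<bar>g x\<bar> \<le> c * ((norm x)\<^sup>2 + 1)"
  shows "integrable std_gaussian (\<lambda>x. u x * g x)"
proof (rule Bochner_Integration.integrable_bound)
  have g2: "square_integrable std_gaussian g" by (rule square_integrable_bound[OF g b])
  show "integrable std_gaussian (\<lambda>x. (u x)\<^sup>2 + (g x)\<^sup>2)"
    using u g2 by (auto simp: square_integrable_def)
  show "(\<lambda>x. u x * g x) \<in> borel_measurable std_gaussian"
    using u g by (auto simp: square_integrable_def)
  have "\<bar>u x * g x\<bar> \<le> (u x)\<^sup>2 + (g x)\<^sup>2" for x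
  proof -
    have "0 \<le> (\<bar>u x\<bar> - \<bar>g x\<bar>)\<^sup>2" by simp
    then have "2 * \<bar>u x * g x\<bar> \<le> (u x)\<^sup>2 + (g x)\<^sup>2" by (simp add: power2_diff abs_mult)
    then show ?thesis by linarith
  qed
  then show "AE x in std_gaussian. norm (u x * g x) \<le> norm ((u x)\<^sup>2 + (g x)\<^sup>2)" by simp
qed

lemma integrable_herm: "integrable std_gaussian (herm v w)"
  and integral_herm: "(\<integral>x. herm v w x \<partial>std_gaussian) = 0" for v w :: "'a::euclidean_space"
  using wick2[of v w] unfolding herm_def
  by auto

lemma square_integrable_herm_sum:
  fixes v w :: "'i \<Rightarrow> 'a::euclidean_space"
  shows "square_integrable std_gaussian (\<lambda>x. \<Sum>i\<in>I. herm (v i) (w i) x)"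
proof (rule square_integrable_bound)
  fix x :: 'a
  have "\<bar>\<Sum>i\<in>I. herm (v i) (w i) x\<bar> \<le> (\<Sum>i\<in>I. norm (v i) * norm (w i) * ((norm x)\<^sup>2 + 1))"
    by (intro order_trans[OF sum_abs] sum_mono herm_bound)
  then show "\<bar>\<Sum>i\<in>I. herm (v i) (w i) x\<bar> \<le> (\<Sum>i\<in>I. norm (v i) * norm (w i)) * ((norm x)\<^sup>2 + 1)"
    by (simp add: sum_distrib_right)
qed measurable

lemma integrable_mult_herm:
  fixes v w :: "'a::euclidean_space"
  shows "square_integrable std_gaussian u \<Longrightarrow> integrable std_gaussian (\<lambda>x. u x * herm v w x)"
  by (rule integrable_std_gaussian_quadratic[OF _ _ herm_bound]) measurable

text \<open>Centering removes from Wick's formula the pairing inside each factor; the two cross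
  pairings remain.\<close>

lemma integral_herm_herm:
  fixes a b c d :: "'a::euclidean_space"
  shows "(\<integral>x. herm a b x * herm c d x \<partial>std_gaussian) = (a \<bullet> c) * (b \<bullet> d) + (a \<bullet> d) * (b \<bullet> c)"
proof -
  have e: "herm a b x * herm c d x = (a \<bullet> x) * ((b \<bullet> x) * ((c \<bullet> x) * (d \<bullet> x)))
      - (c \<bullet> d) * ((a \<bullet> x) * (b \<bullet> x)) - (a \<bullet> b) * ((c \<bullet> x) * (d \<bullet> x)) + (a \<bullet> b) * (c \<bullet> d)" for x
    by (simp add: herm_def algebra_simps)
  show ?thesis
    unfolding e using wick[of a b c d] wick2[of a b] wick2[of c d]
    by simp
qed

text \<open>For linear maps \<open>m t = 1 + t A + o(t)\<close>, bounds the error of the difference quotient of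
  \<open>herm (m t v) (m t w)\<close> at \<open>0\<close>.\<close>

definition herm_err ::
  "(real \<Rightarrow> 'a::euclidean_space \<Rightarrow> 'a) \<Rightarrow> ('a \<Rightarrow> 'a) \<Rightarrow> 'a \<Rightarrow> 'a \<Rightarrow> real \<Rightarrow> real" where
  "herm_err m A v w t = norm ((m t v - v) /\<^sub>R t - A v) * norm (m t w) + norm (A v) * norm (m t w - w)
     + norm v * norm ((m t w - w) /\<^sub>R t - A w)"

lemma herm_err_bound:
  assumes "t > 0"
  shows "\<bar>(herm (m t v) (m t w) x - herm v w x) / t - (herm (A v) w x + herm v (A w) x)\<bar>
    \<le> herm_err m A v w t * ((norm x)\<^sup>2 + 1)"
proof -
  interpret H: bounded_bilinear "\<lambda>v w. herm v w x" by (rule bilinear_herm)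
  \<comment> \<open>A product rule: each of the three terms contains one difference that tends to
    zero, while its other factor stays bounded.\<close>
  have "(herm (m t v) (m t w) x - herm v w x) / t - (herm (A v) w x + herm v (A w) x)
      = herm ((m t v - v) /\<^sub>R t - A v) (m t w) x + herm (A v) (m t w - w) x + herm v ((m t w - w) /\<^sub>R t - A w) x"
    using assms by (simp add: H.diff_left H.diff_right H.add_left H.add_right H.scaleR_left H.scaleR_right divide_inverse algebra_simps)
  also have "\<bar>\<dots>\<bar> \<le> \<bar>herm ((m t v - v) /\<^sub>R t - A v) (m t w) x\<bar> + \<bar>herm (A v) (m t w - w) x\<bar>
      + \<bar>herm v ((m t w - w) /\<^sub>R t - A w) x\<bar>"
    by linarith
  also have "\<dots> \<le> herm_err m A v w t * ((norm x)\<^sup>2 + 1)"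
    unfolding herm_err_def distrib_right by (intro add_mono herm_bound)
  finally show ?thesis .
qed

lemma herm_err_tendsto:
  assumes m: "\<And>v. ((\<lambda>t. (m t v - v) /\<^sub>R t) \<longlongrightarrow> A v) (at_right 0)"
  shows "((\<lambda>t. herm_err m A v w t) \<longlongrightarrow> 0) (at_right 0)"
proof -
  have e: "((\<lambda>t. (m t v - v) /\<^sub>R t - A v) \<longlongrightarrow> 0) (at_right 0)" for v
    using m[of v] by (simp add: LIM_zero)
  have "((\<lambda>t. t *\<^sub>R ((m t v - v) /\<^sub>R t)) \<longlongrightarrow> 0 *\<^sub>R A v) (at_right 0)" for v
    by (intro tendsto_intros m)
  moreover have "eventually (\<lambda>t. t *\<^sub>R ((m t v - v) /\<^sub>R t) = m t v - v) (at_right 0)" for v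
    unfolding eventually_at_right_field by (intro exI[of _ 1]) auto
  ultimately have "((\<lambda>t. m t v - v) \<longlongrightarrow> 0 *\<^sub>R A v) (at_right 0)" for v
    by (rule Lim_transform_eventually)
  then have d: "((\<lambda>t. m t v - v) \<longlongrightarrow> 0) (at_right 0)" for v by simp
  then have c: "((\<lambda>t. m t v) \<longlongrightarrow> v) (at_right 0)" for v
    by (simp add: LIM_zero_iff)
  have "((\<lambda>t. herm_err m A v w t) \<longlongrightarrow> norm (0 :: 'a) * norm w + norm (A v) * norm (0 :: 'a) + norm v * norm (0 :: 'a)) (at_right 0)"
    unfolding herm_err_def by (intro tendsto_intros e d c)
  then show ?thesis by simp
qed

section \<open>Passage to the limit\<close>

text \<open>Pathwise convergence only passes through bounded continuous functions; this turns such
  an identity into one of measures. Indicators of open sets are limits of truncated multiples of the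
  distance to the complement.\<close>

lemma measure_eqI_continuous:
  fixes M N :: "'a::metric_space measure"
  assumes sets: "sets M = sets borel" "sets N = sets borel" and fin: "finite_measure M" "finite_measure N"
    and eq: "\<And>f :: 'a \<Rightarrow> real. continuous_on UNIV f \<Longrightarrow> (\<And>x. 0 \<le> f x \<and> f x \<le> 1) \<Longrightarrow>
      (\<integral>\<^sup>+x. ennreal (f x) \<partial>M) = (\<integral>\<^sup>+x. ennreal (f x) \<partial>N)"
  shows "M = N"
proof -
  have op: "emeasure M U = emeasure N U" if U: "open U" for U
  \<comment> \<open>The whole space is treated apart because \<open>infdist\<close> to the empty set
    is 0 by convention.\<close>
  proof (cases "U = UNIV")
    case True
    then show ?thesis
      using eq[of "\<lambda>_. 1"] sets_eq_imp_space_eq[OF sets(1)] sets_eq_imp_space_eq[OF sets(2)] by simp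
  next
    case False
    define f where "f = (\<lambda>n x. min 1 (real n * infdist x (- U)))"
    have lim: "(\<lambda>n. \<integral>\<^sup>+x. ennreal (f n x) \<partial>L) \<longlonglongrightarrow> emeasure L U"
      if L: "sets L = sets borel" "finite_measure L" for L
    proof -
      interpret finite_measure L by fact
      have fm: "f n \<in> borel_measurable borel" for n
        unfolding f_def by (intro borel_measurable_continuous_onI continuous_intros)
      have "(\<lambda>n. \<integral>\<^sup>+x. ennreal (f n x) \<partial>L) \<longlonglongrightarrow> (\<integral>\<^sup>+x. indicator U x \<partial>L)"
      proof (rule nn_integral_dominated_convergence[where w = "\<lambda>_. 1"])
        show "(\<lambda>x. ennreal (f n x)) \<in> borel_measurable L" for n
          unfolding measurable_cong_sets[OF L(1) refl] using fm[of n] by measurable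
        show "indicator U \<in> borel_measurable L"
          using U L by (intro borel_measurable_indicator) simp
        show "(\<integral>\<^sup>+x. 1 \<partial>L) < \<infinity>" by (simp add: less_top[symmetric])
        show "AE x in L. ennreal (f n x) \<le> 1" for n
          by (auto simp: f_def)
        show "AE x in L. (\<lambda>n. ennreal (f n x)) \<longlonglongrightarrow> indicator U x"
        proof (rule AE_I2)
          fix x
          show "(\<lambda>n. ennreal (f n x)) \<longlonglongrightarrow> indicator U x"
          proof (cases "x \<in> U")
            case True
            have "infdist x (- U) > 0"
              using True U False by (intro infdist_pos_not_in_closed) (auto simp: closed_def)
            then have "eventually (\<lambda>n. 1 \<le> real n * infdist x (- U)) sequentially"
              by real_asymp
            then have "eventually (\<lambda>n. 1 = ennreal (f n x)) sequentially"
              by eventually_elim (simp add: f_def)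
            then have "(\<lambda>n. ennreal (f n x)) \<longlonglongrightarrow> 1"
              by (rule Lim_transform_eventually[rotated]) simp
            then show ?thesis using True by simp
          qed (simp add: f_def)
        qed
      qed simp
      then show ?thesis using U L by simp
    qed
    have "(\<integral>\<^sup>+x. ennreal (f n x) \<partial>M) = (\<integral>\<^sup>+x. ennreal (f n x) \<partial>N)" for n
      unfolding f_def by (rule eq) (auto intro!: continuous_intros simp: infdist_nonneg)
    then show ?thesis
      using lim[OF sets(1) fin(1)] lim[OF sets(2) fin(2)] by (simp add: LIMSEQ_unique)
  qed
  show ?thesis
  proof (rule measure_eqI_generator_eq[where E = "{U. open U}" and \<Omega> = UNIV and A = "\<lambda>_. UNIV"])
    show "Int_stable {U :: 'a set. open U}" by (auto simp: Int_stable_def)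
    show "sets M = sigma_sets UNIV {U. open U}" "sets N = sigma_sets UNIV {U. open U}"
      using sets by (simp_all add: borel_def)
    show "emeasure M UNIV \<noteq> \<infinity>" for i :: nat
      using finite_measure.emeasure_finite[OF fin(1)] by simp
  qed (auto simp: op)
qed

context skew_langevin
begin

definition flow :: "(real \<Rightarrow> 'a) \<Rightarrow> 'a \<times> 'a \<Rightarrow> real \<Rightarrow> 'a \<times> 'a" where
  "flow w x = (SOME z. solution w x z)"

lemma flow_solution: "continuous_on {0..} w \<Longrightarrow> solution w x (flow w x)"
  unfolding flow_def by (rule someI_ex[OF solution_exists])

text \<open>Shifting the index makes every step size admissible, so the limit theorems below apply
  to whole sequences. \<open>n0 > 0\<close> also avoids division by zero.\<close>

lemma admissible_step_sizes:
  assumes t: "t > 0"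
  obtains n0 :: nat where "\<And>n. 2 * \<gamma> * (t / real (n + n0)) \<le> 1" "n0 > 0"
proof -
  obtain n0 :: nat where n0: "2 * \<gamma> * t < real n0"
    using reals_Archimedean2 by blast
  moreover have "0 < 2 * \<gamma> * t" using t gamma_pos by simp
  ultimately have "n0 > 0" by (auto intro: Nat.gr0I)
  then show ?thesis
    using n0 by (intro that[of n0]) (auto simp: field_simps)
qed

lemma nn_integral_sq: "k \<ge> 0 \<Longrightarrow> (\<integral>\<^sup>+x. sq v k x \<partial>std_gaussian) = ennreal ((norm v)\<^sup>2 + k)"
  using integral_gaussian_affine_square[of k 0 v] by (simp add: sq_def power2_norm_eq_inner)

lemma norm_mean_flow_le: "t > 0 \<Longrightarrow> norm (mean_flow t v) \<le> norm v"
proof (rule tendsto_upperbound[OF tendsto_norm[OF chain_mean_tendsto]])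
  assume t: "t > 0"
  have "eventually (\<lambda>n. t / real n < 1 / (2 * \<gamma>)) sequentially"
    using gamma_pos by (intro order_tendstoD) (real_asymp, auto)
  then show "eventually (\<lambda>n. norm (chain (t / real n) (\<lambda>_. 0) v n) \<le> norm v) sequentially"
  proof eventually_elim
    case (elim n)
    then show ?case using t gamma_pos by (intro norm_chain_mean_le) (auto simp: field_simps)
  qed
qed auto

end

section \<open>Duality for the stochastic flow with Gaussian initial state\<close>

locale langevin_process = skew_langevin S \<gamma>
  for S :: "'a::euclidean_space \<times> 'a \<Rightarrow> 'a \<times> 'a" and \<gamma> :: real +
  fixes M :: "'w measure" and W :: "real \<Rightarrow> 'w \<Rightarrow> 'a"
  assumes bm: "brownian_motion M W"
begin

sublocale prob_space M
  using bm by (simp add: brownian_motion_def)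

abbreviation joint :: "(('a \<times> 'a) \<times> 'w) measure" where
  "joint \<equiv> std_gaussian \<Otimes>\<^sub>M M"

definition Y :: "real \<Rightarrow> 'a \<times> 'a \<Rightarrow> 'w \<Rightarrow> 'a \<times> 'a" where
  "Y t x \<omega> = flow (\<lambda>s. W s \<omega>) x t"

definition X :: "real \<Rightarrow> nat \<Rightarrow> 'a \<times> 'a \<Rightarrow> 'w \<Rightarrow> 'a \<times> 'a" where
  "X t n x \<omega> = chain (t / n) (\<lambda>k. W (real (Suc k) * (t / n)) \<omega> - W (real k * (t / n)) \<omega>)
     (x + (0, sqrt (2 * \<gamma>) *\<^sub>R W 0 \<omega>)) n"

lemma W_measurable: "s \<ge> 0 \<Longrightarrow> W s \<in> borel_measurable M"
  using bm by (simp add: brownian_motion_def)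

lemma X_tendsto:
  assumes "\<omega> \<in> space M" "t > 0"
  shows "(\<lambda>n. X t n x \<omega>) \<longlonglongrightarrow> Y t x \<omega>"
proof -
  have "continuous_on {0..} (\<lambda>s. W s \<omega>)" using bm assms by (simp add: brownian_motion_def)
  from chain_tendsto_solution[OF flow_solution[OF this] this assms(2)]
  show ?thesis unfolding X_def Y_def .
qed

lemma X_measurable:
  assumes t: "t > 0"
  shows "(\<lambda>z. X t n (fst z) (snd z)) \<in> borel_measurable joint"
  unfolding X_def
proof (rule chain_measurable)
  have Wm: "(\<lambda>z. W s (snd z)) \<in> borel_measurable joint" if "s \<ge> 0" for s
    using W_measurable[OF that] by measurable
  have [measurable]: "fst \<in> borel_measurable joint"
    using measurable_fst[of std_gaussian M] by (simp add: measurable_cong_sets[OF refl sets_std_gaussian])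
  show "(\<lambda>z. fst z + (0, sqrt (2 * \<gamma>) *\<^sub>R W 0 (snd z))) \<in> borel_measurable joint"
    using borel_measurable_scaleR[OF borel_measurable_const Wm[of 0]]
    by (intro borel_measurable_add borel_measurable_Pair) auto
  show "(\<lambda>z. W (real (Suc k) * (t / real n)) (snd z) - W (real k * (t / real n)) (snd z))
      \<in> borel_measurable joint" for k
    using t by (intro borel_measurable_diff Wm) auto
qed

text \<open>The flow comes from a choice made separately for each path, so its measurability is
  inherited from the scheme, which converges to it at every point of the joint space.\<close>

lemma Y_measurable [measurable]:
  assumes t: "t > 0"
  shows "(\<lambda>z. Y t (fst z) (snd z)) \<in> borel_measurable joint"
  by (rule borel_measurable_LIMSEQ_metric[OF X_measurable[OF t]])
    (auto simp: space_pair_measure intro!: X_tendsto t)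

lemma nn_integral_X:
  assumes t: "t > 0" and n: "n > 0" and u: "u \<in> borel_measurable borel"
  shows "(\<integral>\<^sup>+\<omega>. u (X t n x \<omega>) \<partial>M) = (fwd (t / n) ^^ n) u x"
proof -
  define r where "r = (\<lambda>k. real k * (t / n))"
  have r: "0 \<le> r 0 \<and> (\<forall>k<n. r k < r (Suc k))" and r0: "\<And>k. 0 \<le> r k" and r1: "\<And>k. r (Suc k) - r k = t / n"
    using t n by (auto simp: r_def field_simps)
  have W0: "AE \<omega> in M. W 0 \<omega> = 0" using bm by (simp add: brownian_motion_def)
  have "(\<integral>\<^sup>+\<omega>. u (X t n x \<omega>) \<partial>M) = (\<integral>\<^sup>+\<omega>. u (chain (t / n) (\<lambda>k. W (r (Suc k)) \<omega> - W (r k) \<omega>) x n) \<partial>M)"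
    by (rule nn_integral_cong_AE) (use W0 in \<open>auto simp: X_def r_def simp flip: zero_prod_def\<close>)
  also have "\<dots> = (fwd (t / n) ^^ n) u x"
  proof (rule nn_integral_chain[OF prob_space_axioms _ _ _ u])
    show "indep_vars (\<lambda>_. borel) (\<lambda>k \<omega>. W (r (Suc k)) \<omega> - W (r k) \<omega>) {..<n}"
      using bm r unfolding brownian_motion_def by blast
    show "distributed M lborel (\<lambda>\<omega>. W (r (Suc k)) \<omega> - W (r k) \<omega>)
        (\<lambda>x. ennreal (\<Prod>b\<in>Basis. normal_density 0 (sqrt (t / n)) (x \<bullet> b)))" if "k < n" for k
      using bm r r0[of k] that unfolding brownian_motion_def r1[of k, symmetric] by blast
  qed (use t n in auto)
  finally show ?thesis .
qed

interpretation GM: pair_sigma_finite "std_gaussian :: ('a \<times> 'a) measure" M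
  by (simp add: pair_sigma_finite_def prob_space_imp_sigma_finite prob_space_axioms prob_space_std_gaussian)

lemma fst_sq_measurable [measurable]:
  "(\<lambda>z. sq v k (fst z)) \<in> borel_measurable joint"
  by (rule measurable_compose[OF measurable_fst]) (simp add: sq_measurable)

text \<open>On the left the chain converges pathwise under the fixed weight \<open>sq v k\<close>;
  on the right only the vector of the weight moves, and it converges to the mean flow.\<close>

lemma duality_continuous:
  fixes u :: "'a \<times> 'a \<Rightarrow> real" and v :: "'a \<times> 'a"
  assumes t: "t > 0" and k: "k \<ge> 0" and u: "continuous_on UNIV u" "\<And>x. 0 \<le> u x \<and> u x \<le> 1"
  defines "m \<equiv> mean_flow t v"
  shows "(\<integral>\<^sup>+z. sq v k (fst z) * ennreal (u (Y t (fst z) (snd z))) \<partial>joint)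
    = (\<integral>\<^sup>+x. sq m (k + (norm v)\<^sup>2 - (norm m)\<^sup>2) x * ennreal (u x) \<partial>std_gaussian)"
proof -
  let ?S = "\<lambda>m. sq m (k + (norm v)\<^sup>2 - (norm m)\<^sup>2)"
  let ?w = "\<lambda>x :: 'a \<times> 'a. ennreal ((norm v)\<^sup>2 * (norm x)\<^sup>2 + (k + (norm v)\<^sup>2))"
  have um [measurable]: "u \<in> borel_measurable borel" by (rule borel_measurable_continuous_onI[OF u(1)])
  define U where "U = (\<lambda>x. ennreal (u x))"
  have Um [measurable]: "U \<in> borel_measurable borel" unfolding U_def by measurable
  obtain n0 where n0: "\<And>n. 2 * \<gamma> * (t / real (n + n0)) \<le> 1" "n0 > 0"
    by (rule admissible_step_sizes[OF t]) blast
  define h where "h = (\<lambda>n. n + n0)"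
  define d where "d = (\<lambda>n. t / real (h n))"
  have d: "d n \<ge> 0" "2 * \<gamma> * d n \<le> 1" "h n > 0" for n
    using t n0 unfolding d_def h_def by auto
  have sub: "(\<lambda>n. f (h n)) \<longlonglongrightarrow> l" if "f \<longlonglongrightarrow> l" for f :: "nat \<Rightarrow> 'c::topological_space" and l
    using LIMSEQ_ignore_initial_segment[OF that, of n0] by (simp add: h_def)
  define N where "N = (\<lambda>n. chain (d n) (\<lambda>_. 0) v (h n))"
  have N: "N \<longlonglongrightarrow> m" unfolding N_def m_def d_def by (rule sub[OF chain_mean_tendsto[OF t]])
  have nN: "norm (N n) \<le> norm v" for n unfolding N_def by (rule norm_chain_mean_le[OF d(1,2)])
  let ?FX = "\<lambda>n z. sq v k (fst z) * U (X t (h n) (fst z) (snd z))"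
  let ?FY = "\<lambda>z. sq v k (fst z) * U (Y t (fst z) (snd z))"
  let ?L = "\<lambda>n. \<integral>\<^sup>+z. ?FX n z \<partial>joint"
  let ?R = "\<lambda>n. \<integral>\<^sup>+x. ?S (N n) x * U x \<partial>std_gaussian"
  \<comment> \<open>For the scheme the identity is exact at every step size; limits are taken only
    afterwards, on both sides separately.\<close>
  have LR: "?L n = ?R n" for n
  proof -
    have "?L n = (\<integral>\<^sup>+x. \<integral>\<^sup>+\<omega>. sq v k x * U (X t (h n) x \<omega>) \<partial>M \<partial>std_gaussian)"
      using X_measurable[OF t, of "h n"] by (subst nn_integral_fst[symmetric]) auto
    also have "\<dots> = (\<integral>\<^sup>+x. (fwd (d n) ^^ h n) U x * sq v k x \<partial>std_gaussian)"
    proof (rule nn_integral_cong)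
      fix x
      have "(\<lambda>\<omega>. X t (h n) x \<omega>) \<in> borel_measurable M"
        using measurable_Pair2[OF X_measurable[OF t, of "h n"], of x] by simp
      then show "(\<integral>\<^sup>+\<omega>. sq v k x * U (X t (h n) x \<omega>) \<partial>M) = (fwd (d n) ^^ h n) U x * sq v k x"
        by (simp add: nn_integral_cmult nn_integral_X[OF t d(3) Um] d_def mult.commute)
    qed
    also have "\<dots> = (\<integral>\<^sup>+x. U x * (bwd (d n) ^^ h n) (sq v k) x \<partial>std_gaussian)"
      by (rule fwd_bwd_funpow_duality[OF d(1,2)]) simp_all
    also have "\<dots> = ?R n"
      by (simp add: bwd_funpow_sq[OF d(1,2) k] N_def mult.commute)
    finally show ?thesis .
  qed
  have isU: "isCont u x" for x using u(1) by (simp only: continuous_on_eq_continuous_at[OF open_UNIV]) blast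
  have U1: "a * U x \<le> a" for a x
    using u(2)[of x] mult_left_mono[of "U x" 1 a] by (simp add: U_def)
  have L: "?L \<longlonglongrightarrow> (\<integral>\<^sup>+z. ?FY z \<partial>joint)"
  proof (rule nn_integral_dominated_convergence[where w = "\<lambda>z. sq v k (fst z)"])
    show "(\<lambda>z. ?FX n z) \<in> borel_measurable joint" for n
      using X_measurable[OF t, of "h n"] by measurable
    show "(\<lambda>z. ?FY z) \<in> borel_measurable joint"
      using Y_measurable[OF t] by measurable
    show "AE z in joint. ?FX n z \<le> sq v k (fst z)" for n
      by (simp add: U1)
    have "(\<integral>\<^sup>+z. sq v k (fst z) \<partial>joint) = (\<integral>\<^sup>+x. sq v k x \<partial>std_gaussian)"
      by (subst nn_integral_fst[symmetric]) (auto simp: emeasure_space_1)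
    then show "(\<integral>\<^sup>+z. sq v k (fst z) \<partial>joint) < \<infinity>"
      by (simp add: nn_integral_sq[OF k])
    show "AE z in joint. (\<lambda>n. ?FX n z)
        \<longlonglongrightarrow> ?FY z"
    proof (rule AE_I2)
      fix z :: "('a \<times> 'a) \<times> 'w" assume "z \<in> space joint"
      then have "snd z \<in> space M" by (auto simp: space_pair_measure)
      then have "(\<lambda>n. u (X t (h n) (fst z) (snd z))) \<longlonglongrightarrow> u (Y t (fst z) (snd z))"
        by (intro isCont_tendsto_compose[OF isU] sub[OF X_tendsto] t)
      then show "(\<lambda>n. ?FX n z)
        \<longlonglongrightarrow> ?FY z"
        unfolding U_def by (intro tendsto_mult_ennreal[OF tendsto_const] tendsto_ennrealI)
          (auto simp: sq_def simp del: ennreal_plus)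
    qed
  qed simp
  have "?R \<longlonglongrightarrow> (\<integral>\<^sup>+x. ?S m x * U x \<partial>std_gaussian)"
  proof (rule nn_integral_dominated_convergence[where w = "\<lambda>x. ?w x"])
    show "AE x in std_gaussian. ?S (N n) x * U x
        \<le> ?w x" for n
    proof (rule AE_I2)
      fix x
      have "(N n \<bullet> x)\<^sup>2 \<le> (norm (N n))\<^sup>2 * (norm x)\<^sup>2" by (rule inner_square_le)
      also have "(norm (N n))\<^sup>2 * (norm x)\<^sup>2 \<le> (norm v)\<^sup>2 * (norm x)\<^sup>2"
        by (intro mult_right_mono power_mono nN) auto
      finally have "(N n \<bullet> x)\<^sup>2 \<le> (norm v)\<^sup>2 * (norm x)\<^sup>2" .
      moreover have "0 \<le> (norm (N n))\<^sup>2" by simp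
      ultimately have "?S (N n) x \<le> ?w x"
        unfolding sq_def by (intro ennreal_leI) linarith
      then show "?S (N n) x * U x \<le> ?w x"
        using U1 order_trans by blast
    qed
    have "integrable std_gaussian (\<lambda>x :: 'a \<times> 'a. (norm v)\<^sup>2 * (norm x)\<^sup>2 + (k + (norm v)\<^sup>2))"
      using integrable_std_gaussian_norm(1) by auto
    then show "(\<integral>\<^sup>+x. ?w x \<partial>(std_gaussian :: ('a \<times> 'a) measure)) < \<infinity>"
      using k by (subst nn_integral_eq_integral) auto
    show "AE x in std_gaussian. (\<lambda>n. ?S (N n) x * U x)
        \<longlonglongrightarrow> ?S m x * U x"
    proof (rule AE_I2)
      fix x
      have 1: "(\<lambda>n. ?S (N n) x) \<longlonglongrightarrow> ?S m x"
        unfolding sq_def by (intro tendsto_intros N)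
      show "(\<lambda>n. ?S (N n) x * U x) \<longlonglongrightarrow> ?S m x * U x"
        by (rule tendsto_mult_ennreal[OF 1 tendsto_const]) (auto simp: sq_def U_def)
    qed
  qed (unfold measurable_std_gaussian, measurable)
  from LIMSEQ_unique[OF L this[folded LR]] show ?thesis
    unfolding U_def .
qed

text \<open>As the law of the flow under a weighted initial measure, the duality extends to
  arbitrary test functions, in particular to the unknown solution of the Poisson equation.\<close>

lemma measure_duality:
  fixes v :: "'a \<times> 'a"
  assumes t: "t > 0" and k: "k \<ge> 0"
  defines "m \<equiv> mean_flow t v"
  shows "distr (density joint (\<lambda>z. sq v k (fst z))) borel (\<lambda>z. Y t (fst z) (snd z))
    = density std_gaussian (sq m (k + (norm v)\<^sup>2 - (norm m)\<^sup>2))" (is "?A = ?B")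
proof (rule measure_eqI_continuous)
  note [measurable] = Y_measurable[OF t]
  have kk: "k + (norm v)\<^sup>2 - (norm m)\<^sup>2 \<ge> 0"
    using norm_mean_flow_le[OF t, of v] k by (simp add: m_def add_increasing power_mono)
  show eq: "(\<integral>\<^sup>+x. ennreal (u x) \<partial>?A) = (\<integral>\<^sup>+x. ennreal (u x) \<partial>?B)"
    if "continuous_on UNIV u" "\<And>x. 0 \<le> u x \<and> u x \<le> 1" for u :: "'a \<times> 'a \<Rightarrow> real"
  proof -
    have [measurable]: "u \<in> borel_measurable borel" by (rule borel_measurable_continuous_onI[OF that(1)])
    show ?thesis
      using duality_continuous[OF t k that, of v] unfolding m_def[symmetric]
      by (simp add: nn_integral_distr nn_integral_density)
  qed
  have B: "emeasure ?B UNIV = ennreal ((norm m)\<^sup>2 + (k + (norm v)\<^sup>2 - (norm m)\<^sup>2))"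
    using nn_integral_sq[OF kk, of m] by (simp add: emeasure_density)
  then show "finite_measure ?B" by (intro finite_measureI) simp
  have "emeasure ?A UNIV = emeasure ?B UNIV" using eq[of "\<lambda>_. 1"] by simp
  then show "finite_measure ?A" using B by (intro finite_measureI) simp
qed simp_all

definition sg :: "real \<Rightarrow> ('a \<times> 'a \<Rightarrow> real) \<Rightarrow> 'a \<times> 'a \<Rightarrow> real" where
  "sg t u x = (\<integral>\<omega>. u (Y t x \<omega>) \<partial>M)"

lemma sg_measurable [measurable]:
  assumes t: "t > 0" and u [measurable]: "u \<in> borel_measurable borel"
  shows "sg t u \<in> borel_measurable borel"
proof -
  have [measurable]: "(\<lambda>z. u (Y t (fst z) (snd z))) \<in> borel_measurable joint"
    using Y_measurable[OF t] by measurable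
  have "(\<lambda>x. \<integral>\<omega>. u (Y t x \<omega>) \<partial>M) \<in> borel_measurable std_gaussian"
    by (rule borel_measurable_lebesgue_integral) (simp add: split_def)
  then show ?thesis by (simp add: sg_def[abs_def])
qed

lemma sg_duality_square:
  fixes u :: "'a \<times> 'a \<Rightarrow> real" and v :: "'a \<times> 'a"
  assumes t: "t > 0" and k: "k \<ge> 0" and um [measurable]: "u \<in> borel_measurable borel"
  defines "m \<equiv> mean_flow t v"
  assumes I: "integrable std_gaussian (\<lambda>x. ((m \<bullet> x)\<^sup>2 + (k + (norm v)\<^sup>2 - (norm m)\<^sup>2)) * u x)"
  shows "integrable std_gaussian (\<lambda>x. ((v \<bullet> x)\<^sup>2 + k) * sg t u x)"
    and "(\<integral>x. ((v \<bullet> x)\<^sup>2 + k) * sg t u x \<partial>std_gaussian)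
      = (\<integral>x. ((m \<bullet> x)\<^sup>2 + (k + (norm v)\<^sup>2 - (norm m)\<^sup>2)) * u x \<partial>std_gaussian)"
proof -
  define k' where "k' = k + (norm v)\<^sup>2 - (norm m)\<^sup>2"
  have k': "k' \<ge> 0"
    using norm_mean_flow_le[OF t, of v] k by (simp add: k'_def m_def add_increasing power_mono)
  note [measurable] = Y_measurable[OF t]
  have fm [measurable]: "(\<lambda>z. v \<bullet> fst z) \<in> borel_measurable joint"
    by (rule measurable_compose[OF measurable_fst]) simp
  \<comment> \<open>Integrating \<open>u\<close> against \<open>Q\<close> in its two descriptions
    gives both sides, and integrability is transferred from the density form to the joint
    space.\<close>
  define Q where "Q = distr (density joint (\<lambda>z. ennreal ((v \<bullet> fst z)\<^sup>2 + k))) borel (\<lambda>z. Y t (fst z) (snd z))"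
  have Q: "Q = density std_gaussian (\<lambda>x. ennreal ((m \<bullet> x)\<^sup>2 + k'))"
    using measure_duality[OF t k, of v] unfolding Q_def sq_def[abs_def] k'_def m_def .
  have IQ: "integrable Q u"
    unfolding Q using I k' by (subst integrable_density) (auto simp: k'_def)
  have EQ: "integral\<^sup>L Q u = (\<integral>x. ((m \<bullet> x)\<^sup>2 + k') * u x \<partial>std_gaussian)"
    unfolding Q using k' by (subst integral_density) auto
  let ?F = "\<lambda>z. ((v \<bullet> fst z)\<^sup>2 + k) * u (Y t (fst z) (snd z))"
  have IF: "integrable joint ?F"
  proof -
    have "integrable (density joint (\<lambda>z. ennreal ((v \<bullet> fst z)\<^sup>2 + k))) (\<lambda>z. u (Y t (fst z) (snd z)))"
      by (rule integrable_distr[OF _ IQ[unfolded Q_def]]) simp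
    then show ?thesis using k by (subst (asm) integrable_density) auto
  qed
  have EF: "integral\<^sup>L Q u = integral\<^sup>L joint ?F"
    using k unfolding Q_def by (simp add: integral_distr integral_density del: ennreal_plus)
  have in_eq: "(\<integral>\<omega>. ?F (x, \<omega>) \<partial>M) = ((v \<bullet> x)\<^sup>2 + k) * sg t u x" for x
    by (simp add: sg_def)
  show "integrable std_gaussian (\<lambda>x. ((v \<bullet> x)\<^sup>2 + k) * sg t u x)"
    using GM.integrable_fst'[OF IF] unfolding in_eq .
  show "(\<integral>x. ((v \<bullet> x)\<^sup>2 + k) * sg t u x \<partial>std_gaussian)
      = (\<integral>x. ((m \<bullet> x)\<^sup>2 + (k + (norm v)\<^sup>2 - (norm m)\<^sup>2)) * u x \<partial>std_gaussian)"
    using GM.integral_fst'[OF IF] unfolding in_eq EF[symmetric] EQ k'_def .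
qed

lemma sg_duality_herm:
  fixes u :: "'a \<times> 'a \<Rightarrow> real" and v w :: "'a \<times> 'a"
  assumes t: "t > 0" and u: "square_integrable std_gaussian u"
  shows "integrable std_gaussian (\<lambda>x. sg t u x * herm v w x)"
    and "(\<integral>x. sg t u x * herm v w x \<partial>std_gaussian) = (\<integral>x. u x * herm (mean_flow t v) (mean_flow t w) x \<partial>std_gaussian)"
proof -
  let ?m = "mean_flow t"
  interpret m: linear ?m by (rule linear_mean_flow[OF t])
  have um: "u \<in> borel_measurable borel" using u by (simp add: square_integrable_def)
  have I: "integrable std_gaussian (\<lambda>x. ((m \<bullet> x)\<^sup>2 + k) * u x)" for m k
  proof -
    have b: "\<bar>(m \<bullet> x)\<^sup>2 + k\<bar> \<le> ((norm m)\<^sup>2 + \<bar>k\<bar>) * ((norm x)\<^sup>2 + 1)" for x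
    proof -
      have "\<bar>(m \<bullet> x)\<^sup>2 + k\<bar> \<le> (norm m)\<^sup>2 * (norm x)\<^sup>2 + \<bar>k\<bar>"
        using inner_square_le[of m x] zero_le_power2[of "m \<bullet> x"] by linarith
      also have "\<dots> \<le> ((norm m)\<^sup>2 + \<bar>k\<bar>) * ((norm x)\<^sup>2 + 1)" by (simp add: algebra_simps)
      finally show ?thesis .
    qed
    have "integrable std_gaussian (\<lambda>x. u x * ((m \<bullet> x)\<^sup>2 + k))"
      by (rule integrable_std_gaussian_quadratic[OF u _ b]) measurable
    then show ?thesis by (simp add: mult.commute)
  qed
  have D: "integrable std_gaussian (\<lambda>x. ((v \<bullet> x)\<^sup>2 + k) * sg t u x)"
    "(\<integral>x. ((v \<bullet> x)\<^sup>2 + k) * sg t u x \<partial>std_gaussian)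
      = (\<integral>x. ((?m v \<bullet> x)\<^sup>2 + (k + (norm v)\<^sup>2 - (norm (?m v))\<^sup>2)) * u x \<partial>std_gaussian)" if "k \<ge> 0" for v k
    using sg_duality_square[OF t that um, of v] I by blast+
  \<comment> \<open>Polarization into weights of the admissible form; the constant term is the
    weight with vector 0 and constant 1.\<close>
  have e: "sg t u x * herm v w x = (1 / 4) * (((v + w) \<bullet> x)\<^sup>2 + 0) * sg t u x - (1 / 4) * ((((v - w) \<bullet> x)\<^sup>2 + 0) * sg t u x)
      - (v \<bullet> w) * (((0 \<bullet> x)\<^sup>2 + 1) * sg t u x)" for x
    by (simp add: herm_polarization algebra_simps)
  show "integrable std_gaussian (\<lambda>x. sg t u x * herm v w x)"
    unfolding e mult.assoc using D(1)[of 0] D(1)[of 1 0]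
    by (intro Bochner_Integration.integrable_diff integrable_mult_right) auto
  let ?K = "\<lambda>v k x. ((?m v \<bullet> x)\<^sup>2 + (k + (norm v)\<^sup>2 - (norm (?m v))\<^sup>2)) * u x"
  have lc: "(\<integral>x. c * f x - c' * g x - c'' * h x \<partial>N)
      = c * integral\<^sup>L N f - c' * integral\<^sup>L N g - c'' * integral\<^sup>L N h"
    if "integrable N f" "integrable N g" "integrable N h"
    for N :: "('a \<times> 'a) measure" and f g h :: "'a \<times> 'a \<Rightarrow> real" and c c' c'' :: real
    using that by simp
  have "(\<integral>x. sg t u x * herm v w x \<partial>std_gaussian) = (1 / 4) * (\<integral>x. ?K (v + w) 0 x \<partial>std_gaussian)
      - (1 / 4) * (\<integral>x. ?K (v - w) 0 x \<partial>std_gaussian) - (v \<bullet> w) * (\<integral>x. ?K 0 1 x \<partial>std_gaussian)"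
    unfolding e mult.assoc using D[of 0 "v + w"] D[of 0 "v - w"] D[of 1 0] by simp
  also have "\<dots> = (\<integral>x. (1 / 4) * ?K (v + w) 0 x - (1 / 4) * ?K (v - w) 0 x - (v \<bullet> w) * ?K 0 1 x \<partial>std_gaussian)"
    by (rule lc[symmetric]) (rule I)+
  also have "\<dots> = (\<integral>x. u x * herm (?m v) (?m w) x \<partial>std_gaussian)"
  proof (rule Bochner_Integration.integral_cong[OF refl])
    fix x
    have "(1 / 4) * ?K (v + w) 0 x - (1 / 4) * ?K (v - w) 0 x - (v \<bullet> w) * ?K 0 1 x
      = u x * (((?m v + ?m w) \<bullet> x)\<^sup>2 / 4 - ((?m v - ?m w) \<bullet> x)\<^sup>2 / 4
        + ((norm (v + w))\<^sup>2 - (norm (v - w))\<^sup>2) / 4 - ((norm (?m v + ?m w))\<^sup>2 - (norm (?m v - ?m w))\<^sup>2) / 4 - v \<bullet> w)"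
      by (simp add: m.add m.diff m.zero field_simps)
    also have "\<dots> = u x * herm (?m v) (?m w) x"
      \<comment> \<open>The norms before the flow sum to \<open>v \<bullet> w\<close> and cancel
        that constant, while the norms after it supply the constant of the transported
        \<open>herm\<close>.\<close>
      unfolding norm_polarization herm_polarization by simp
    finally show "(1 / 4) * ?K (v + w) 0 x - (1 / 4) * ?K (v - w) 0 x - (v \<bullet> w) * ?K 0 1 x
      = u x * herm (?m v) (?m w) x" .
  qed
  finally show "(\<integral>x. sg t u x * herm v w x \<partial>std_gaussian) = (\<integral>x. u x * herm (?m v) (?m w) x \<partial>std_gaussian)" .
qed

text \<open>Invariance of the Gaussian is the case of a constant weight: vector 0 and constant
  1.\<close>

lemma Y_law:
  assumes t: "t > 0" and U [measurable]: "U \<in> borel_measurable borel"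
  shows "(\<integral>\<^sup>+x. \<integral>\<^sup>+\<omega>. U (Y t x \<omega>) \<partial>M \<partial>std_gaussian) = (\<integral>\<^sup>+x. U x \<partial>std_gaussian)"
proof -
  note [measurable] = Y_measurable[OF t]
  have s: "sq (0 :: 'a \<times> 'a) 1 = (\<lambda>_. 1)" by (simp add: sq_def fun_eq_iff)
  have m0: "mean_flow t 0 = 0" by (rule linear_0[OF linear_mean_flow[OF t]])
  have "distr joint borel (\<lambda>z. Y t (fst z) (snd z)) = std_gaussian"
    using measure_duality[OF t, of 1 0] by (simp add: m0 s density_1)
  then have "(\<integral>\<^sup>+x. U x \<partial>std_gaussian) = (\<integral>\<^sup>+x. U x \<partial>distr joint borel (\<lambda>z. Y t (fst z) (snd z)))"
    by simp
  also have "\<dots> = (\<integral>\<^sup>+z. U (Y t (fst z) (snd z)) \<partial>joint)"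
    by (rule nn_integral_distr) simp_all
  also have "\<dots> = (\<integral>\<^sup>+x. \<integral>\<^sup>+\<omega>. U (Y t x \<omega>) \<partial>M \<partial>std_gaussian)"
    by (subst nn_integral_fst[symmetric]) auto
  finally show ?thesis ..
qed

lemma Y_measurable2: "t > 0 \<Longrightarrow> Y t x \<in> borel_measurable M"
  using measurable_Pair2[OF Y_measurable, of t x] by simp

text \<open>The scheme transports the square exactly, with the transposed noise-free chain acting on
  \<open>v\<close>; Fatou's lemma carries this to the flow as an inequality.\<close>

lemma sq_Y_le:
  fixes v :: "'a \<times> 'a"
  assumes t: "t > 0"
  defines "m \<equiv> adjoint (mean_flow t) v"
  shows "(\<integral>\<^sup>+\<omega>. sq v 0 (Y t x \<omega>) \<partial>M) \<le> sq m ((norm v)\<^sup>2 - (norm m)\<^sup>2) x"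
proof -
  obtain n0 where n0: "\<And>n. 2 * \<gamma> * (t / real (n + n0)) \<le> 1" "n0 > 0"
    by (rule admissible_step_sizes[OF t]) blast
  define h where "h = (\<lambda>n. n + n0)"
  define d where "d = (\<lambda>n. t / real (h n))"
  have d: "d n \<ge> 0" "2 * \<gamma> * d n \<le> 1" "h n > 0" for n
    using t n0 unfolding d_def h_def by auto
  define N where "N = (\<lambda>n. ((adjoint (\<lambda>z. step (d n) z 0)) ^^ h n) v)"
  have N: "N \<longlonglongrightarrow> m"
    using LIMSEQ_ignore_initial_segment[OF adjoint_mean_flow_tendsto[OF t, of v], of n0]
    by (simp add: N_def m_def d_def h_def)
  have XY: "(\<lambda>n. X t (h n) x \<omega>) \<longlonglongrightarrow> Y t x \<omega>" if "\<omega> \<in> space M" for \<omega>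
    using LIMSEQ_ignore_initial_segment[OF X_tendsto[OF that t, of x], of n0] by (simp add: h_def)
  have Xm: "X t (h n) x \<in> borel_measurable M" for n
    using measurable_Pair2[OF X_measurable[OF t], of x "h n"] by simp
  have lim: "(\<lambda>n. sq (f n) (a n) (g n)) \<longlonglongrightarrow> sq l b y" if "f \<longlonglongrightarrow> l" "a \<longlonglongrightarrow> b" "g \<longlonglongrightarrow> y" for f a g l b y
    unfolding sq_def by (intro tendsto_intros that)
  have "(\<integral>\<^sup>+\<omega>. sq v 0 (Y t x \<omega>) \<partial>M) = (\<integral>\<^sup>+\<omega>. liminf (\<lambda>n. sq v 0 (X t (h n) x \<omega>)) \<partial>M)"
    by (intro nn_integral_cong lim_imp_Liminf[symmetric] lim XY tendsto_const) auto
  also have "\<dots> \<le> liminf (\<lambda>n. \<integral>\<^sup>+\<omega>. sq v 0 (X t (h n) x \<omega>) \<partial>M)"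
    by (rule nn_integral_liminf) (use Xm in measurable)
  also have "(\<lambda>n. \<integral>\<^sup>+\<omega>. sq v 0 (X t (h n) x \<omega>) \<partial>M) = (\<lambda>n. sq (N n) (0 + (norm v)\<^sup>2 - (norm (N n))\<^sup>2) x)"
  proof
    fix n
    show "(\<integral>\<^sup>+\<omega>. sq v 0 (X t (h n) x \<omega>) \<partial>M) = sq (N n) (0 + (norm v)\<^sup>2 - (norm (N n))\<^sup>2) x"
      using fwd_funpow_sq[OF d(1,2)[of n], where k = 0 and v = v and n = "h n"]
      by (simp add: nn_integral_X[OF t d(3) sq_measurable] N_def) (simp add: d_def)
  qed
  also have "liminf \<dots> = sq m ((norm v)\<^sup>2 - (norm m)\<^sup>2) x"
    by (intro lim_imp_Liminf lim N) (auto intro!: tendsto_eq_intros N)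
  finally show ?thesis .
qed

lemma norm_adjoint_mean_flow_le:
  assumes t: "t > 0"
  shows "norm (adjoint (mean_flow t) v) \<le> norm v"
proof -
  define m where "m = adjoint (mean_flow t) v"
  have "norm m * norm m = mean_flow t m \<bullet> v"
    using adjoint_works[OF linear_mean_flow[OF t], of m v] unfolding m_def[symmetric]
    by (metis power2_eq_square power2_norm_eq_inner)
  also have "\<dots> \<le> norm m * norm v"
    using norm_mean_flow_le[OF t, of m] by (meson norm_cauchy_schwarz mult_right_mono norm_ge_zero order_trans)
  finally show ?thesis unfolding m_def[symmetric] by (cases "norm m = 0") auto
qed

text \<open>Fatou only gives one inequality for the unbounded function \<open>(v \<bullet> x)\<^sup>2\<close>; both sides
  have the same integral by invariance of the Gaussian measure.\<close>

lemma sq_Y_eq: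
  fixes v :: "'a \<times> 'a"
  assumes t: "t > 0"
  defines "m \<equiv> adjoint (mean_flow t) v"
  shows "AE x in std_gaussian. integrable M (\<lambda>\<omega>. (v \<bullet> Y t x \<omega>)\<^sup>2) \<and>
    (\<integral>\<omega>. (v \<bullet> Y t x \<omega>)\<^sup>2 \<partial>M) = (m \<bullet> x)\<^sup>2 + ((norm v)\<^sup>2 - (norm m)\<^sup>2)"
proof -
  define k where "k = (norm v)\<^sup>2 - (norm m)\<^sup>2"
  have k: "k \<ge> 0"
    using norm_adjoint_mean_flow_le[OF t, of v] by (simp add: k_def m_def power_mono)
  let ?f = "\<lambda>x. \<integral>\<^sup>+\<omega>. sq v 0 (Y t x \<omega>) \<partial>M"
  let ?g = "sq m k"
  have le: "?f x \<le> ?g x" for x using sq_Y_le[OF t, of v x] by (simp add: m_def k_def)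
  have fm: "?f \<in> borel_measurable std_gaussian"
    using Y_measurable[OF t] by (intro borel_measurable_nn_integral) (simp add: split_def)
  have If: "integral\<^sup>N std_gaussian ?f = ennreal ((norm v)\<^sup>2)"
    using Y_law[OF t, of "sq v 0"] nn_integral_sq[of 0 v] by simp
  have Ig: "integral\<^sup>N std_gaussian ?g = ennreal ((norm v)\<^sup>2)"
    using nn_integral_sq[OF k, of m] by (simp add: k_def)
  have "(\<integral>\<^sup>+x. ?g x - ?f x \<partial>std_gaussian) = 0"
    using le fm If Ig by (subst nn_integral_diff) auto
  then have "AE x in std_gaussian. ?g x - ?f x = 0"
    using fm by (subst (asm) nn_integral_0_iff_AE) auto
  then show ?thesis
  proof eventually_elim
    case (elim x)
    then have "?f x = ?g x" using le[of x] by (metis diff_eq_0_iff_ennreal ennreal_minus_eq_0 order_antisym)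
    then have "(\<integral>\<^sup>+\<omega>. ennreal ((v \<bullet> Y t x \<omega>)\<^sup>2) \<partial>M) = ennreal ((m \<bullet> x)\<^sup>2 + k)"
      by (simp add: sq_def)
    then show ?case
      using k Y_measurable2[OF t, of x] by (subst (asm) nn_integral_eq_integrable) (auto simp: k_def)
  qed
qed

lemma sg_herm:
  fixes v w :: "'a \<times> 'a"
  assumes t: "t > 0"
  defines "m \<equiv> adjoint (mean_flow t)"
  shows "AE x in std_gaussian. integrable M (\<lambda>\<omega>. herm v w (Y t x \<omega>)) \<and> sg t (herm v w) x = herm (m v) (m w) x"
proof -
  interpret m: linear m unfolding m_def by (rule adjoint_linear[OF linear_mean_flow[OF t]])
  show ?thesis
    using sq_Y_eq[OF t, of "v + w"] sq_Y_eq[OF t, of "v - w"]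
  proof eventually_elim
    case (elim x)
    have "sg t (herm v w) x = (1 / 4) * ((m (v + w) \<bullet> x)\<^sup>2 + ((norm (v + w))\<^sup>2 - (norm (m (v + w)))\<^sup>2))
        - (1 / 4) * ((m (v - w) \<bullet> x)\<^sup>2 + ((norm (v - w))\<^sup>2 - (norm (m (v - w)))\<^sup>2)) - v \<bullet> w"
      unfolding sg_def herm_polarization using elim by (simp add: prob_space m_def)
    also have "\<dots> = (1 / 4) * ((m v + m w) \<bullet> x)\<^sup>2 - (1 / 4) * ((m v - m w) \<bullet> x)\<^sup>2
       + (1 / 4) * ((norm (v + w))\<^sup>2 - (norm (v - w))\<^sup>2) - (1 / 4) * ((norm (m v + m w))\<^sup>2 - (norm (m v - m w))\<^sup>2) - v \<bullet> w"
      by (simp add: m.add m.diff algebra_simps)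
    also have "\<dots> = herm (m v) (m w) x" unfolding norm_polarization herm_polarization by simp
    finally show ?case using elim unfolding herm_polarization by simp
  qed
qed

section \<open>Generator and Poisson equation\<close>

lemma linear_drift: "linear drift"
  using bounded_linear_drift by (simp add: linear_conv_bounded_linear)

lemma adjoint_mean_flow_derivative:
  "((\<lambda>t. (adjoint (mean_flow t) v - v) /\<^sub>R t) \<longlongrightarrow> adjoint drift v) (at_right 0)"
proof (rule tendsto_componentwise_iff[THEN iffD2], rule ballI)
  fix b :: "'a \<times> 'a"
  have "((\<lambda>t. v \<bullet> ((mean_flow t b - b) /\<^sub>R t)) \<longlongrightarrow> v \<bullet> drift b) (at_right 0)"
    by (intro tendsto_intros mean_flow_derivative)
  also have "v \<bullet> drift b = adjoint drift v \<bullet> b"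
    using adjoint_works[OF linear_drift, of b v] by (simp add: inner_commute)
  finally have L: "((\<lambda>t. v \<bullet> ((mean_flow t b - b) /\<^sub>R t)) \<longlongrightarrow> adjoint drift v \<bullet> b) (at_right 0)" .
  have "eventually (\<lambda>t. v \<bullet> ((mean_flow t b - b) /\<^sub>R t) = ((adjoint (mean_flow t) v - v) /\<^sub>R t) \<bullet> b) (at_right 0)"
    unfolding eventually_at_right_field
  proof (intro exI[of _ 1] conjI allI impI)
    fix t :: real assume "0 < t" "t < 1"
    then have "b \<bullet> adjoint (mean_flow t) v = mean_flow t b \<bullet> v"
      by (intro adjoint_works linear_mean_flow)
    then show "v \<bullet> ((mean_flow t b - b) /\<^sub>R t) = ((adjoint (mean_flow t) v - v) /\<^sub>R t) \<bullet> b"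
      by (simp add: inner_diff_left inner_diff_right inner_commute)
  qed simp
  then show "((\<lambda>t. ((adjoint (mean_flow t) v - v) /\<^sub>R t) \<bullet> b) \<longlongrightarrow> adjoint drift v \<bullet> b) (at_right 0)"
    by (rule Lim_transform_eventually[OF L])
qed

text \<open>The semigroup moves both vectors by the transposed mean flow, so the generator acts as a
  derivation. The error of the difference quotient is almost everywhere at most \<open>e t\<close>
  times \<open>(norm x)\<^sup>2 + 1\<close>, which has finite second moment.\<close>

lemma generator_herm_sum:
  fixes v w :: "'i \<Rightarrow> 'a \<times> 'a"
  assumes I: "finite I"
  defines "A \<equiv> adjoint drift"
  shows "L2_generator std_gaussian sg (\<lambda>x. \<Sum>i\<in>I. herm (v i) (w i) x)
    (\<lambda>x. \<Sum>i\<in>I. herm (A (v i)) (w i) x + herm (v i) (A (w i)) x)"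
  unfolding L2_generator_def
proof (intro conjI)
  let ?c = "\<lambda>x. \<Sum>i\<in>I. herm (v i) (w i) x"
  let ?g = "\<lambda>x. \<Sum>i\<in>I. herm (A (v i)) (w i) x + herm (v i) (A (w i)) x"
  let ?D = "\<lambda>t x. (sg t ?c x - ?c x) / t - ?g x"
  show "square_integrable std_gaussian ?c" by (rule square_integrable_herm_sum)
  show "square_integrable std_gaussian ?g"
  proof (rule square_integrable_bound)
    fix x :: "'a \<times> 'a"
    have "\<bar>?g x\<bar> \<le> (\<Sum>i\<in>I. norm (A (v i)) * norm (w i) * ((norm x)\<^sup>2 + 1) + norm (v i) * norm (A (w i)) * ((norm x)\<^sup>2 + 1))"
      by (intro order_trans[OF sum_abs] sum_mono order_trans[OF abs_triangle_ineq] add_mono herm_bound)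
    then show "\<bar>?g x\<bar> \<le> (\<Sum>i\<in>I. norm (A (v i)) * norm (w i) + norm (v i) * norm (A (w i))) * ((norm x)\<^sup>2 + 1)"
      by (simp only: sum_distrib_right distrib_right)
  qed measurable
  define m where "m = (\<lambda>t. adjoint (mean_flow t))"
  define e where "e = (\<lambda>t. \<Sum>i\<in>I. herm_err m A (v i) (w i) t)"
  have e: "(e \<longlongrightarrow> 0) (at_right 0)"
  proof -
    have "(e \<longlongrightarrow> (\<Sum>i\<in>I. 0)) (at_right 0)"
      unfolding e_def m_def A_def by (intro tendsto_sum herm_err_tendsto adjoint_mean_flow_derivative)
    then show ?thesis by simp
  qed
  define C where "C = (\<integral>\<^sup>+x. ennreal (((norm (x :: 'a \<times> 'a))\<^sup>2 + 1)\<^sup>2) \<partial>std_gaussian)"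
  have C: "C < top"
    unfolding C_def using integrable_std_gaussian_norm(2) by (subst nn_integral_eq_integral) auto
  have bound: "(\<integral>\<^sup>+x. ennreal ((?D t x)\<^sup>2) \<partial>std_gaussian) \<le> C * ennreal ((e t)\<^sup>2)"
    if t: "t > 0" for t
  proof -
    have "AE x in std_gaussian. \<forall>i\<in>I. integrable M (\<lambda>\<omega>. herm (v i) (w i) (Y t x \<omega>)) \<and>
        sg t (herm (v i) (w i)) x = herm (m t (v i)) (m t (w i)) x"
      unfolding m_def by (intro AE_finite_allI I sg_herm t)
    then have "AE x in std_gaussian. ennreal ((?D t x)\<^sup>2)
        \<le> ennreal (((norm x)\<^sup>2 + 1)\<^sup>2) * ennreal ((e t)\<^sup>2)"
    proof eventually_elim
      case (elim x)
      have "sg t ?c x = (\<Sum>i\<in>I. sg t (herm (v i) (w i)) x)"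
        unfolding sg_def by (rule Bochner_Integration.integral_sum) (use elim in auto)
      also have "\<dots> = (\<Sum>i\<in>I. herm (m t (v i)) (m t (w i)) x)"
        by (rule sum.cong) (use elim in auto)
      finally have sgc: "sg t ?c x = (\<Sum>i\<in>I. herm (m t (v i)) (m t (w i)) x)" .
      have "\<bar>?D t x\<bar> = \<bar>\<Sum>i\<in>I. (herm (m t (v i)) (m t (w i)) x - herm (v i) (w i) x) / t
          - (herm (A (v i)) (w i) x + herm (v i) (A (w i)) x)\<bar>"
        unfolding sgc sum_subtractf sum_divide_distrib[symmetric] ..
      also have "\<dots> \<le> (\<Sum>i\<in>I. herm_err m A (v i) (w i) t * ((norm x)\<^sup>2 + 1))"
        by (intro order_trans[OF sum_abs] sum_mono herm_err_bound t)
      also have "\<dots> = e t * ((norm x)\<^sup>2 + 1)" by (simp add: e_def sum_distrib_right)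
      finally have b: "\<bar>?D t x\<bar> \<le> e t * ((norm x)\<^sup>2 + 1)" .
      have "(?D t x)\<^sup>2 \<le> (e t * ((norm x)\<^sup>2 + 1))\<^sup>2"
        by (rule power2_le_iff_abs_le[THEN iffD2, OF order_trans[OF abs_ge_zero b] b])
      then have "(?D t x)\<^sup>2 \<le> ((norm x)\<^sup>2 + 1)\<^sup>2 * (e t)\<^sup>2"
        by (simp add: power_mult_distrib mult.commute)
      then show ?case by (simp add: ennreal_mult'[symmetric] ennreal_leI)
    qed
    then have "(\<integral>\<^sup>+x. ennreal ((?D t x)\<^sup>2) \<partial>std_gaussian)
        \<le> (\<integral>\<^sup>+x. ennreal (((norm (x :: 'a \<times> 'a))\<^sup>2 + 1)\<^sup>2) * ennreal ((e t)\<^sup>2) \<partial>std_gaussian)"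
      by (rule nn_integral_mono_AE)
    also have "\<dots> = C * ennreal ((e t)\<^sup>2)"
      unfolding C_def by (rule nn_integral_multc) simp
    finally show ?thesis .
  qed
  have "((\<lambda>t. (e t)\<^sup>2) \<longlongrightarrow> 0\<^sup>2) (at_right 0)" by (intro tendsto_intros e)
  then have "((\<lambda>t. ennreal ((e t)\<^sup>2)) \<longlongrightarrow> ennreal 0) (at_right 0)" by (intro tendsto_ennrealI) simp
  then have "((\<lambda>t. C * ennreal ((e t)\<^sup>2)) \<longlongrightarrow> C * ennreal 0) (at_right 0)"
    by (rule ennreal_tendsto_cmult[OF C])
  then have lim: "((\<lambda>t. C * ennreal ((e t)\<^sup>2)) \<longlongrightarrow> 0) (at_right 0)" by simp
  show "((\<lambda>t. \<integral>\<^sup>+x. ennreal ((?D t x)\<^sup>2) \<partial>std_gaussian) \<longlongrightarrow> 0) (at_right 0)"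
  proof (rule tendsto_sandwich[OF _ _ tendsto_const lim])
    show "eventually (\<lambda>t. (\<integral>\<^sup>+x. ennreal ((?D t x)\<^sup>2) \<partial>std_gaussian) \<le> C * ennreal ((e t)\<^sup>2)) (at_right 0)"
      unfolding eventually_at_right_field by (intro exI[of _ 1]) (auto intro: bound)
  qed simp
qed

text \<open>The difference quotient of the semigroup at \<open>u\<close>, paired with the quadratic
  function, has two descriptions as t tends to 0: the generator applied to \<open>u\<close>, and,
  after moving the semigroup across by duality, the mean flow applied to the quadratic function.
  Comparing the limits gives the identity.\<close>

lemma poisson_pairing:
  fixes v w :: "'i \<Rightarrow> 'a \<times> 'a" and F u :: "'a \<times> 'a \<Rightarrow> real"
  assumes I: "finite I" and u: "L2_generator std_gaussian sg u (\<lambda>x. - F x)"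
    and adj: "\<And>x. (\<Sum>i\<in>I. herm (drift (v i)) (w i) x + herm (v i) (drift (w i)) x) = - F x"
  shows "(\<integral>x. u x * F x \<partial>std_gaussian) = (\<integral>x. F x * (\<Sum>i\<in>I. herm (v i) (w i) x) \<partial>std_gaussian)"
proof -
  let ?c = "\<lambda>x. \<Sum>i\<in>I. herm (v i) (w i) x"
  have su: "square_integrable std_gaussian u" and sF': "square_integrable std_gaussian (\<lambda>x. - F x)"
    and lim: "((\<lambda>t. \<integral>\<^sup>+x. ennreal (((sg t u x - u x) / t - - F x)\<^sup>2) \<partial>std_gaussian) \<longlongrightarrow> 0) (at_right 0)"
    using u by (auto simp: L2_generator_def)
  have Fm: "F \<in> borel_measurable borel"
    using sF' borel_measurable_uminus_eq[of F borel] by (simp add: square_integrable_def)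
  have um: "u \<in> borel_measurable borel" using su by (simp add: square_integrable_def)
  have sF: "square_integrable std_gaussian F"
    using sF' Fm by (simp add: square_integrable_def)
  define D where "D = (\<lambda>t x. (sg t u x - u x) / t - - F x)"
  define Z where "Z = (\<lambda>t. \<integral>x. D t x * ?c x \<partial>std_gaussian)"
  define C where "C = (\<integral>\<^sup>+x. ennreal ((?c x)\<^sup>2) \<partial>std_gaussian)"
  have cm: "?c \<in> borel_measurable borel" by measurable
  have C: "C < top"
    using square_integrable_herm_sum[of v w I] unfolding C_def square_integrable_def
    by (subst nn_integral_eq_integral) auto
  have Zb: "ennreal ((Z t)\<^sup>2) \<le> C * (\<integral>\<^sup>+x. ennreal ((D t x)\<^sup>2) \<partial>std_gaussian)" if t: "t > 0" for t
  proof -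
    have Dm [measurable]: "D t \<in> borel_measurable borel"
      unfolding D_def using sg_measurable[OF t um] um Fm by measurable
    have "ennreal \<bar>Z t\<bar> \<le> (\<integral>\<^sup>+x. ennreal \<bar>D t x\<bar> * ennreal \<bar>?c x\<bar> \<partial>std_gaussian)"
    \<comment> \<open>Without integrability \<open>Z t\<close> is 0 by the convention for the
      integral, and the bound is trivial.\<close>
    proof (cases "integrable std_gaussian (\<lambda>x. D t x * ?c x)")
      case True
      from integral_norm_bound_ennreal[OF this] show ?thesis
        by (simp add: Z_def abs_mult ennreal_mult')
    qed (simp add: Z_def not_integrable_integral_eq)
    then have "(ennreal \<bar>Z t\<bar>)\<^sup>2 \<le> (\<integral>\<^sup>+x. ennreal \<bar>D t x\<bar> * ennreal \<bar>?c x\<bar> \<partial>std_gaussian)\<^sup>2"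
      by (rule power_mono) simp
    also have "\<dots> \<le> (\<integral>\<^sup>+x. (ennreal \<bar>D t x\<bar>)\<^sup>2 \<partial>std_gaussian) * (\<integral>\<^sup>+x. (ennreal \<bar>?c x\<bar>)\<^sup>2 \<partial>std_gaussian)"
      by (rule Cauchy_Schwarz_nn_integral) simp_all
    finally show ?thesis by (simp add: ennreal_power C_def mult.commute)
  qed
  have "((\<lambda>t. C * (\<integral>\<^sup>+x. ennreal ((D t x)\<^sup>2) \<partial>std_gaussian)) \<longlongrightarrow> C * 0) (at_right 0)"
    by (rule ennreal_tendsto_cmult[OF C]) (use lim in \<open>simp only: D_def\<close>)
  then have lim': "((\<lambda>t. C * (\<integral>\<^sup>+x. ennreal ((D t x)\<^sup>2) \<partial>std_gaussian)) \<longlongrightarrow> 0) (at_right 0)" by simp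
  have "((\<lambda>t. ennreal ((Z t)\<^sup>2)) \<longlongrightarrow> 0) (at_right 0)"
  proof (rule tendsto_sandwich[OF _ _ tendsto_const lim'])
    show "eventually (\<lambda>t. ennreal ((Z t)\<^sup>2) \<le> C * (\<integral>\<^sup>+x. ennreal ((D t x)\<^sup>2) \<partial>std_gaussian)) (at_right 0)"
      unfolding eventually_at_right_field by (intro exI[of _ 1]) (auto intro: Zb)
  qed simp
  then have "((\<lambda>t. enn2real (ennreal ((Z t)\<^sup>2))) \<longlongrightarrow> enn2real 0) (at_right 0)"
    by (intro tendsto_enn2real) auto
  then have "((\<lambda>t. sqrt ((Z t)\<^sup>2)) \<longlongrightarrow> sqrt 0) (at_right 0)" by (intro tendsto_real_sqrt) simp
  then have Z0: "(Z \<longlongrightarrow> 0) (at_right 0)" by (simp add: tendsto_rabs_zero_iff)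
  define m where "m = mean_flow"
  let ?ct = "\<lambda>t x. \<Sum>i\<in>I. herm (m t (v i)) (m t (w i)) x"
  let ?Q = "\<lambda>t. \<integral>x. u x * ((?ct t x - ?c x) / t) \<partial>std_gaussian"
  let ?E = "\<integral>x. u x * - F x \<partial>std_gaussian"
  let ?G = "\<integral>x. F x * ?c x \<partial>std_gaussian"
  have Iu: "integrable std_gaussian (\<lambda>x. h x * (\<Sum>i\<in>I. herm (f i) (g i) x))"
    if "square_integrable std_gaussian h" for h and f g :: "'i \<Rightarrow> 'a \<times> 'a"
    unfolding sum_distrib_left by (intro Bochner_Integration.integrable_sum integrable_mult_herm that)
  have Zeq: "Z t = ?Q t + ?G" if t: "t > 0" for t
  proof -
    have i: "integrable std_gaussian (\<lambda>x. sg t u x * ?c x)"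
      unfolding sum_distrib_left by (intro Bochner_Integration.integrable_sum sg_duality_herm[OF t su])
    have "(\<integral>x. sg t u x * ?c x \<partial>std_gaussian) = (\<Sum>i\<in>I. \<integral>x. u x * herm (m t (v i)) (m t (w i)) x \<partial>std_gaussian)"
      unfolding sum_distrib_left m_def
      by (subst Bochner_Integration.integral_sum) (simp_all add: sg_duality_herm[OF t su])
    also have "\<dots> = (\<integral>x. u x * ?ct t x \<partial>std_gaussian)"
      unfolding sum_distrib_left
      by (rule Bochner_Integration.integral_sum[symmetric]) (rule integrable_mult_herm[OF su])
    finally have e: "(\<integral>x. sg t u x * ?c x \<partial>std_gaussian) = (\<integral>x. u x * ?ct t x \<partial>std_gaussian)" .
    have D: "D t x * ?c x = (1 / t) * (sg t u x * ?c x) - (1 / t) * (u x * ?c x) + F x * ?c x" for x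
      unfolding D_def by (simp add: algebra_simps diff_divide_distrib)
    have U: "u x * ((?ct t x - ?c x) / t) = (1 / t) * (u x * ?ct t x) - (1 / t) * (u x * ?c x)" for x
      by (simp add: algebra_simps diff_divide_distrib)
    have lc: "(\<integral>x. c * f x - c * g x + h x \<partial>N)
        = c * integral\<^sup>L N f - c * integral\<^sup>L N g + integral\<^sup>L N h"
        "(\<integral>x. c * f x - c * g x \<partial>N) = c * integral\<^sup>L N f - c * integral\<^sup>L N g"
      if "integrable N f" "integrable N g" "integrable N h"
      for N :: "('a \<times> 'a) measure" and f g h :: "'a \<times> 'a \<Rightarrow> real" and c :: real
      using that by simp_all
    show ?thesis
      unfolding Z_def D U lc(1)[OF i Iu[OF su] Iu[OF sF]] lc(2)[OF Iu[OF su] Iu[OF su] Iu[OF sF]] e ..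
  qed
  define e where "e = (\<lambda>t. \<Sum>i\<in>I. herm_err m drift (v i) (w i) t)"
  have e: "(e \<longlongrightarrow> 0) (at_right 0)"
  proof -
    have "(e \<longlongrightarrow> (\<Sum>i\<in>I. 0)) (at_right 0)"
      unfolding e_def m_def by (intro tendsto_sum herm_err_tendsto mean_flow_derivative)
    then show ?thesis by simp
  qed
  \<comment> \<open>Finite because \<open>u\<close> is square integrable and the Gaussian has fourth
    moments; it makes the pointwise bound by \<open>e t\<close> uniform after integration.\<close>
  define B where "B = (\<integral>x. \<bar>u x\<bar> * ((norm x)\<^sup>2 + 1) \<partial>std_gaussian)"
  have IB: "integrable std_gaussian (\<lambda>x. \<bar>u x\<bar> * ((norm x)\<^sup>2 + 1))"
    by (rule integrable_std_gaussian_quadratic[where c = 1])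
      (use su in \<open>auto simp: square_integrable_def\<close>)
  have lim2: "((\<lambda>t. ?Q t) \<longlongrightarrow> ?E) (at_right 0)"
  proof (rule Lim_null_comparison[THEN LIM_zero_cancel])
    have "((\<lambda>t. e t * B) \<longlongrightarrow> 0 * B) (at_right 0)" by (intro tendsto_intros e)
    then show "((\<lambda>t. e t * B) \<longlongrightarrow> 0) (at_right 0)" by simp
    have "norm (?Q t - ?E) \<le> e t * B"
      if t: "t > 0" for t
    proof -
      have I1: "integrable std_gaussian (\<lambda>x. u x * ((?ct t x - ?c x) / t))"
      proof -
        have U: "u x * ((?ct t x - ?c x) / t) = (1 / t) * (u x * ?ct t x) - (1 / t) * (u x * ?c x)" for x
          by (simp add: algebra_simps diff_divide_distrib)
        show ?thesis
          unfolding U by (intro Bochner_Integration.integrable_diff integrable_mult_right impI Iu su)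
      qed
      have I2: "integrable std_gaussian (\<lambda>x. u x * - F x)"
        unfolding adj[symmetric] sum.distrib distrib_left by (intro Bochner_Integration.integrable_add Iu su)
      have "norm (?Q t - ?E)
          = norm (\<integral>x. u x * ((?ct t x - ?c x) / t) - u x * - F x \<partial>std_gaussian)"
        by (simp only: Bochner_Integration.integral_diff[OF I1 I2])
      also have "\<dots> \<le> (\<integral>x. e t * (\<bar>u x\<bar> * ((norm x)\<^sup>2 + 1)) \<partial>std_gaussian)"
      proof (rule Bochner_Integration.integral_norm_bound_integral)
        show "integrable std_gaussian (\<lambda>x. u x * ((?ct t x - ?c x) / t) - u x * - F x)"
          by (rule Bochner_Integration.integrable_diff[OF I1 I2])
        show "integrable std_gaussian (\<lambda>x. e t * (\<bar>u x\<bar> * ((norm x)\<^sup>2 + 1)))"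
          by (intro integrable_mult_right impI IB)
        fix x
        have "\<bar>(?ct t x - ?c x) / t - - F x\<bar> = \<bar>\<Sum>i\<in>I. (herm (m t (v i)) (m t (w i)) x - herm (v i) (w i) x) / t
          - (herm (drift (v i)) (w i) x + herm (v i) (drift (w i)) x)\<bar>"
          unfolding adj[symmetric] sum_subtractf sum_divide_distrib[symmetric] ..
        also have "\<dots> \<le> (\<Sum>i\<in>I. herm_err m drift (v i) (w i) t * ((norm x)\<^sup>2 + 1))"
          by (intro order_trans[OF sum_abs] sum_mono herm_err_bound t)
        also have "\<dots> = e t * ((norm x)\<^sup>2 + 1)" by (simp add: e_def sum_distrib_right)
        finally have b: "\<bar>(?ct t x - ?c x) / t - - F x\<bar> \<le> e t * ((norm x)\<^sup>2 + 1)" .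
        have "\<bar>u x\<bar> * \<bar>(?ct t x - ?c x) / t - - F x\<bar> \<le> \<bar>u x\<bar> * (e t * ((norm x)\<^sup>2 + 1))"
          by (rule mult_left_mono[OF b]) simp
        then show "norm (u x * ((?ct t x - ?c x) / t) - u x * - F x) \<le> e t * (\<bar>u x\<bar> * ((norm x)\<^sup>2 + 1))"
          by (simp only: right_diff_distrib[symmetric] real_norm_def abs_mult mult_ac)
      qed
      also have "\<dots> = e t * B" unfolding B_def by simp
      finally show ?thesis .
    qed
    then show "eventually (\<lambda>t. norm (?Q t - ?E) \<le> e t * B) (at_right 0)"
      unfolding eventually_at_right_field by (intro exI[of _ 1]) auto
  qed
  have "eventually (\<lambda>t. ?Q t + ?G = Z t) (at_right 0)"
    unfolding eventually_at_right_field by (intro exI[of _ 1]) (auto simp: Zeq)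
  then have "(Z \<longlongrightarrow> ?E + ?G) (at_right 0)"
    by (rule Lim_transform_eventually[rotated]) (intro tendsto_intros lim2)
  then have "?E + ?G = 0"
    using Z0 by (rule tendsto_unique[rotated]) simp
  then show ?thesis by simp
qed

end

section \<open>Asymptotic variance of quadratic observables\<close>

lemma matrix_vector_mult_minus: "m *v (- v) = - (m *v v)" "(- m) *v v = - (m *v v)"
  for m :: "real ^ 'n ^ 'm"
  by (simp_all add: matrix_vector_mult_def vec_eq_iff sum_negf)

definition hamiltonian_part :: "real \<Rightarrow> real ^ 'n ^ 'n \<Rightarrow> (real ^ 'n) \<times> (real ^ 'n) \<Rightarrow> (real ^ 'n) \<times> (real ^ 'n)" where
  "hamiltonian_part \<mu> J z = (snd z - \<mu> *\<^sub>R (J *v fst z), - fst z - \<mu> *\<^sub>R (J *v snd z))"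

lemma antisymmetric_inner:
  assumes "antisymmetric J"
  shows "(J *v x) \<bullet> y = - (x \<bullet> (J *v y))"
proof -
  have "(J *v x) \<bullet> y = x \<bullet> (transpose J *v y)"
    by (metis dot_lmul_matrix inner_commute transpose_matrix_vector)
  also have "transpose J *v y = - (J *v y)"
    using assms unfolding antisymmetric_def by (simp add: matrix_vector_mult_def vec_eq_iff sum_negf)
  finally show ?thesis by simp
qed

lemma skew_langevin_hamiltonian:
  assumes J: "antisymmetric J" and g: "\<gamma> > 0"
  shows "skew_langevin (hamiltonian_part \<mu> J) \<gamma>"
proof (rule skew_langevin.intro)
  show "linear (hamiltonian_part \<mu> J)"
    unfolding hamiltonian_part_def
    by (rule linearI) (auto simp: matrix_vector_right_distrib matrix_vector_mult_scaleR algebra_simps)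
  show "x \<bullet> hamiltonian_part \<mu> J x = 0" for x
  proof -
    have "y \<bullet> (J *v y) = 0" for y
      using antisymmetric_inner[OF J, of y y] by (simp add: inner_commute)
    then show ?thesis
      by (simp add: hamiltonian_part_def inner_prod_def inner_diff_right inner_commute)
  qed
qed (use g in auto)

text \<open>\<open>b\<close> stands in both off-diagonal blocks, so that the two mixed terms of the
  derivative along the drift lead to one and the same matrix equation.\<close>

definition block_op ::
  "real ^ 'n ^ 'n \<Rightarrow> real ^ 'n ^ 'n \<Rightarrow> real ^ 'n ^ 'n \<Rightarrow> (real ^ 'n) \<times> (real ^ 'n) \<Rightarrow> (real ^ 'n) \<times> (real ^ 'n)" where
  "block_op a b c z = (a *v fst z + b *v snd z, b *v fst z + c *v snd z)"

lemma linear_block_op: "linear (block_op a b c)"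
  unfolding block_op_def
  by (rule linearI) (auto simp: matrix_vector_right_distrib matrix_vector_mult_scaleR algebra_simps)

lemma commutator_mult_vec: "commutator J a *v x = J *v (a *v x) - a *v (J *v x)"
  by (simp add: commutator_def matrix_vector_mult_diff_rdistrib matrix_vector_mul_assoc)

text \<open>The left side is the derivative of \<open>z \<bullet> block_op a b c z\<close> along the
  drift. Moving \<open>J\<close> across the inner product turns its four position and momentum
  blocks into the three matrix equations tested on q and p.\<close>

lemma lyapunov_quadratic:
  fixes \<gamma> \<mu> :: real and J K a b c :: "real ^ 'n ^ 'n"
  assumes J: "antisymmetric J" and L: "lyapunov_blocks \<gamma> \<mu> J K a b c"
  defines "A \<equiv> \<lambda>z. hamiltonian_part \<mu> J z - (0, \<gamma> *\<^sub>R snd z)"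
  shows "A z \<bullet> block_op a b c z + z \<bullet> block_op a b c (A z) = - (fst z \<bullet> (K *v fst z))"
proof -
  obtain q p where z: "z = (q, p)" by (cases z)
  note Ji = antisymmetric_inner[OF J]
  have "(\<mu> *\<^sub>R commutator J a - 2 *\<^sub>R b) *v x = (- K) *v x"
    "(\<mu> *\<^sub>R commutator J b + a - c - \<gamma> *\<^sub>R b) *v x = 0 *v x"
    "(2 *\<^sub>R b + \<mu> *\<^sub>R commutator J c - (2 * \<gamma>) *\<^sub>R c) *v x = 0 *v x" for x
    using L by (auto simp: lyapunov_blocks_def)
  then have 1: "\<mu> *\<^sub>R (J *v (a *v x) - a *v (J *v x)) - 2 *\<^sub>R (b *v x) = - (K *v x)"
    and 2: "\<mu> *\<^sub>R (J *v (b *v x) - b *v (J *v x)) + a *v x - c *v x - \<gamma> *\<^sub>R (b *v x) = 0"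
    and 3: "2 *\<^sub>R (b *v x) + \<mu> *\<^sub>R (J *v (c *v x) - c *v (J *v x)) - (2 * \<gamma>) *\<^sub>R (c *v x) = 0" for x
    unfolding commutator_mult_vec[symmetric]
    by (simp_all add: matrix_vector_mult_diff_rdistrib matrix_vector_mult_add_rdistrib scaleR_matrix_vector_assoc
        matrix_vector_mult_minus)
  have "q \<bullet> (\<mu> *\<^sub>R (J *v (a *v q) - a *v (J *v q)) - 2 *\<^sub>R (b *v q)) = - (q \<bullet> (K *v q))"
    "p \<bullet> (\<mu> *\<^sub>R (J *v (b *v q) - b *v (J *v q)) + a *v q - c *v q - \<gamma> *\<^sub>R (b *v q)) = 0"
    "q \<bullet> (\<mu> *\<^sub>R (J *v (b *v p) - b *v (J *v p)) + a *v p - c *v p - \<gamma> *\<^sub>R (b *v p)) = 0"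
    "p \<bullet> (2 *\<^sub>R (b *v p) + \<mu> *\<^sub>R (J *v (c *v p) - c *v (J *v p)) - (2 * \<gamma>) *\<^sub>R (c *v p)) = 0"
    unfolding 1 2 3 by simp_all
  then show ?thesis
    by (simp add: A_def z hamiltonian_part_def block_op_def inner_prod_def inner_add_left inner_add_right
        inner_diff_left inner_diff_right matrix_vector_right_distrib matrix_vector_mult_diff_distrib
        matrix_vector_mult_scaleR matrix_vector_mult_minus Ji algebra_simps)
qed

text \<open>Parseval, after moving the adjoints onto x. The constant is left open, as a mean-zero
  argument determines it later.\<close>

lemma sum_herm_quadratic:
  assumes H: "linear H" and T: "linear T"
  shows "\<exists>c. \<forall>x. (\<Sum>b\<in>Basis. herm (adjoint T b) (adjoint H b) x + herm b (adjoint T (adjoint H b)) x)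
    = T x \<bullet> H x + x \<bullet> H (T x) - (c :: real)"
proof (intro exI allI)
  fix x :: "'a::euclidean_space"
  have 1: "adjoint T b \<bullet> y = b \<bullet> T y" "adjoint H b \<bullet> y = b \<bullet> H y" for b y
    using adjoint_works[OF T, of y b] adjoint_works[OF H, of y b] by (simp_all add: inner_commute)
  have 2: "(\<Sum>b\<in>Basis. (b \<bullet> y) * (b \<bullet> z)) = y \<bullet> z" for y z :: 'a
    by (simp add: euclidean_inner[of y z] inner_commute)
  show "(\<Sum>b\<in>Basis. herm (adjoint T b) (adjoint H b) x + herm b (adjoint T (adjoint H b)) x)
    = T x \<bullet> H x + x \<bullet> H (T x)
      - (\<Sum>b\<in>(Basis :: 'a set). adjoint T b \<bullet> adjoint H b + b \<bullet> adjoint T (adjoint H b))"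
    unfolding herm_def by (simp add: 1[of _ x] 1(2)[of _ "T x"] sum.distrib sum_subtractf 2)
qed

definition quad_obs :: "real ^ 'n ^ 'n \<Rightarrow> (real ^ 'n) \<times> (real ^ 'n) \<Rightarrow> real" where
  "quad_obs K x = fst x \<bullet> (K *v fst x) - trace K"

lemma quad_obs_herm:
  assumes sym: "transpose K = K"
  shows "quad_obs K x = (\<Sum>i\<in>UNIV. herm (axis i 1, 0) (K *v axis i 1, 0) x)"
proof -
  have "axis i 1 \<bullet> fst x * ((K *v axis i 1) \<bullet> fst x) = fst x $ i * (K *v fst x) $ i" for i
  proof -
    have "(K *v axis i 1) \<bullet> fst x = axis i 1 \<bullet> (K *v fst x)"
      by (metis dot_lmul_matrix inner_commute sym transpose_matrix_vector)
    then show ?thesis by (simp add: inner_axis')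
  qed
  moreover have "axis i 1 \<bullet> (K *v axis i 1) = K $ i $ i" for i
    by (simp add: inner_axis' matrix_vector_mult_basis column_def)
  ultimately show ?thesis
    by (simp add: quad_obs_def herm_def inner_prod_def sum_subtractf trace_def inner_vec_def)
qed

text \<open>Equal quadratic parts suffice, since both sides have mean zero.\<close>

lemma herm_sum_eq_quad_obs:
  fixes K :: "real ^ 'n ^ 'n" and v w v' w' :: "'i \<Rightarrow> (real ^ 'n) \<times> (real ^ 'n)"
  assumes sym: "transpose K = K"
    and eq: "\<And>x. (\<Sum>i\<in>I. herm (v i) (w i) x + herm (v' i) (w' i) x) = - (fst x \<bullet> (K *v fst x)) - c"
  shows "(\<Sum>i\<in>I. herm (v i) (w i) x + herm (v' i) (w' i) x) = - quad_obs K x"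
proof -
  define d where "d = - trace K - c"
  have e: "(\<Sum>i\<in>I. herm (v i) (w i) x + herm (v' i) (w' i) x) + quad_obs K x = d" for x
    by (simp add: eq quad_obs_def d_def)
  have "(\<integral>x. (\<Sum>i\<in>I. herm (v i) (w i) x + herm (v' i) (w' i) x) + quad_obs K x \<partial>std_gaussian) = 0"
    unfolding quad_obs_herm[OF sym] by (simp add: integrable_herm integral_herm)
  then have "d = 0"
    unfolding e by simp
  then show ?thesis using e[of x] by simp
qed

lemma inner_matrix_columns:
  fixes A B :: "real ^ 'n ^ 'm"
  shows "(\<Sum>i\<in>UNIV. (A *v axis i 1) \<bullet> (B *v axis i 1)) = A \<bullet> B"
proof -
  have "(\<Sum>i\<in>UNIV. (A *v axis i 1) \<bullet> (B *v axis i 1)) = (\<Sum>i\<in>UNIV. \<Sum>j\<in>UNIV. A $ j $ i * B $ j $ i)"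
    by (simp add: matrix_vector_mult_basis column_def inner_vec_def)
  also have "\<dots> = A \<bullet> B" by (subst sum.swap) (simp add: inner_vec_def)
  finally show ?thesis .
qed

text \<open>Two Lyapunov equations enter. The one with \<open>\<mu>\<close> only shows that a
  solution exists; the value comes from the dual one, with \<open>- \<mu>\<close>, because reversing
  the momentum conjugates the adjoint drift to the drift with \<open>\<mu>\<close> negated.\<close>

lemma asymptotic_variance_eq:
  fixes M :: "'w measure" and W :: "real \<Rightarrow> 'w \<Rightarrow> real ^ 'n"
    and \<gamma> \<mu> :: real and J K a b c :: "real ^ 'n ^ 'n"
  assumes bm: "brownian_motion M W" and g: "\<gamma> > 0" and J: "antisymmetric J" and sym: "transpose K = K"
    and L: "lyapunov_blocks \<gamma> (- \<mu>) J K a b c"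
  shows "asymptotic_variance M W \<gamma> (\<lambda>q. q \<bullet> (K *v q) - trace K) \<mu> J = 2 * (a \<bullet> K)"
proof -
  define S where "S = hamiltonian_part \<mu> J"
  have skS: "skew_langevin S \<gamma>" unfolding S_def by (rule skew_langevin_hamiltonian[OF J g])
  interpret langevin_process S \<gamma> M W
    by (intro langevin_process.intro skS langevin_process_axioms.intro bm)
  let ?f = "\<lambda>q. q \<bullet> (K *v q) - trace K"
  define F where "F = quad_obs K"
  have Ff: "F x = ?f (fst x)" for x by (simp add: F_def quad_obs_def)
  have dr: "langevin_drift \<gamma> \<mu> J = drift"
    unfolding fun_eq_iff drift_def by (simp add: langevin_drift_def S_def hamiltonian_part_def split_beta)
  have sol: "langevin_solution \<gamma> \<mu> J = solution"
    by (intro ext) (simp add: langevin_solution_def solution_def dr)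
  have P: "langevin_semigroup M W \<gamma> \<mu> J = sg"
    by (intro ext) (simp only: langevin_semigroup_def sg_def Y_def langevin_flow_def flow_def sol)
  have fF: "(\<lambda>(q, p). - ?f q) = (\<lambda>x. - F x)" by (auto simp: Ff fun_eq_iff)
  have lin: "linear (block_op a b c)" for a b c :: "real ^ 'n ^ 'n" by (rule linear_block_op)
  have drift: "drift z = hamiltonian_part \<mu> J z - (0, \<gamma> *\<^sub>R snd z)" for z
    unfolding drift_def by (simp add: S_def)
  \<comment> \<open>Existence makes the \<open>SOME\<close> in the definition return a genuine
    solution, not necessarily the quadratic one built here.\<close>
  have ex: "\<exists>u. poisson_solution M W \<gamma> \<mu> J ?f u"
  proof -
    obtain a1 b1 c1 where L1: "lyapunov_blocks \<gamma> \<mu> J K a1 b1 c1"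
      by (rule lyapunov_blocks_exists[OF J g])
    define H where "H = block_op a1 b1 c1"
    have lH: "linear H" unfolding H_def by (rule lin)
    obtain k where k: "\<And>x. (\<Sum>b\<in>Basis. herm (adjoint drift b) (adjoint H b) x + herm b (adjoint drift (adjoint H b)) x)
        = drift x \<bullet> H x + x \<bullet> H (drift x) - k"
      using sum_herm_quadratic[OF lH linear_drift] by auto
    have "drift x \<bullet> H x + x \<bullet> H (drift x) = - (fst x \<bullet> (K *v fst x))" for x
      unfolding drift H_def by (rule lyapunov_quadratic[OF J L1])
    then have e: "(\<Sum>b\<in>Basis. herm (adjoint drift b) (adjoint H b) x + herm b (adjoint drift (adjoint H b)) x) = - F x" for x
      unfolding F_def by (intro herm_sum_eq_quad_obs[OF sym, where c = k]) (simp add: k)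
    have "L2_generator std_gaussian sg (\<lambda>x. \<Sum>b\<in>Basis. herm b (adjoint H b) x) (\<lambda>x. - F x)"
      using generator_herm_sum[of Basis "\<lambda>b. b" "\<lambda>b. adjoint H b"] by (simp add: e)
    moreover have "(\<integral>x. (\<Sum>b\<in>Basis. herm b (adjoint H b) x) \<partial>std_gaussian) = 0"
      by (simp add: integrable_herm integral_herm)
    ultimately show ?thesis
      unfolding poisson_solution_def P fF by blast
  qed
  define u where "u = (SOME u. poisson_solution M W \<gamma> \<mu> J ?f u)"
  have "poisson_solution M W \<gamma> \<mu> J ?f u"
    unfolding u_def by (rule someI_ex[OF ex])
  then have u: "L2_generator std_gaussian sg u (\<lambda>x. - F x)"
    unfolding poisson_solution_def P fF by blast
  \<comment> \<open>The momentum reversal conjugates the blocks: only the mixed block changes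
    sign.\<close>
  define H where "H = block_op a (- b) c"
  have lH: "linear H" unfolding H_def by (rule lin)
  define A' where "A' = adjoint drift"
  have lA': "linear A'" unfolding A'_def by (rule adjoint_linear[OF linear_drift])
  have A'_eq: "A' z = (- snd z + \<mu> *\<^sub>R (J *v fst z), fst z + \<mu> *\<^sub>R (J *v snd z) - \<gamma> *\<^sub>R snd z)" for z
  proof (rule vector_eq_ldot[THEN iffD1], rule allI)
    fix y
    have "y \<bullet> A' z = drift y \<bullet> z" unfolding A'_def by (rule adjoint_works[OF linear_drift])
    moreover have "fst z \<bullet> (J *v fst y) = - (fst y \<bullet> (J *v fst z))" "snd z \<bullet> (J *v snd y) = - (snd y \<bullet> (J *v snd z))"
      using antisymmetric_inner[OF J] by (metis inner_commute)+
    ultimately show "y \<bullet> A' z = y \<bullet> (- snd z + \<mu> *\<^sub>R (J *v fst z), fst z + \<mu> *\<^sub>R (J *v snd z) - \<gamma> *\<^sub>R snd z)"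
      by (simp add: drift hamiltonian_part_def inner_prod_def inner_diff_left inner_diff_right
          inner_add_left inner_add_right antisymmetric_inner[OF J] inner_commute algebra_simps)
  qed
  have AA: "adjoint A' = drift" unfolding A'_def by (rule adjoint_adjoint[OF linear_drift])
  have quad: "A' x \<bullet> H x + x \<bullet> H (A' x) = - (fst x \<bullet> (K *v fst x))" for x
  proof -
    define y where "y = (fst x, - snd x)"
    define B where "B = hamiltonian_part (- \<mu>) J y - (0, \<gamma> *\<^sub>R snd y)"
    have A'x: "A' x = (fst B, - snd B)"
      by (simp add: A'_eq B_def hamiltonian_part_def y_def matrix_vector_mult_minus)
    have flip: "H (q, - p) = (fst (block_op a b c (q, p)), - snd (block_op a b c (q, p)))" for q p
      by (simp add: H_def block_op_def matrix_vector_mult_minus)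
    have Hx: "H x = (fst (block_op a b c y), - snd (block_op a b c y))"
      using flip[of "fst x" "- snd x"] by (simp add: y_def)
    have HA: "H (A' x) = (fst (block_op a b c B), - snd (block_op a b c B))"
      using flip[of "fst B" "snd B"] by (simp add: A'x)
    have "A' x \<bullet> H x = B \<bullet> block_op a b c y"
      unfolding A'x Hx by (simp add: inner_prod_def)
    moreover have "x \<bullet> H (A' x) = y \<bullet> block_op a b c B"
      unfolding HA by (simp add: inner_prod_def y_def)
    ultimately have "A' x \<bullet> H x + x \<bullet> H (A' x) = B \<bullet> block_op a b c y + y \<bullet> block_op a b c B" by simp
    also have "\<dots> = - (fst y \<bullet> (K *v fst y))"
      unfolding B_def by (rule lyapunov_quadratic[OF J L])
    finally show ?thesis by (simp add: y_def)
  qed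
  obtain k where k: "\<And>x. (\<Sum>b\<in>Basis. herm (drift b) (adjoint H b) x + herm b (drift (adjoint H b)) x)
      = A' x \<bullet> H x + x \<bullet> H (A' x) - k"
    using sum_herm_quadratic[OF lH lA'] unfolding AA by auto
  have e: "(\<Sum>b\<in>Basis. herm (drift b) (adjoint H b) x + herm b (drift (adjoint H b)) x) = - F x" for x
    unfolding F_def by (rule herm_sum_eq_quad_obs[OF sym, where c = k]) (simp add: k quad)
  have "asymptotic_variance M W \<gamma> ?f \<mu> J = (\<integral>x. u x * F x \<partial>std_gaussian)"
    by (simp add: asymptotic_variance_def u_def Ff)
  also have "\<dots> = (\<integral>x. F x * (\<Sum>b\<in>Basis. herm b (adjoint H b) x) \<partial>std_gaussian)"
    by (rule poisson_pairing[OF _ u e]) simp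
  also have "\<dots> = (\<Sum>i\<in>UNIV. \<Sum>b\<in>Basis. \<integral>x. herm (axis i 1, 0) (K *v axis i 1, 0) x * herm b (adjoint H b) x \<partial>std_gaussian)"
  proof -
    have I: "integrable std_gaussian (\<lambda>x. herm v w x * herm v' w' x)" for v w v' w' :: "(real ^ 'n) \<times> (real ^ 'n)"
      using integrable_mult_herm[OF square_integrable_herm_sum[of "\<lambda>_. v" "\<lambda>_. w" "{()}"], of v' w'] by simp
    show ?thesis
      unfolding F_def quad_obs_herm[OF sym] sum_product using I by simp
  qed
  \<comment> \<open>Each of the two Wick pairings, summed over the basis, becomes an inner product
    with \<open>H\<close>. The momentum components are zero, so only the block \<open>a\<close> will
    survive, once from each pairing.\<close>
  also have "\<dots> = (\<Sum>i\<in>UNIV. (axis i 1, 0) \<bullet> H (K *v axis i 1, 0) + (K *v axis i 1, 0) \<bullet> H (axis i 1, 0))"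
  proof (rule sum.cong[OF refl])
    fix i :: 'n
    have s: "(\<Sum>b\<in>Basis. (y \<bullet> b) * (z \<bullet> adjoint H b)) = y \<bullet> H z" for y z
      by (simp add: euclidean_inner[of y "H z"] adjoint_works[OF lH])
    show "(\<Sum>b\<in>Basis. \<integral>x. herm (axis i 1, 0) (K *v axis i 1, 0) x * herm b (adjoint H b) x \<partial>std_gaussian)
        = (axis i 1, 0) \<bullet> H (K *v axis i 1, 0) + (K *v axis i 1, 0) \<bullet> H (axis i 1, 0)"
      unfolding integral_herm_herm sum.distrib s
      by (simp add: s[symmetric] mult.commute)
  qed
  also have "\<dots> = (\<Sum>i\<in>UNIV. (mat 1 *v axis i 1) \<bullet> ((a ** K) *v axis i 1) + (K *v axis i 1) \<bullet> (a *v axis i 1))"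
    by (intro sum.cong refl) (simp add: H_def block_op_def inner_prod_def matrix_vector_mul_assoc)
  also have "\<dots> = 2 * (a \<bullet> K)"
    unfolding sum.distrib inner_matrix_columns
    using matrix_mult_inner_right[of a K "mat 1"] by (simp add: sym inner_commute)
  finally show ?thesis .
qed

theorem lemma8:
  fixes M :: "'w measure" and W :: "real \<Rightarrow> 'w \<Rightarrow> real ^ 'n"
    and \<gamma> :: real and K K0 K1 :: "real ^ 'n ^ 'n" and f f0 f1 :: "real ^ 'n \<Rightarrow> real"
  assumes "brownian_motion M W"
    and "\<gamma> > 0"
    and "transpose K = K"
    and "f = (\<lambda>q. q \<bullet> (K *v q) - trace K)"
    and "K0 = K - (trace K / real CARD('n)) *\<^sub>R mat 1"
    and "K1 = (trace K / real CARD('n)) *\<^sub>R mat 1"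
    and "f0 = (\<lambda>q. q \<bullet> (K0 *v q))"
    and "f1 = (\<lambda>q. q \<bullet> (K1 *v q) - trace K)"
  shows "(\<forall>q. f q = f0 q + f1 q)
    \<and> (\<exists>J. antisymmetric J \<and> ((\<lambda>\<mu>. asymptotic_variance M W \<gamma> f0 \<mu> J) \<longlongrightarrow> 0) at_top)
    \<and> (\<exists>U. orthogonal_matrix U \<and> (\<forall>i. (U ** K0 ** transpose U) $ i $ i = 0))
    \<and> (\<forall>U a Jbar J.
         orthogonal_matrix U \<and> (\<forall>i. (U ** K0 ** transpose U) $ i $ i = 0) \<and> inj a
         \<and> Jbar = (\<chi> i j. if i = j then 0 else (U ** K0 ** transpose U) $ i $ j / (a i - a j))
         \<and> J = transpose U ** Jbar ** U
         \<longrightarrow> antisymmetric J \<and> ((\<lambda>\<mu>. asymptotic_variance M W \<gamma> f0 \<mu> J) \<longlongrightarrow> 0) at_top)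
    \<and> (\<forall>\<mu> J J'. antisymmetric J \<and> antisymmetric J'
         \<longrightarrow> asymptotic_variance M W \<gamma> f1 \<mu> J = asymptotic_variance M W \<gamma> f1 0 J')"
proof -
  note bm = assms(1) and g = assms(2) and sym = assms(3)
  define \<kappa> where "\<kappa> = trace K / real CARD('n)"
  have tr1: "trace (mat 1 :: real ^ 'n ^ 'n) = real CARD('n)"
    by (simp add: trace_def mat_def)
  have trs: "trace (r *\<^sub>R A) = r * trace A" for r and A :: "real ^ 'n ^ 'n"
    by (simp add: trace_def sum_distrib_left)
  have K0: "K0 = K - \<kappa> *\<^sub>R mat 1" and K1: "K1 = \<kappa> *\<^sub>R mat 1"
    using assms(5,6) by (simp_all add: \<kappa>_def)
  have trK1: "trace K1 = trace K" by (simp add: K1 trs tr1 \<kappa>_def)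
  have trK0: "trace K0 = 0" using trK1 by (simp add: K0 trace_sub K1)
  have tm: "transpose (r *\<^sub>R mat 1) = (r *\<^sub>R mat 1 :: real ^ 'n ^ 'n)" for r
    by (simp add: transpose_def mat_def vec_eq_iff)
  have symK0: "transpose K0 = K0" by (simp add: K0 transpose_diff tm sym)
  \<comment> \<open>As \<open>K0\<close> has trace zero, \<open>f0\<close> is already centered and
    fits the general formula.\<close>
  have f0: "f0 = (\<lambda>q. q \<bullet> (K0 *v q) - trace K0)" using assms(7) by (simp add: trK0)
  have f1: "f1 = (\<lambda>q. q \<bullet> (K1 *v q) - trace K1)" using assms(8) by (simp add: trK1)
  have sum: "f q = f0 q + f1 q" for q
  proof -
    have "K = K0 + K1" by (simp add: K0 K1)
    then have "K *v q = K0 *v q + K1 *v q" by (metis matrix_vector_mult_add_rdistrib)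
    then show ?thesis unfolding assms(4) assms(7) assms(8) by (simp add: inner_add_right)
  qed
  have lim: "((\<lambda>\<mu>. asymptotic_variance M W \<gamma> f0 \<mu> J) \<longlongrightarrow> 0) at_top"
    if J: "antisymmetric J" and G: "K0 = commutator J G" for J G
  proof (rule Lim_null_comparison)
    have "\<bar>asymptotic_variance M W \<gamma> f0 \<mu> J\<bar> \<le> 4 * (norm G)\<^sup>2 / (\<gamma> * \<mu>\<^sup>2)" if "\<mu> > 0" for \<mu>
    proof -
      obtain a b c where L: "lyapunov_blocks \<gamma> (- \<mu>) J K0 a b c"
        by (rule lyapunov_blocks_exists[OF J g])
      have "asymptotic_variance M W \<gamma> f0 \<mu> J = 2 * (a \<bullet> K0)"
        unfolding f0 by (rule asymptotic_variance_eq[OF bm g J symK0 L])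
      moreover have "\<bar>a \<bullet> K0\<bar> \<le> 2 * (norm G)\<^sup>2 / (\<gamma> * (- \<mu>)\<^sup>2)"
        \<comment> \<open>The sign of \<open>- \<mu>\<close> disappears in the square.\<close>
        unfolding G by (rule lyapunov_blocks_range_bound[OF J g]) (use that L G in auto)
      ultimately show ?thesis by simp
    qed
    then show "eventually (\<lambda>\<mu>. norm (asymptotic_variance M W \<gamma> f0 \<mu> J) \<le> 4 * (norm G)\<^sup>2 / (\<gamma> * \<mu>\<^sup>2)) at_top"
      by (intro eventually_mono[OF eventually_gt_at_top[of 0]]) simp
    show "((\<lambda>\<mu>. 4 * (norm G)\<^sup>2 / (\<gamma> * \<mu>\<^sup>2)) \<longlongrightarrow> 0) at_top"
      using g by real_asymp
  qed
  have construct: "antisymmetric J \<and> ((\<lambda>\<mu>. asymptotic_variance M W \<gamma> f0 \<mu> J) \<longlongrightarrow> 0) at_top"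
    if "orthogonal_matrix U" "\<forall>i. (U ** K0 ** transpose U) $ i $ i = 0" "inj a"
      "Jbar = (\<chi> i j. if i = j then 0 else (U ** K0 ** transpose U) $ i $ j / (a i - a j))"
      "J = transpose U ** Jbar ** U" for U a Jbar J
    using antisymmetric_potential[OF symK0 that(1-4)] lim unfolding that(5) by blast
  obtain U where U: "orthogonal_matrix U" "\<forall>i. (U ** K0 ** transpose U) $ i $ i = 0"
    by (rule orthogonal_zero_diagonal[OF trK0])
  \<comment> \<open>Pairwise distinct reals, taken from a numbering of the finite index
    type.\<close>
  obtain a :: "'n \<Rightarrow> real" where a: "inj a"
  proof -
    obtain h :: "'n \<Rightarrow> nat" where "inj h"
      using finite_imp_inj_to_nat_seg[of "UNIV :: 'n set"] by auto
    then have "inj (\<lambda>i. real (h i))" by (auto simp: inj_def)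
    then show ?thesis by (rule that)
  qed
  \<comment> \<open>The right side mentions neither \<open>\<mu>\<close> nor \<open>J\<close>,
    because one triple of scalar matrices solves the Lyapunov equation for all of them.\<close>
  have b: "asymptotic_variance M W \<gamma> f1 \<mu> J = 2 * ((\<kappa> * (1 / (2 * \<gamma>) + \<gamma> / 2)) *\<^sub>R mat 1 \<bullet> K1)"
    if "antisymmetric J" for \<mu> J
    unfolding f1 by (rule asymptotic_variance_eq[OF bm g that])
      (use lyapunov_blocks_scalar[OF g] in \<open>auto simp: K1 tm\<close>)
  show ?thesis
  proof (intro conjI)
    show "\<forall>q. f q = f0 q + f1 q" by (intro allI sum)
    show "\<exists>J. antisymmetric J \<and> ((\<lambda>\<mu>. asymptotic_variance M W \<gamma> f0 \<mu> J) \<longlongrightarrow> 0) at_top"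
      by (rule exI, rule construct[OF U a refl refl])
    show "\<exists>U. orthogonal_matrix U \<and> (\<forall>i. (U ** K0 ** transpose U) $ i $ i = 0)"
      using U by blast
  qed (intro allI impI, elim conjE, rule construct, assumption+, intro allI impI, elim conjE, simp only: b)
qed

end
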